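(* Let $C$ be a smooth complex quartic curve in $\mathbb{P}^{2}_{\mathbb{C}}$ and let $\mathcal{L}$ be the associated arrangement of the $28$ bitangent lines. Then the number of quadruple intersection points of $\mathcal{L}$ is equal to the number of (non-trivial) involutions of $C$. Moreover, the number of quadruple intersection points of $\mathcal{L}$ is less than or equal to $21$, and this upper bound is achieved for the $28$ bitangents to the Klein quartic curve.
   Context: A bitangent of a smooth plane quartic is a line tangent to the curve at two points, which are allowed to coincide, i.e. the line cuts out a divisor $2P+2P'$ on the curve, with $P=P'$ allowed; a smooth complex plane quartic has exactly $28$ bitangents in this sense. A quadruple point of a line arrangement is a point lying on exactly four of the lines. An involution of $C$ is an automorphism of $C$ of order $2$. The Klein quartic is the smooth plane curve $x^4 + y^4 + z^4 + \lambda(x^2y^2 + x^2z^2 + y^2z^2)=0$, where $\lambda$ is either root of $\lambda^2+3\lambda+18=0$. *)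

theory Defs
  imports "HOL-Analysis.Analysis" "HOL-Library.Poly_Mapping" "HOL-Library.FuncSet"
    "HOL-Computational_Algebra.Polynomial"
begin

text \<open>The polynomial ring \<open>\<complex>[x\<^sub>1, x\<^sub>2, x\<^sub>3]\<close>, as the monoid ring over exponent vectors.\<close>

type_synonym tpoly = "(3 \<Rightarrow>\<^sub>0 nat) \<Rightarrow>\<^sub>0 complex"

definition X :: "3 \<Rightarrow> tpoly" where
  "X i = Poly_Mapping.single (Poly_Mapping.single i 1) 1"

definition const :: "complex \<Rightarrow> tpoly" where
  "const c = Poly_Mapping.single 0 c"

text \<open>Substitution into a polynomial, with coefficients mapped along \<open>h\<close>; used with values
  in the complex numbers and in the univariate polynomials.\<close>

definition subst :: "(complex \<Rightarrow> 'a::comm_semiring_1) \<Rightarrow> tpoly \<Rightarrow> 'a ^ 3 \<Rightarrow> 'a" where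
  "subst h F v =
     (\<Sum>m\<in>Poly_Mapping.keys F.
        h (Poly_Mapping.lookup F m) * (\<Prod>i\<in>UNIV. (v $ i) ^ Poly_Mapping.lookup m i))"

definition eval :: "tpoly \<Rightarrow> complex ^ 3 \<Rightarrow> complex" where
  "eval F v = subst (\<lambda>c. c) F v"

definition homogeneous :: "nat \<Rightarrow> tpoly \<Rightarrow> bool" where
  "homogeneous d F \<longleftrightarrow>
     (\<forall>m\<in>Poly_Mapping.keys F. (\<Sum>i\<in>UNIV. Poly_Mapping.lookup m i) = d)"

text \<open>Truncated subtraction in the exponent is harmless: such terms have coefficient 0.\<close>

definition partial_deriv :: "3 \<Rightarrow> tpoly \<Rightarrow> tpoly" where
  "partial_deriv i F =
     (\<Sum>m\<in>Poly_Mapping.keys F.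
        Poly_Mapping.single (m - Poly_Mapping.single i 1)
          (of_nat (Poly_Mapping.lookup m i) * Poly_Mapping.lookup F m))"

text \<open>Points and lines of the complex projective plane are the one- and two-dimensional
  complex subspaces of \<open>\<complex>\<^sup>3\<close>; incidence is inclusion. (The prefix \<open>vec\<close> selects the
  complex, not the real, vector space structure.)\<close>

definition proj_points :: "(complex ^ 3) set set" where
  "proj_points = {P. vec.subspace P \<and> vec.dim P = 1}"

definition proj_lines :: "(complex ^ 3) set set" where
  "proj_lines = {L. vec.subspace L \<and> vec.dim L = 2}"

definition curve :: "tpoly \<Rightarrow> (complex ^ 3) set set" where
  "curve F = {P \<in> proj_points. \<forall>v\<in>P. eval F v = 0}"

definition smooth_curve :: "tpoly \<Rightarrow> bool" where
  "smooth_curve F \<longleftrightarrow>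
     \<not> (\<exists>v. v \<noteq> 0 \<and> eval F v = 0 \<and> (\<forall>i. eval (partial_deriv i F) v = 0))"

definition smooth_quartic :: "tpoly \<Rightarrow> bool" where
  "smooth_quartic F \<longleftrightarrow> homogeneous 4 F \<and> smooth_curve F"

text \<open>The polynomial \<open>F(u + t w)\<close> in \<open>t\<close>.\<close>

definition restrict_to_line :: "tpoly \<Rightarrow> complex ^ 3 \<Rightarrow> complex ^ 3 \<Rightarrow> complex poly" where
  "restrict_to_line F u w = subst (\<lambda>c. [:c:]) F (\<chi> i. [:u $ i, w $ i:])"

text \<open>The line \<open>L\<close> is not a component of the curve and meets it at the point \<open>Q\<close> of \<open>L\<close>
  with intersection multiplicity \<open>n\<close>: if \<open>u\<close> represents \<open>Q\<close> and \<open>w\<close> is a second vector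
  spanning \<open>L\<close>, then \<open>t\<close> is a local coordinate on \<open>L\<close> at \<open>Q = [u + 0 w]\<close>. The order does
  not depend on the choice of \<open>u\<close> and \<open>w\<close>.\<close>

definition meets_with_mult ::
    "tpoly \<Rightarrow> (complex ^ 3) set \<Rightarrow> (complex ^ 3) set \<Rightarrow> nat \<Rightarrow> bool" where
  "meets_with_mult F L Q n \<longleftrightarrow>
     (\<forall>u\<in>Q - {0}. \<forall>w\<in>L - Q.
        restrict_to_line F u w \<noteq> 0 \<and> Polynomial.order 0 (restrict_to_line F u w) = n)"

text \<open>The divisor cut out by \<open>L\<close> on the curve is \<open>2P + 2P'\<close>, where \<open>P = P'\<close> is allowed.\<close>

definition bitangents :: "tpoly \<Rightarrow> (complex ^ 3) set set" where
  "bitangents F = {L \<in> proj_lines.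
     \<exists>P\<in>proj_points. \<exists>P'\<in>proj_points. P \<subseteq> L \<and> P' \<subseteq> L \<and>
       (\<forall>Q\<in>proj_points. Q \<subseteq> L \<longrightarrow>
          meets_with_mult F L Q ((if Q = P then 2 else 0) + (if Q = P' then 2 else 0)))}"

definition quadruple_points :: "(complex ^ 3) set set \<Rightarrow> (complex ^ 3) set set" where
  "quadruple_points A = {P \<in> proj_points. card {L \<in> A. P \<subseteq> L} = 4}"

definition apply_forms :: "(3 \<Rightarrow> tpoly) \<Rightarrow> complex ^ 3 \<Rightarrow> complex ^ 3" where
  "apply_forms G v = (\<chi> i. eval (G i) v)"

text \<open>Morphisms from the curve to itself: near each point \<open>P\<close> the map is
  \<open>[G\<^sub>1 : G\<^sub>2 : G\<^sub>3]\<close> with forms of a common degree that do not all vanish at \<open>P\<close>. Multiplying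
  the \<open>G\<^sub>i\<close> by a further form which does not vanish at \<open>P\<close> shrinks the open set where they
  do not all vanish, so it is no restriction to require the formula on that entire set.\<close>

definition regular_self_map ::
    "tpoly \<Rightarrow> ((complex ^ 3) set \<Rightarrow> (complex ^ 3) set) \<Rightarrow> bool" where
  "regular_self_map F f \<longleftrightarrow> f \<in> curve F \<rightarrow> curve F \<and>
     (\<forall>P\<in>curve F. \<exists>d G. (\<forall>i. homogeneous d (G i)) \<and>
        (\<exists>v\<in>P - {0}. apply_forms G v \<noteq> 0) \<and>
        (\<forall>Q\<in>curve F. \<forall>v\<in>Q - {0}.
           apply_forms G v \<noteq> 0 \<longrightarrow> f Q = vec.span {apply_forms G v}))"

text \<open>Automorphisms are made extensional (undefined off the curve), so that distinct functions
  are distinct automorphisms.\<close>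

definition automorphisms :: "tpoly \<Rightarrow> ((complex ^ 3) set \<Rightarrow> (complex ^ 3) set) set" where
  "automorphisms F = {f \<in> extensional (curve F).
     bij_betw f (curve F) (curve F) \<and>
     regular_self_map F f \<and> regular_self_map F (inv_into (curve F) f)}"

definition involutions :: "tpoly \<Rightarrow> ((complex ^ 3) set \<Rightarrow> (complex ^ 3) set) set" where
  "involutions F = {f \<in> automorphisms F.
     f \<noteq> (\<lambda>P\<in>curve F. P) \<and> compose (curve F) f f = (\<lambda>P\<in>curve F. P)}"

definition klein_quartic :: "complex \<Rightarrow> tpoly" where
  "klein_quartic l = X 1 ^ 4 + X 2 ^ 4 + X 3 ^ 4 +
     const l * (X 1 ^ 2 * X 2 ^ 2 + X 1 ^ 2 * X 3 ^ 2 + X 2 ^ 2 * X 3 ^ 2)"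

end

theory Submission
  imports Defs "HOL-Computational_Algebra.Fundamental_Theorem_Algebra"
begin

text \<open>Let \<open>p\<close> lie on four bitangents. Then \<open>p\<close> is not on the curve, and in coordinates \<open>x p + w\<close> with
  \<open>w\<close> in a suitable plane \<open>W\<close> the equation is \<open>x\<^sup>4 + q(w) x\<^sup>2 + r(w) x + g(w)\<close>. The line through \<open>p\<close> and \<open>w\<close>
  is a bitangent iff \<open>r(w) = 0\<close> and \<open>q(w)\<^sup>2 = 4 g(w)\<close>; four zeros make the cubic \<open>r\<close> vanish, so that
  the reflection \<open>x \<mapsto> -x\<close> preserves the curve. Conversely \<open>q\<^sup>2 - 4 g\<close> has four simple zeros by
  smoothness. So quadruple points are the centers of the reflections that preserve the curve.

  Given one such reflection, a bitangent \<open>x = \<ell>(w)\<close> not through \<open>p\<close> amounts to a factorisation of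
  \<open>q\<^sup>2/4 - g\<close> into two quadratics with a discriminant condition, which leaves at most 24 lines.
  A bitangent contains at most three centers, hence there are at most \<open>3 \<cdot> 28 / 4 = 21\<close>.

  An involution of the curve pulls back the regular differentials, which are the linear forms times
  a fixed residue form, so it is induced by a linear map; an involution of the plane is a reflection.\<close>

section \<open>Coordinates, forms and gradients on \<open>\<complex>\<^sup>3\<close>\<close>

text \<open>The curve is treated through polynomial functions on its cone in \<open>c3\<close>.
  Projection from a point off the curve makes the equation monic, up to a constant, in one variable,
  with four distinct zeros over all but finitely many parameters. Division with remainder then does
  the work of coordinate rings: a polynomial of degree below four in that variable that vanishes on
  the curve is zero.

  A regular self-map is known only through local formulas of unrelated degrees. What glues is not
  the formula \<open>G\<close> but the section \<open>J *s G\<close> of O(1), where \<open>J\<close>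
  is the factor by which \<open>G\<close> pulls back the residue form. This is the canonical
  embedding of the quartic written out in vectors.

  The 28 enters as an upper bound derived from a center: 4 lines through it and 24 = 3 * 4 * 2
  others, for three ways to split four roots into two pairs, four scale factors, and two signs of
  the linear form. The 3 centers on a bitangent come from a cubic equation for the ratio of their
  coordinates. For the Klein quartic 21 centers are written down, and the general bound forces
  equality.\<close>

type_synonym c3 = "complex ^ 3"

text \<open>Bilinear, without complex conjugation: \<open>cdot a\<close> has to be a linear form,
  and \<open>cdot\<close> polynomial in both arguments.\<close>

definition cdot :: "c3 \<Rightarrow> c3 \<Rightarrow> complex" where
  "cdot a b = a $ 1 * b $ 1 + a $ 2 * b $ 2 + a $ 3 * b $ 3"

definition ccross :: "c3 \<Rightarrow> c3 \<Rightarrow> c3" where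
  "ccross a b = vector [a $ 2 * b $ 3 - a $ 3 * b $ 2, a $ 3 * b $ 1 - a $ 1 * b $ 3,
     a $ 1 * b $ 2 - a $ 2 * b $ 1]"

definition cdet :: "c3 \<Rightarrow> c3 \<Rightarrow> c3 \<Rightarrow> complex" where
  "cdet a b c = cdot a (ccross b c)"

lemmas c3_simps = cdot_def ccross_def cdet_def vec_eq_iff forall_3 vector_3

lemma cdot_add_right [simp]: "cdot a (v + w) = cdot a v + cdot a w"
  and cdot_add_left [simp]: "cdot (a + b) v = cdot a v + cdot b v"
  and cdot_diff_right [simp]: "cdot a (v - w) = cdot a v - cdot a w"
  and cdot_diff_left [simp]: "cdot (a - b) v = cdot a v - cdot b v"
  and cdot_scale_right [simp]: "cdot a (c *s v) = c * cdot a v"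
  and cdot_scale_left [simp]: "cdot (c *s a) v = c * cdot a v"
  and cdot_minus_right [simp]: "cdot a (- v) = - cdot a v"
  and cdot_zero_right [simp]: "cdot a 0 = 0"
  and cdot_zero_left [simp]: "cdot 0 a = 0"
  by (simp_all add: cdot_def algebra_simps)

lemma cdot_commute: "cdot a b = cdot b a"
  by (simp add: cdot_def algebra_simps)

lemma cdot_axis [simp]: "cdot (axis i 1) v = v $ i" "cdot v (axis i 1) = v $ i"
  using exhaust_3[of i] by (auto simp: cdot_def axis_def)

lemma ccross_add_right [simp]: "ccross a (v + w) = ccross a v + ccross a w"
  and ccross_add_left [simp]: "ccross (v + w) a = ccross v a + ccross w a"
  and ccross_diff_right [simp]: "ccross a (v - w) = ccross a v - ccross a w"
  and ccross_scale_right [simp]: "ccross a (c *s v) = c *s ccross a v"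
  and ccross_scale_left [simp]: "ccross (c *s v) a = c *s ccross v a"
  and ccross_self [simp]: "ccross a a = 0"
  and ccross_zero [simp]: "ccross a 0 = 0" "ccross 0 a = 0"
  by (simp_all add: c3_simps algebra_simps)

lemma ccross_swap: "ccross a b = - ccross b a"
  by (simp add: c3_simps)

lemma ccross_ccross: "ccross a (ccross b c) = cdot a c *s b - cdot a b *s c"
  by (simp add: c3_simps algebra_simps)

lemma cdot_ccross_self [simp]: "cdot a (ccross a b) = 0" "cdot a (ccross b a) = 0"
  "cdot (ccross a b) a = 0" "cdot (ccross b a) a = 0"
  by (simp_all add: c3_simps algebra_simps)

lemma nonzero_cdot: assumes "v \<noteq> 0" obtains e where "cdot v e = 1"
proof -
  from assms obtain i where "v $ i \<noteq> 0" by (auto simp: vec_eq_iff)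
  then have "cdot v ((1 / v $ i) *s axis i 1) = 1" by simp
  then show ?thesis using that by blast
qed

lemma ccross_eq_0_imp: assumes "ccross u v = 0" "u \<noteq> 0" obtains c where "v = c *s u"
proof -
  obtain e where e: "cdot u e = 1" using nonzero_cdot[OF assms(2)] .
  have "ccross e (ccross u v) = cdot e v *s u - cdot e u *s v" by (rule ccross_ccross)
  then have "v = cdot e v *s u" using e assms(1) by (simp add: cdot_commute)
  then show ?thesis using that by blast
qed

lemma ccross_eq_0_iff: "u \<noteq> 0 \<Longrightarrow> ccross u v = 0 \<longleftrightarrow> (\<exists>c. v = c *s u)"
  by (metis ccross_eq_0_imp ccross_scale_right ccross_self vec.scale_zero_right)

lemma ccross_nonzero_indep:
  assumes "ccross u v \<noteq> 0" "x *s u + y *s v = 0"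
  shows "x = 0" "y = 0"
proof -
  have "y *s ccross u v = ccross u (x *s u + y *s v)"
    and "(- x) *s ccross u v = ccross v (x *s u + y *s v)"
    by (simp_all add: c3_simps algebra_simps)
  then have "y *s ccross u v = 0" "(- x) *s ccross u v = 0"
    unfolding assms(2) by (simp_all only: ccross_zero)
  then show "x = 0" "y = 0" using assms(1) by (simp_all only: vec.scale_eq_0_iff neg_equal_0_iff_equal simp_thms)
qed

text \<open>Cramer's rule with the denominator cleared.\<close>

lemma cdet_expand:
  "cdet a b c *s v = cdet v b c *s a + cdet a v c *s b + cdet a b v *s c"
  by (simp add: c3_simps, intro conjI; algebra)

lemma cdet_coords:
  assumes "cdet a b c \<noteq> 0"
  obtains x y z where "v = x *s a + y *s b + z *s c"
proof -
  have "v = (1 / cdet a b c) *s (cdet a b c *s v)" using assms by simp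
  also have "\<dots> = (cdet v b c / cdet a b c) *s a + (cdet a v c / cdet a b c) *s b
    + (cdet a b v / cdet a b c) *s c"
    by (subst cdet_expand) (simp add: vec.scale_right_distrib)
  finally show ?thesis by (rule that)
qed

lemma cdet_comb:
  "cdet (x *s a + y *s b + z *s c) b c = x * cdet a b c"
  "cdet a (x *s a + y *s b + z *s c) c = y * cdet a b c"
  "cdet a b (x *s a + y *s b + z *s c) = z * cdet a b c"
  by (simp_all add: c3_simps algebra_simps)

lemma cdet_unique:
  assumes "cdet a b c \<noteq> 0" "x *s a + y *s b + z *s c = x' *s a + y' *s b + z' *s c"
  shows "x = x' \<and> y = y' \<and> z = z'"
proof -
  have "x * cdet a b c = x' * cdet a b c" "y * cdet a b c = y' * cdet a b c"
    "z * cdet a b c = z' * cdet a b c"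
    using assms(2) cdet_comb[where a = a and b = b and c = c] by metis+
  then show ?thesis using assms(1) by simp
qed

lemma ccross_nonzero_extend:
  assumes "ccross u v \<noteq> 0" obtains w where "cdet u v w \<noteq> 0"
proof -
  obtain e where "cdot (ccross u v) e = 1" using nonzero_cdot[OF assms] .
  then have "cdet u v e \<noteq> 0" by (simp add: c3_simps algebra_simps)
  then show ?thesis using that by blast
qed

lemma nonzero_extend:
  assumes "u \<noteq> 0" obtains v where "ccross u v \<noteq> 0"
proof -
  obtain i where i: "u $ i \<noteq> 0" using assms by (auto simp: vec_eq_iff)
  \<comment> \<open>A nonzero vector is not parallel to two different axes.\<close>
  have "ccross u (axis 1 1) \<noteq> 0 \<or> ccross u (axis 2 1) \<noteq> 0"
    using i exhaust_3[of i] by (auto simp: c3_simps axis_def)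
  then show ?thesis using that by blast
qed

lemma nonzero_extend_basis:
  assumes "u \<noteq> 0" obtains v w where "cdet u v w \<noteq> 0"
  using nonzero_extend[OF assms] ccross_nonzero_extend by metis

lemma cdet_perm: "cdet a b c = cdet b c a" "cdet a b c = - cdet a c b" "cdet a b c = - cdet b a c"
  by (simp_all add: c3_simps algebra_simps)

lemma cdet_nonzero:
  assumes "cdet a b c \<noteq> 0"
  shows "a \<noteq> 0" "b \<noteq> 0" "c \<noteq> 0" "ccross a b \<noteq> 0" "ccross b c \<noteq> 0" "ccross a c \<noteq> 0"
  using assms cdet_perm[of a b c] cdet_perm[of b c a] cdet_perm[of a c b]
  by (auto simp: cdet_def)

lemma kernel_basis:
  assumes "cdot a p = 1"
  obtains e f where "cdot a e = 0" "cdot a f = 0" "cdet p e f \<noteq> 0"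
proof -
  have "p \<noteq> 0" using assms by auto
  then obtain v w where vw: "cdet p v w \<noteq> 0" using nonzero_extend_basis by metis
  \<comment> \<open>Projection along \<open>p\<close> onto the kernel of \<open>a\<close>; the
    determinant does not change.\<close>
  define e where "e = v - cdot a v *s p"
  define f where "f = w - cdot a w *s p"
  have "cdet p e f = cdet p v w" by (simp add: e_def f_def c3_simps algebra_simps)
  then show ?thesis using vw that[of e f] assms by (simp add: e_def f_def)
qed

lemma kernel_decomp:
  assumes "cdot a p = 1" "cdot a e = 0" "cdot a f = 0" "cdet p e f \<noteq> 0"
  obtains y z where "v = cdot a v *s p + y *s e + z *s f"
proof -
  obtain x y z where v: "v = x *s p + y *s e + z *s f" using cdet_coords[OF assms(4)] by metis
  then have "x = cdot a v" using assms by simp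
  then show ?thesis using v that by blast
qed

text \<open>Functions instead of \<open>tpoly\<close>: closure properties follow by induction,
  without exponent vectors or a choice of coordinates. The degree is an index and not an invariant,
  since the zero function is a form of every degree.\<close>

inductive form :: "nat \<Rightarrow> (c3 \<Rightarrow> complex) \<Rightarrow> bool" where
  form_const: "form 0 (\<lambda>v. c)"
| form_cdot: "form d H \<Longrightarrow> form (Suc d) (\<lambda>v. cdot a v * H v)"
| form_add: "form d H \<Longrightarrow> form d K \<Longrightarrow> form d (\<lambda>v. H v + K v)"

lemma form_zero: "form d (\<lambda>v. 0)"
proof (induction d)
  case (Suc d) then show ?case using form_cdot[of d "\<lambda>v. 0" 0] by simp
qed (rule form_const)

lemma form_scale: "form d H \<Longrightarrow> form d (\<lambda>v. c * H v)"
proof (induction rule: form.induct)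
  case (form_const c') then show ?case by (rule form.form_const)
next
  case (form_cdot d H a)
  from form.form_cdot[OF form_cdot.IH, of a] show ?case by (simp add: algebra_simps)
next
  case (form_add d H K)
  from form.form_add[OF form_add.IH] show ?case by (simp add: algebra_simps)
qed

lemma form_mult: "form d H \<Longrightarrow> form e K \<Longrightarrow> form (d + e) (\<lambda>v. H v * K v)"
proof (induction rule: form.induct)
  case (form_const c) then show ?case by (simp add: form_scale)
next
  case (form_cdot d H a)
  from form.form_cdot[OF form_cdot.IH[OF form_cdot.prems], of a] show ?case
    by (simp add: algebra_simps)
next
  case (form_add d H K')
  from form.form_add[OF form_add.IH[OF form_add.prems]] show ?case by (simp add: algebra_simps)
qed

lemma form_power: "form d H \<Longrightarrow> form (n * d) (\<lambda>v. H v ^ n)"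
  by (induction n) (auto intro: form_mult form_const)

lemma form_sum: "finite S \<Longrightarrow> (\<And>i. i \<in> S \<Longrightarrow> form d (H i)) \<Longrightarrow> form d (\<lambda>v. \<Sum>i\<in>S. H i v)"
  by (induction S rule: finite_induct) (auto intro: form_add form_zero)

lemma form_linear: "form 1 (cdot a)"
  using form_cdot[OF form_const[of 1], of a] by simp

lemma form_homogeneous: "form d H \<Longrightarrow> H (c *s v) = c ^ d * H v"
  by (induction rule: form.induct) (auto simp: algebra_simps)

text \<open>Taylor expansion in the direction \<open>p\<close>. A linear factor contributes
  \<open>x * cdot a p + cdot a w\<close>, so multiplying by it is a two-term recursion for the
  coefficients.\<close>

lemma form_expand:
  "form d H \<Longrightarrow> \<exists>h. (\<forall>k. form k (h k)) \<and> (\<forall>x w. H (x *s p + w) = (\<Sum>k\<le>d. x ^ (d - k) * h k w))"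
proof (induction rule: form.induct)
  case (form_const c)
  show ?case
    by (rule exI[of _ "\<lambda>k. if k = 0 then (\<lambda>v. c) else (\<lambda>v. 0)"])
      (auto intro: form.form_const form_zero)
next
  case (form_cdot d H a)
  then obtain h where h: "\<And>k. form k (h k)"
    and hs: "\<And>x w. H (x *s p + w) = (\<Sum>k\<le>d. x ^ (d - k) * h k w)" by blast
  \<comment> \<open>\<open>h\<close> is arbitrary beyond \<open>d\<close>, so the first summand has
    to be cut off there; the second has no predecessor at \<open>k = 0\<close>.\<close>
  define h' where "h' k = (\<lambda>w. (if k \<le> d then cdot a p * h k w else 0)
      + (if k = 0 then 0 else cdot a w * h (k - 1) w))" for k
  have "form k (h' k)" for k
  proof -
    have "form k (\<lambda>w. if k \<le> d then cdot a p * h k w else 0)"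
      using form_scale[OF h] by (cases "k \<le> d") (simp_all add: form_zero)
    moreover have "form k (\<lambda>w. if k = 0 then 0 else cdot a w * h (k - 1) w)"
      using form.form_cdot[OF h] by (cases k) (simp_all add: form_zero)
    ultimately show ?thesis unfolding h'_def by (rule form.form_add)
  qed
  moreover have "cdot a (x *s p + w) * H (x *s p + w) = (\<Sum>k\<le>Suc d. x ^ (Suc d - k) * h' k w)"
    for x w
  proof -
    have "(\<Sum>k\<le>Suc d. x ^ (Suc d - k) * h' k w)
      = (\<Sum>k\<le>Suc d. x ^ (Suc d - k) * (if k \<le> d then cdot a p * h k w else 0))
      + (\<Sum>k\<le>Suc d. x ^ (Suc d - k) * (if k = 0 then 0 else cdot a w * h (k - 1) w))"
      by (simp add: h'_def algebra_simps sum.distrib)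
    also have "(\<Sum>k\<le>Suc d. x ^ (Suc d - k) * (if k \<le> d then cdot a p * h k w else 0))
      = x * cdot a p * (\<Sum>k\<le>d. x ^ (d - k) * h k w)"
      by (simp add: sum_distrib_left Suc_diff_le algebra_simps)
    also have "(\<Sum>k\<le>Suc d. x ^ (Suc d - k) * (if k = 0 then 0 else cdot a w * h (k - 1) w))
      = cdot a w * (\<Sum>k\<le>d. x ^ (d - k) * h k w)"
      by (subst sum.atMost_Suc_shift) (simp add: sum_distrib_left algebra_simps)
    finally show ?thesis
      unfolding hs by (simp only: cdot_add_right cdot_scale_right distrib_right mult_ac)
  qed
  ultimately show ?case by blast
next
  case (form_add d H K)
  then obtain h k where "\<And>i. form i (h i)" "\<And>i. form i (k i)"
    and "\<And>x w. H (x *s p + w) = (\<Sum>i\<le>d. x ^ (d - i) * h i w)"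
    and "\<And>x w. K (x *s p + w) = (\<Sum>i\<le>d. x ^ (d - i) * k i w)" by blast
  then show ?case
    by (intro exI[of _ "\<lambda>i w. h i w + k i w"])
      (auto intro: form.form_add simp: sum.distrib algebra_simps)
qed

lemma form_0: "form 0 H \<Longrightarrow> H v = H w"
  using form_homogeneous[of 0 H 0 v] form_homogeneous[of 0 H 0 w] by simp

lemma form_0_vec: "form d H \<Longrightarrow> 0 < d \<Longrightarrow> H 0 = 0"
  using form_homogeneous[of d H 0 0] by (simp add: power_0_left)

lemma form_1: assumes "form 1 H" obtains a where "H = cdot a"
proof -
  have "\<exists>a. H = cdot a" if "form d H" "d = 1" for d
    using that
  proof (induction rule: form.induct)
    case (form_cdot d H a)
    then have "(\<lambda>v. cdot a v * H v) = cdot (H 0 *s a)"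
      using form_0[of H] by (auto simp: fun_eq_iff mult.commute)
    then show ?case by blast
  next
    case (form_add d H K)
    then obtain a b where "H = cdot a" "K = cdot b" by blast
    then show ?case by (intro exI[of _ "a + b"]) (auto simp: fun_eq_iff)
  qed simp
  then show ?thesis using assms that by blast
qed

lemma quartic_expand:
  assumes "form 4 F"
  obtains a h2 h3 h4 where "form 2 h2" "form 3 h3" "form 4 h4"
    "\<And>x w. F (x *s p + w) = F p * x ^ 4 + cdot a w * x ^ 3 + h2 w * x\<^sup>2 + h3 w * x + h4 w"
proof -
  obtain h where h: "\<And>k. form k (h k)"
    and e: "\<And>x w. F (x *s p + w) = (\<Sum>k\<le>4. x ^ (4 - k) * h k w)"
    using form_expand[OF assms, of p] by blast
  obtain a where a: "h 1 = cdot a" using form_1[OF h[of 1]] .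
  have "F (x *s p + w) = h 0 w * x ^ 4 + cdot a w * x ^ 3 + h 2 w * x\<^sup>2 + h 3 w * x + h 4 w" for x w
    using e[of x w] a by (simp add: numeral_eq_Suc algebra_simps)
  moreover from this[of 1 0] have "F p = h 0 0"
    using form_0_vec[OF h[of 2]] form_0_vec[OF h[of 3]] form_0_vec[OF h[of 4]] by simp
  then have "h 0 w = F p" for w using form_0[OF h[of 0]] by metis
  ultimately show ?thesis using that[of "h 2" "h 3" "h 4" a] h by simp
qed

lemma form_binary:
  assumes "form d H"
  shows "\<exists>c. \<forall>x y. H (x *s u + y *s v) = (\<Sum>k\<le>d. c k * x ^ (d - k) * y ^ k)"
proof -
  obtain h where h: "\<And>k. form k (h k)"
    and e: "\<And>x w. H (x *s u + w) = (\<Sum>k\<le>d. x ^ (d - k) * h k w)"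
    using form_expand[OF assms, of u] by blast
  show ?thesis
    by (rule exI[of _ "\<lambda>k. h k v"])
      (auto simp: e form_homogeneous[OF h] algebra_simps)
qed

lemma form_4_binary:
  assumes "form 4 H"
  obtains a b c d e where
    "\<And>x y. H (x *s u + y *s v) = a * x ^ 4 + b * x ^ 3 * y + c * x\<^sup>2 * y\<^sup>2 + d * x * y ^ 3 + e * y ^ 4"
proof -
  obtain c where "\<And>x y. H (x *s u + y *s v) = (\<Sum>k\<le>4. c k * x ^ (4 - k) * y ^ k)"
    using form_binary[OF assms] by blast
  then show ?thesis by (intro that[of "c 0" "c 1" "c 2" "c 3" "c 4"]) (simp add: numeral_eq_Suc)
qed

lemma form_3_binary:
  assumes "form 3 H"
  obtains a b c d where
    "\<And>x y. H (x *s u + y *s v) = a * x ^ 3 + b * x\<^sup>2 * y + c * x * y\<^sup>2 + d * y ^ 3"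
proof -
  obtain c where "\<And>x y. H (x *s u + y *s v) = (\<Sum>k\<le>3. c k * x ^ (3 - k) * y ^ k)"
    using form_binary[OF assms] by blast
  then show ?thesis by (intro that[of "c 0" "c 1" "c 2" "c 3"]) (simp add: numeral_eq_Suc)
qed

lemma form_2_binary:
  assumes "form 2 H"
  obtains a b c where "\<And>x y. H (x *s u + y *s v) = a * x\<^sup>2 + b * x * y + c * y\<^sup>2"
proof -
  obtain c where "\<And>x y. H (x *s u + y *s v) = (\<Sum>k\<le>2. c k * x ^ (2 - k) * y ^ k)"
    using form_binary[OF assms] by blast
  then show ?thesis by (intro that[of "c 0" "c 1" "c 2"]) (simp add: numeral_eq_Suc)
qed

text \<open>Degrees are given up here, so that sums of any kind, gradients, Jacobians and
  compositions stay in one class; numerators and denominators of regular sections are taken from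
  it.\<close>

inductive polyfun :: "(c3 \<Rightarrow> complex) \<Rightarrow> bool" where
  polyfun_const: "polyfun (\<lambda>v. c)"
| polyfun_cdot: "polyfun (cdot a)"
| polyfun_add: "polyfun H \<Longrightarrow> polyfun K \<Longrightarrow> polyfun (\<lambda>v. H v + K v)"
| polyfun_mult: "polyfun H \<Longrightarrow> polyfun K \<Longrightarrow> polyfun (\<lambda>v. H v * K v)"

lemma form_polyfun: "form d H \<Longrightarrow> polyfun H"
proof (induction rule: form.induct)
  case (form_cdot d H a)
  from polyfun_mult[OF polyfun_cdot[of a] form_cdot.IH] show ?case .
qed (auto intro: polyfun.intros)

lemma polyfun_nth: "polyfun (\<lambda>v. v $ i)"
  using polyfun_cdot[of "axis i 1"] by (simp add: cdot_axis(1)[abs_def])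

lemma polyfun_uminus: "polyfun H \<Longrightarrow> polyfun (\<lambda>v. - H v)"
  using polyfun_mult[OF polyfun_const[of "-1"]] by simp

lemma polyfun_diff: "polyfun H \<Longrightarrow> polyfun K \<Longrightarrow> polyfun (\<lambda>v. H v - K v)"
  using polyfun_add[OF _ polyfun_uminus] by simp

definition polymap :: "(c3 \<Rightarrow> c3) \<Rightarrow> bool" where
  "polymap G \<longleftrightarrow> (\<forall>i. polyfun (\<lambda>v. G v $ i))"

lemma polymapD: "polymap G \<Longrightarrow> polyfun (\<lambda>v. G v $ i)"
  by (simp add: polymap_def)

lemma polymap_id: "polymap (\<lambda>v. v)"
  by (simp add: polymap_def polyfun_nth)

lemma polymap_const: "polymap (\<lambda>v. a)"
  by (simp add: polymap_def polyfun_const)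

lemma polymap_scale: "polyfun H \<Longrightarrow> polymap G \<Longrightarrow> polymap (\<lambda>v. H v *s G v)"
  by (simp add: polymap_def polyfun_mult)

lemma polymap_add: "polymap H \<Longrightarrow> polymap G \<Longrightarrow> polymap (\<lambda>v. H v + G v)"
  by (simp add: polymap_def polyfun_add)

lemma polyfun_cdot_map: "polymap G \<Longrightarrow> polymap H \<Longrightarrow> polyfun (\<lambda>v. cdot (G v) (H v))"
  by (simp add: cdot_def polyfun_add polyfun_mult polymapD)

lemma polymap_ccross: "polymap G \<Longrightarrow> polymap H \<Longrightarrow> polymap (\<lambda>v. ccross (G v) (H v))"
  unfolding polymap_def[of "\<lambda>v. ccross (G v) (H v)"] forall_3
  by (simp add: ccross_def vector_3 polyfun_diff polyfun_mult polymapD)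

lemma polyfun_comp: "polyfun H \<Longrightarrow> polymap G \<Longrightarrow> polyfun (\<lambda>v. H (G v))"
proof (induction rule: polyfun.induct)
  case (polyfun_cdot a) then show ?case by (intro polyfun_cdot_map polymap_const)
qed (auto intro: polyfun.intros)

lemma polymap_comp: "polymap H \<Longrightarrow> polymap G \<Longrightarrow> polymap (\<lambda>v. H (G v))"
  unfolding polymap_def[of H] polymap_def[of "\<lambda>v. H (G v)"] using polyfun_comp by blast

text \<open>The chain rule along every differentiable path is built in, so that compositions can be
  differentiated without a total derivative in several variables.\<close>

definition is_grad :: "(c3 \<Rightarrow> complex) \<Rightarrow> (c3 \<Rightarrow> c3) \<Rightarrow> bool" where
  "is_grad H g \<longleftrightarrow> polymap g \<and> (\<forall>(c :: complex \<Rightarrow> c3) c' x.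
     (\<forall>i. ((\<lambda>t. c t $ i) has_field_derivative c' $ i) (at x)) \<longrightarrow>
     ((\<lambda>t. H (c t)) has_field_derivative cdot (g (c x)) c') (at x))"

text \<open>For a polynomial function the choice is forced, since lines in the three axis directions
  determine the components.\<close>

definition grad :: "(c3 \<Rightarrow> complex) \<Rightarrow> c3 \<Rightarrow> c3" where
  "grad H = (SOME g. is_grad H g)"

lemma polyfun_has_grad: "polyfun H \<Longrightarrow> \<exists>g. is_grad H g"
proof (induction rule: polyfun.induct)
  case (polyfun_const c)
  show ?case by (rule exI[of _ "\<lambda>v. 0"]) (simp add: is_grad_def polymap_const)
next
  case (polyfun_cdot a)
  show ?case
    by (rule exI[of _ "\<lambda>v. a"])
      (auto simp: is_grad_def polymap_const cdot_def intro!: derivative_eq_intros)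
next
  case (polyfun_add H K)
  then obtain g h where "is_grad H g" "is_grad K h" by blast
  then show ?case
    by (intro exI[of _ "\<lambda>v. g v + h v"])
      (auto simp: is_grad_def intro!: polymap_add derivative_eq_intros)
next
  case (polyfun_mult H K)
  then obtain g h where "is_grad H g" "is_grad K h" by blast
  then show ?case using polyfun_mult
    by (intro exI[of _ "\<lambda>v. K v *s g v + H v *s h v"])
      (auto simp: is_grad_def intro!: polymap_add polymap_scale derivative_eq_intros)
qed

lemma is_grad_grad: "polyfun H \<Longrightarrow> is_grad H (grad H)"
  unfolding grad_def using polyfun_has_grad someI_ex by metis

lemma polymap_grad: "polyfun H \<Longrightarrow> polymap (grad H)"
  using is_grad_grad by (simp add: is_grad_def)

lemma grad_chain:
  assumes "polyfun H" "\<And>i. ((\<lambda>t. c t $ i) has_field_derivative c' $ i) (at x)"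
  shows "((\<lambda>t. H (c t)) has_field_derivative cdot (grad H (c x)) c') (at x)"
  using is_grad_grad[OF assms(1)] assms(2) by (auto simp: is_grad_def)

lemma grad_line:
  assumes "polyfun H"
  shows "((\<lambda>t. H (v + t *s w)) has_field_derivative cdot (grad H v) w) (at 0)"
proof -
  have "((\<lambda>t. (v + t *s w) $ i) has_field_derivative w $ i) (at 0)" for i
    by (auto intro!: derivative_eq_intros)
  from grad_chain[OF assms, of "\<lambda>t. v + t *s w", OF this] show ?thesis by simp
qed

text \<open>Uniqueness of derivatives: gradients below are computed by differentiating a function of
  one variable along a line.\<close>

lemma cdot_gradI:
  assumes "polyfun H" "((\<lambda>t. H (v + t *s w)) has_field_derivative d) (at 0)"
  shows "cdot (grad H v) w = d"
  using DERIV_unique grad_line[OF assms(1)] assms(2) by blast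

definition jac :: "(c3 \<Rightarrow> c3) \<Rightarrow> c3 \<Rightarrow> c3 \<Rightarrow> c3" where
  "jac G v w = (\<chi> i. cdot (grad (\<lambda>v. G v $ i) v) w)"

lemma jac_add: "jac G v (w + w') = jac G v w + jac G v w'"
  and jac_scale: "jac G v (c *s w) = c *s jac G v w"
  by (simp_all add: jac_def vec_eq_iff)

lemma grad_comp:
  assumes "polyfun H" "polymap G"
  shows "cdot (grad (\<lambda>v. H (G v)) v) w = cdot (grad H (G v)) (jac G v w)"
proof (rule cdot_gradI)
  show "polyfun (\<lambda>v. H (G v))" using assms by (rule polyfun_comp)
  have "((\<lambda>t. G (v + t *s w) $ i) has_field_derivative jac G v w $ i) (at 0)" for i
    using grad_line[OF polymapD[OF assms(2)], where v = v and w = w] by (simp add: jac_def)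
  from grad_chain[OF assms(1), of "\<lambda>t. G (v + t *s w)", OF this]
  show "((\<lambda>t. H (G (v + t *s w))) has_field_derivative cdot (grad H (G v)) (jac G v w)) (at 0)"
    by simp
qed

lemma jac_comp:
  assumes "polymap H" "polymap G"
  shows "jac (\<lambda>v. H (G v)) v w = jac H (G v) (jac G v w)"
  using grad_comp[OF polymapD[OF assms(1)] assms(2)]
  by (simp add: vec_eq_iff jac_def[of "\<lambda>v. H (G v)"] jac_def[of H])

lemma polymap_jac:
  assumes "polymap G" "polymap W" shows "polymap (\<lambda>v. jac G v (W v))"
  unfolding polymap_def jac_def
  using assms by (simp add: polyfun_cdot_map polymap_grad polymapD)

text \<open>Euler's identity, and homogeneity of the gradient. The extra factor \<open>c\<close> on
  the left stands in for the exponent \<open>d - 1\<close>, so that \<open>d = 0\<close> is no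
  exception.\<close>

lemma grad_homogeneous:
  assumes "polyfun H" "\<And>c v. H (c *s v) = c ^ d * H v"
  shows "cdot (grad H v) v = of_nat d * H v"
    and "c * cdot (grad H (c *s v)) w = c ^ d * cdot (grad H v) w"
proof -
  have "H (v + t *s v) = (1 + t) ^ d * H v" for t
    using assms(2)[of "1 + t" v] by (simp add: vec.scale_left_distrib)
  moreover have "((\<lambda>t. (1 + t) ^ d * H v) has_field_derivative of_nat d * H v) (at 0)"
    by (auto intro!: derivative_eq_intros)
  ultimately show "cdot (grad H v) v = of_nat d * H v"
    by (intro cdot_gradI[OF assms(1)]) simp
  have "((\<lambda>t. c ^ d * H (v + t *s w)) has_field_derivative c ^ d * cdot (grad H v) w) (at 0)"
    using grad_line[OF assms(1), of v w] by (rule DERIV_cmult)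
  also have "(\<lambda>t. c ^ d * H (v + t *s w)) = (\<lambda>t. H (c *s v + t *s (c *s w)))"
    by (simp add: assms(2)[symmetric] vec.scale_right_distrib mult.commute)
  finally show "c * cdot (grad H (c *s v)) w = c ^ d * cdot (grad H v) w"
    using cdot_gradI[OF assms(1)] by fastforce
qed

lemma form_grad:
  assumes "form d H"
  shows "cdot (grad H v) v = of_nat d * H v"
    and "c * cdot (grad H (c *s v)) w = c ^ d * cdot (grad H v) w"
  using grad_homogeneous[OF form_polyfun[OF assms] form_homogeneous[OF assms]] by simp_all

section \<open>Polynomials in two variables\<close>

text \<open>The outer variable is \<open>z\<close>, the inner one \<open>t\<close>. Later
  \<open>z\<close> is the coordinate along a point off the curve and \<open>t\<close> parametrises
  lines through that point.\<close>

definition ev2 :: "complex poly poly \<Rightarrow> complex \<Rightarrow> complex \<Rightarrow> complex" where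
  "ev2 P t z = poly (poly P [:z:]) t"

lemma ev2_simps [simp]:
  "ev2 0 t z = 0" "ev2 1 t z = 1" "ev2 (P + Q) t z = ev2 P t z + ev2 Q t z"
  "ev2 (P - Q) t z = ev2 P t z - ev2 Q t z"
  "ev2 (- P) t z = - ev2 P t z" "ev2 (P * Q) t z = ev2 P t z * ev2 Q t z"
  "ev2 (smult p P) t z = poly p t * ev2 P t z"
  "ev2 (pCons p P) t z = poly p t + z * ev2 P t z"
  by (simp_all add: ev2_def)

definition sect :: "complex poly poly \<Rightarrow> complex \<Rightarrow> complex poly" where
  "sect P t = map_poly (\<lambda>p. poly p t) P"

lemma coeff_sect [simp]: "coeff (sect P t) k = poly (coeff P k) t"
  by (simp add: sect_def coeff_map_poly)

lemma poly_sect [simp]: "poly (sect P t) z = ev2 P t z"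
  by (induction P) (simp_all add: sect_def map_poly_pCons)

lemma sect_simps [simp]:
  "sect 0 t = 0" "sect 1 t = 1" "sect (P - Q) t = sect P t - sect Q t" "sect (P + Q) t = sect P t + sect Q t" "sect (P * Q) t = sect P t * sect Q t"
  by (simp_all flip: poly_eq_poly_eq_iff add: fun_eq_iff)

lemma degree_sect_le: "degree (sect P t) \<le> degree P"
  by (intro degree_le) (simp add: coeff_eq_0)

lemma degree_sect: "poly (lead_coeff P) t \<noteq> 0 \<Longrightarrow> degree (sect P t) = degree P"
  using degree_sect_le[of P t] le_degree[of "sect P t" "degree P"] by simp

lemma sect_map_const: "sect (map_poly (\<lambda>c. [:c:]) r) t = r"
  by (simp add: poly_eq_iff coeff_map_poly)

lemma pderiv_sect: "pderiv (sect P t) = sect (pderiv P) t"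
  by (simp add: poly_eq_iff coeff_pderiv)

lemma sect_eq_0: assumes "sect P t = 0" obtains Q where "P = smult [:- t, 1:] Q"
proof -
  have "P = smult [:- t, 1:] (map_poly (\<lambda>p. p div [:- t, 1:]) P)"
  proof (rule poly_eqI)
    fix k
    have "poly (coeff P k) t = 0" using assms by (metis coeff_0 coeff_sect)
    then have "[:- t, 1:] dvd coeff P k" by (simp add: poly_eq_0_iff_dvd)
    then show "coeff P k = coeff (smult [:- t, 1:] (map_poly (\<lambda>p. p div [:- t, 1:]) P)) k"
      by (simp only: coeff_smult coeff_map_poly div_0 dvd_mult_div_cancel)
  qed
  then show ?thesis by (rule that)
qed

lemma complex_poly_root: assumes "degree (p :: complex poly) > 0" obtains z where "poly p z = 0"
  using assms fundamental_theorem_of_algebra[of p] constant_degree[of p] by auto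

text \<open>An element of least degree generates the ideal; if it were not constant, its root would
  be a common zero.\<close>

lemma poly_ideal_one:
  fixes I :: "complex poly set"
  assumes add: "\<And>p q. p \<in> I \<Longrightarrow> q \<in> I \<Longrightarrow> p + q \<in> I" and mult: "\<And>p r. p \<in> I \<Longrightarrow> r * p \<in> I"
    and zero: "\<And>a. \<exists>p\<in>I. poly p a \<noteq> 0"
  shows "1 \<in> I"
proof -
  have "\<exists>p. p \<in> I \<and> p \<noteq> 0" using zero[of 0] by auto
  then obtain g where g: "g \<in> I" "g \<noteq> 0"
    and min: "\<And>p. p \<in> I \<and> p \<noteq> 0 \<Longrightarrow> degree g \<le> degree p"
    using ex_has_least_nat[of "\<lambda>p. p \<in> I \<and> p \<noteq> 0" _ degree] by metis
  have dvd: "g dvd p" if "p \<in> I" for p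
  proof -
    have "p mod g = p + - (p div g) * g" by (simp add: minus_div_mult_eq_mod[symmetric])
    then have "p mod g \<in> I" using add[OF that mult[OF g(1)]] by metis
    then have "p mod g = 0" using min[of "p mod g"] degree_mod_less[OF g(2), of p] by force
    then show ?thesis by auto
  qed
  have "degree g = 0"
  proof (rule ccontr)
    assume "degree g \<noteq> 0"
    then obtain a where "poly g a = 0" using complex_poly_root by blast
    with zero[of a] dvd show False by (metis dvdE mult_zero_left poly_mult)
  qed
  then obtain c where c: "g = [:c:]" by (metis degree_eq_zeroE)
  with g(2) have "[:1 / c:] * g = 1" by (simp add: one_pCons)
  then show ?thesis using mult[OF g(1)] by metis
qed

text \<open>The Nullstellensatz for two variables. A nonzero element of least degree in the second
  variable does not involve it at all, and its linear factors \<open>t - t\<^sub>0\<close> can be cancelled one by one,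
  because modulo the ideal they are units.\<close>

lemma poly_poly_ideal_one:
  fixes J :: "complex poly poly set"
  assumes add: "\<And>P Q. P \<in> J \<Longrightarrow> Q \<in> J \<Longrightarrow> P + Q \<in> J" and mult: "\<And>P R. P \<in> J \<Longrightarrow> R * P \<in> J"
    and zero: "\<And>t z. \<exists>P\<in>J. ev2 P t z \<noteq> 0"
  shows "1 \<in> J"
proof -
  have "\<exists>P. P \<in> J \<and> P \<noteq> 0" using zero[of 0 0] by auto
  then obtain D where D: "D \<in> J" "D \<noteq> 0"
    and min: "\<And>P. P \<in> J \<and> P \<noteq> 0 \<Longrightarrow> degree D \<le> degree P"
    using ex_has_least_nat[of "\<lambda>P. P \<in> J \<and> P \<noteq> 0" _ degree] by metis
  have "degree D = 0"
  proof (rule ccontr)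
    assume nz: "degree D \<noteq> 0"
    \<comment> \<open>Pick a fibre on which \<open>D\<close> keeps its degree and hence has a zero.
      An element of \<open>J\<close> that does not vanish there cannot become a multiple of
      \<open>D\<close> after scaling by a power of the leading coefficient.\<close>
    have "finite {t. poly (lead_coeff D) t = 0}" using D(2) by (intro poly_roots_finite) simp
    then obtain t where t: "poly (lead_coeff D) t \<noteq> 0"
      using infinite_UNIV_char_0[where 'a = complex] by (metis (mono_tags) ex_new_if_finite mem_Collect_eq)
    obtain z where z: "ev2 D t z = 0"
      using complex_poly_root[of "sect D t"] nz degree_sect[OF t] by auto
    obtain B where B: "B \<in> J" "ev2 B t z \<noteq> 0" using zero by blast
    obtain Q R where QR: "pseudo_divmod B D = (Q, R)" by force
    note pd = pseudo_divmod[OF D(2) QR]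
    have "R = [:lead_coeff D ^ (Suc (degree B) - degree D):] * B + (- Q) * D"
      using pd(1) by (simp add: mult.commute)
    then have "R \<in> J" using add mult B(1) D(1) by metis
    then have "R = 0" using min pd(2) by (metis leD)
    with arg_cong[OF pd(1), of "\<lambda>P. ev2 P t z"] z t B(2) show False by simp
  qed
  then obtain p where p: "D = [:p:]" by (metis degree_eq_zeroE)
  \<comment> \<open>Restricting \<open>J\<close> to a fibre gives an ideal of one-variable
    polynomials without common zero.\<close>
  have unit: "\<exists>H\<in>J. sect H t = 1" for t
  proof -
    have "1 \<in> (\<lambda>H. sect H t) ` J"
    proof (rule poly_ideal_one)
      fix p q assume "p \<in> (\<lambda>H. sect H t) ` J" "q \<in> (\<lambda>H. sect H t) ` J"
      then obtain H K where "H \<in> J" "K \<in> J" "p = sect H t" "q = sect K t" by blast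
      then show "p + q \<in> (\<lambda>H. sect H t) ` J" using add by (auto intro!: image_eqI[of _ _ "H + K"])
    next
      fix p r assume "p \<in> (\<lambda>H. sect H t) ` J"
      then obtain H where "H \<in> J" "p = sect H t" by blast
      then show "r * p \<in> (\<lambda>H. sect H t) ` J" using mult
        by (auto intro!: image_eqI[of _ _ "map_poly (\<lambda>c. [:c:]) r * H"] simp: sect_map_const)
    next
      fix z show "\<exists>p\<in>(\<lambda>H. sect H t) ` J. poly p z \<noteq> 0" using zero[of t z] by auto
    qed
    then show ?thesis by auto
  qed
  have "q \<noteq> 0 \<Longrightarrow> [:q:] \<in> J \<Longrightarrow> 1 \<in> J" for q
  proof (induction "degree q" arbitrary: q)
    case 0
    then obtain c where "q = [:c:]" by (metis degree_eq_zeroE)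
    with 0 have "[:[:1 / c:]:] * [:q:] = 1" by (simp add: one_pCons)
    then show ?case using mult[OF 0(3)] by metis
  next
    case (Suc n)
    then obtain t where "poly q t = 0" using complex_poly_root[of q] by auto
    then obtain r where r: "q = [:- t, 1:] * r" by (metis dvdE poly_eq_0_iff_dvd)
    have "r \<noteq> 0" using r Suc by auto
    then have deg: "n = degree r" using Suc(2) unfolding r by (subst (asm) degree_mult_eq) auto
    obtain H where H: "H \<in> J" "sect H t = 1" using unit by blast
    have "sect (H - 1) t = 0" using H(2) by simp
    then obtain E where "H - 1 = smult [:- t, 1:] E" by (rule sect_eq_0)
    then have "H = 1 + smult [:- t, 1:] E" by (simp add: algebra_simps)
    then have "[:r:] = [:r:] * H + (- E) * [:q:]" by (simp add: r smult_add_right mult.commute)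
    then have "[:r:] \<in> J" using add mult H(1) Suc(4) by metis
    then show ?case using Suc(1)[OF deg \<open>r \<noteq> 0\<close>] by simp
  qed
  then show ?thesis using D p by auto
qed

lemma rsquarefree_card_roots:
  assumes "rsquarefree (p :: complex poly)" shows "card {z. poly p z = 0} = degree p"
proof -
  have p0: "p \<noteq> 0" using assms by (auto simp: rsquarefree_def)
  have "degree p = degree (smult (lead_coeff p) (\<Prod>z|poly p z = 0. [:-z, 1:]))"
    using complex_poly_decompose_rsquarefree[OF assms] by simp
  also have "\<dots> = (\<Sum>z|poly p z = 0. degree [:-z, 1:])"
    using p0 by (simp add: degree_prod_sum_eq)
  finally show ?thesis by simp
qed

section \<open>Singular points of the fibres of a plane curve\<close>

definition tderiv :: "complex poly poly \<Rightarrow> complex poly poly" where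
  "tderiv P = map_poly pderiv P"

lemma ev2_tderiv: "((\<lambda>t. ev2 P t z) has_field_derivative ev2 (tderiv P) t z) (at t)"
proof (induction P)
  case 0 then show ?case by (simp add: tderiv_def)
next
  case (pCons a P)
  then show ?case
    by (auto simp: tderiv_def map_poly_pCons intro!: derivative_eq_intros poly_DERIV)
qed

lemma tderiv_unique:
  "(\<And>t. ev2 P t z = f t) \<Longrightarrow> (f has_field_derivative d) (at t) \<Longrightarrow> ev2 (tderiv P) t z = d"
  using DERIV_unique ev2_tderiv[of P z t] by (metis ext)

lemma ev2_tderiv_mult:
  "ev2 (tderiv (P * Q)) t z = ev2 (tderiv P) t z * ev2 Q t z + ev2 P t z * ev2 (tderiv Q) t z"
  by (rule tderiv_unique[where f = "\<lambda>t. ev2 P t z * ev2 Q t z"])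
    (auto intro!: derivative_eq_intros ev2_tderiv)

text \<open>A polynomial \<open>D\<close> of least degree in \<open>z\<close> vanishing at infinitely many singular points of the
  fibres divides \<open>P\<close> up to a factor in \<open>t\<close>; since \<open>P\<^sub>t \<noteq> 0\<close> there, the cofactor does not vanish, so the
  relation \<open>P\<^sub>z = 0\<close> forces \<open>D\<^sub>z\<close> to vanish as well, contradicting minimality.\<close>

lemma finite_singular_fibres:
  assumes P: "P \<noteq> 0" and sm: "\<And>t z. ev2 P t z = 0 \<Longrightarrow> ev2 (pderiv P) t z = 0 \<Longrightarrow> ev2 (tderiv P) t z \<noteq> 0"
  shows "finite {t. \<exists>z. ev2 P t z = 0 \<and> ev2 (pderiv P) t z = 0}"
proof (rule ccontr)
  define S where "S = {(t, z). ev2 P t z = 0 \<and> ev2 (pderiv P) t z = 0}"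
  \<comment> \<open>Infinitely many fibres, not just infinitely many points, are demanded: this
    rules out polynomials in \<open>t\<close> alone.\<close>
  define good where "good D \<longleftrightarrow> D \<noteq> 0 \<and>
    (\<exists>T. T \<subseteq> S \<and> infinite (fst ` T) \<and> (\<forall>(t, z)\<in>T. ev2 D t z = 0))" for D
  assume "infinite {t. \<exists>z. ev2 P t z = 0 \<and> ev2 (pderiv P) t z = 0}"
  also have "{t. \<exists>z. ev2 P t z = 0 \<and> ev2 (pderiv P) t z = 0} = fst ` S" by (force simp: S_def)
  finally have "good P" unfolding good_def using P by (auto intro!: exI[of _ S] simp: S_def)
  then obtain D where D: "good D" and min: "\<And>E. good E \<Longrightarrow> degree D \<le> degree E"
    using ex_has_least_nat[of good P degree] by metis
  then obtain T where D0: "D \<noteq> 0" and T: "T \<subseteq> S" "infinite (fst ` T)"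
    and TD: "\<And>t z. (t, z) \<in> T \<Longrightarrow> ev2 D t z = 0" unfolding good_def by blast
  have "degree D \<noteq> 0"
  proof
    assume "degree D = 0"
    then obtain d where d: "D = [:d:]" by (metis degree_eq_zeroE)
    then have "fst ` T \<subseteq> {t. poly d t = 0}" using TD by fastforce
    then show False using T(2) poly_roots_finite[of d] D0 d finite_subset by auto
  qed
  define c where "c = lead_coeff D ^ (Suc (degree P) - degree D)"
  have c0: "c \<noteq> 0" using D0 by (simp add: c_def)
  obtain Q R where QR: "pseudo_divmod P D = (Q, R)" by force
  note pd = pseudo_divmod[OF D0 QR, folded c_def]
  have "ev2 R t z = 0" if "(t, z) \<in> T" for t z
    using arg_cong[OF pd(1), of "\<lambda>P. ev2 P t z"] TD[OF that] that T(1) by (auto simp: S_def)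
  then have "R = 0 \<or> good R" using T unfolding good_def by blast
  then have "R = 0" using min pd(2) by (metis leD)
  with pd(1) have eq: "[:c:] * P = D * Q" by simp
  \<comment> \<open>Off the zeros of \<open>c\<close> the pseudo-division is a division; only
    finitely many fibres are discarded.\<close>
  define T' where "T' = {(t, z) \<in> T. poly c t \<noteq> 0}"
  have "fst ` T \<subseteq> fst ` T' \<union> {t. poly c t = 0}" by (force simp: T'_def)
  then have T'inf: "infinite (fst ` T')" using T(2) poly_roots_finite[OF c0] finite_subset by blast
  have "ev2 (pderiv D) t z = 0" if "(t, z) \<in> T'" for t z
  proof -
    have a: "ev2 P t z = 0" "ev2 (pderiv P) t z = 0" "ev2 D t z = 0" "poly c t \<noteq> 0"
      using that T(1) TD by (auto simp: T'_def S_def)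
    have "poly c t * ev2 (tderiv P) t z = ev2 (tderiv D) t z * ev2 Q t z"
      using arg_cong[OF eq, of "\<lambda>P. ev2 (tderiv P) t z"] a by (simp only: ev2_tderiv_mult) simp
    then have "ev2 Q t z \<noteq> 0" using sm[OF a(1,2)] a(4) by auto
    moreover have "ev2 (pderiv ([:c:] * P)) t z = ev2 (pderiv (D * Q)) t z" by (simp only: eq)
    then have "ev2 (pderiv D) t z * ev2 Q t z = 0"
      unfolding pderiv_mult using a by (simp add: pderiv_smult algebra_simps)
    ultimately show ?thesis by simp
  qed
  moreover have "pderiv D \<noteq> 0" using \<open>degree D \<noteq> 0\<close> by (simp add: pderiv_eq_0_iff)
  moreover have "T' \<subseteq> S" using T(1) by (auto simp: T'_def)
  ultimately have "good (pderiv D)" unfolding good_def using T'inf by blast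
  then show False using min[of "pderiv D"] \<open>degree D \<noteq> 0\<close> by (simp add: degree_pderiv)
qed

text \<open>Existence suffices: in the product rule of \<open>tangent_derivative_zero\<close> this
  derivative is multiplied by the value \<open>F v = 0\<close>.\<close>

lemma ev2_line_derivative:
  "\<exists>d. ((\<lambda>x. ev2 Q (x * b) (x * a)) has_field_derivative d) (at 0)"
proof (induction Q)
  case 0 then show ?case by (auto intro!: exI[of _ 0])
next
  case (pCons q Q)
  then obtain d where d: "((\<lambda>x. ev2 Q (x * b) (x * a)) has_field_derivative d) (at 0)" by blast
  have "((\<lambda>x. poly q (x * b) + (x * a) * ev2 Q (x * b) (x * a)) has_field_derivative
     (b * poly (pderiv q) (0 * b)) + (a * ev2 Q (0 * b) (0 * a) + 0 * a * d)) (at 0)"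
    by (rule derivative_eq_intros d refl | simp)+
  then show ?case by auto
qed

definition smooth_form :: "(c3 \<Rightarrow> complex) \<Rightarrow> bool" where
  "smooth_form F \<longleftrightarrow> form 4 F \<and> (\<forall>v. v \<noteq> 0 \<longrightarrow> F v = 0 \<longrightarrow> grad F v \<noteq> 0)"

lemma smooth_form_nonzero: assumes "smooth_form F" obtains p where "F p \<noteq> 0"
proof -
  have "\<not> (\<forall>p. F p = 0)"
  proof
    assume z: "\<forall>p. F p = 0"
    have F: "polyfun F" using assms form_polyfun by (auto simp: smooth_form_def)
    have "cdot (grad F v) w = 0" for v w using z by (intro cdot_gradI[OF F]) simp
    then have "grad F v = 0" for v by (metis nonzero_cdot zero_neq_one)
    then show False using assms z by (metis smooth_form_def axis_eq_0_iff zero_neq_one)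
  qed
  then show ?thesis using that by blast
qed

section \<open>Affine charts of the plane\<close>

lemma polyfun_chart: "polyfun H \<Longrightarrow> \<exists>P. \<forall>t z. H (z *s p + t *s e + f) = ev2 P t z"
proof (induction rule: polyfun.induct)
  case (polyfun_const c) then show ?case by (intro exI[of _ "[:[:c:]:]"]) simp
next
  case (polyfun_cdot a)
  then show ?case
    by (intro exI[of _ "[:[:cdot a f, cdot a e:], [:cdot a p:]:]"]) (simp add: algebra_simps)
next
  case (polyfun_add H K) then show ?case by (metis ev2_simps(3))
next
  case (polyfun_mult H K) then show ?case by (metis ev2_simps(6))
qed

lemma polyfun_chart1: assumes "polyfun H" shows "\<exists>q. \<forall>t. H (t *s e + f) = poly q t"
proof -
  obtain P where "\<And>t z. H (z *s 0 + t *s e + f) = ev2 P t z"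
    using polyfun_chart[OF assms] by metis
  from this[where z = 0] show ?thesis by (intro exI[of _ "poly P 0"]) (simp add: ev2_def)
qed

text \<open>As \<open>p\<close> is off the curve, the coefficient of \<open>z ^ 4\<close> is a
  nonzero constant. Every line through \<open>p\<close> in the chart then keeps a quartic equation,
  and division by the equation needs no denominators in \<open>t\<close>.\<close>

lemma quartic_chart:
  assumes "form 4 F" "F p \<noteq> 0"
  obtains P where "degree P = 4" "lead_coeff P = [:F p:]" "\<And>t z. F (z *s p + t *s e + f) = ev2 P t z"
proof -
  obtain a h2 h3 h4 where h: "form 2 h2" "form 3 h3" "form 4 h4"
    "\<And>x w. F (x *s p + w) = F p * x ^ 4 + cdot a w * x ^ 3 + h2 w * x\<^sup>2 + h3 w * x + h4 w"
    using quartic_expand[OF assms(1)] by metis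
  obtain q1 q2 q3 q4 where q: "\<And>t. cdot a (t *s e + f) = poly q1 t" "\<And>t. h2 (t *s e + f) = poly q2 t"
    "\<And>t. h3 (t *s e + f) = poly q3 t" "\<And>t. h4 (t *s e + f) = poly q4 t"
    using polyfun_chart1 form_polyfun[OF h(1)] form_polyfun[OF h(2)] form_polyfun[OF h(3)] polyfun_cdot[of a]
    by metis
  have "F (z *s p + t *s e + f) = ev2 [:q4, q3, q2, q1, [:F p:]:] t z" for t z
    using h(4)[of z "t *s e + f"] unfolding q by (simp add: add.assoc power_numeral_reduce algebra_simps)
  then show ?thesis using assms(2) by (intro that[of "[:q4, q3, q2, q1, [:F p:]:]"]) auto
qed

lemma const_lead_division:
  assumes "degree P = 4" "lead_coeff P = [:k:]" "(k::complex) \<noteq> 0"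
  obtains Q R where "H = P * Q + R" "degree R < 4"
proof -
  obtain Q R where QR: "pseudo_divmod H P = (Q, R)" by force
  have "P \<noteq> 0" using assms by auto
  note pd = pseudo_divmod[OF this QR]
  obtain n where "smult ([:k:] ^ n) H = P * Q + R" using pd(1) assms by metis
  moreover have k: "[:k:] ^ n = [:k ^ n:]" for n by (induction n) (auto simp: one_pCons)
  ultimately have "smult [:1 / k ^ n:] (smult [:k ^ n:] H) = smult [:1 / k ^ n:] (P * Q + R)" by simp
  then have "H = P * smult [:1 / k ^ n:] Q + smult [:1 / k ^ n:] R"
    using assms(3) by (simp add: smult_add_right one_pCons[symmetric])
  moreover have "degree (smult [:1 / k ^ n:] R) < 4"
    using pd(2) assms(1) degree_smult_le[of "[:1 / k ^ n:]" R] by auto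
  ultimately show ?thesis by (rule that)
qed

lemma chart_nonzero: "cdet p e f \<noteq> 0 \<Longrightarrow> z *s p + t *s e + f \<noteq> 0"
  using cdet_unique[of p e f z t 1 0 0 0] by auto

section \<open>Polynomial functions on a smooth quartic\<close>

lemma smooth_formD:
  assumes "smooth_form F"
  shows "form 4 F" "polyfun F" "v \<noteq> 0 \<Longrightarrow> F v = 0 \<Longrightarrow> grad F v \<noteq> 0" "F (c *s v) = c ^ 4 * F v"
  using assms form_polyfun form_homogeneous by (auto simp: smooth_form_def)

text \<open>At a multiple root of a fibre the derivative in direction \<open>p\<close> vanishes, and
  by Euler's identity also the one in direction \<open>v\<close>. If the derivative in
  \<open>t\<close> vanished too, the whole gradient would, so smoothness is exactly the hypothesis
  of \<open>finite_singular_fibres\<close>.\<close>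

lemma finite_bad_fibres:
  assumes F: "smooth_form F" "F p \<noteq> 0" "cdet p e f \<noteq> 0"
  shows "finite {t. card {z. F (z *s p + t *s e + f) = 0} \<noteq> 4}"
proof -
  note sF = smooth_formD[OF F(1)]
  obtain P where P: "degree P = 4" "lead_coeff P = [:F p:]" "\<And>t z. F (z *s p + t *s e + f) = ev2 P t z"
    using quartic_chart[OF sF(1) F(2)] by metis
  have P0: "P \<noteq> 0" using P(1) by auto
  have deg: "degree (sect P t) = 4" for t using degree_sect[of P t] P F(2) by simp
  have "finite {t. \<exists>z. ev2 P t z = 0 \<and> ev2 (pderiv P) t z = 0}"
  proof (rule finite_singular_fibres[OF P0])
    fix t z assume z: "ev2 P t z = 0" "ev2 (pderiv P) t z = 0"
    define v where "v = z *s p + t *s e + f"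
    have Fv: "F v = 0" using z(1) P(3) by (simp add: v_def)
    have "((\<lambda>x. poly (sect P t) (z + x)) has_field_derivative poly (pderiv (sect P t)) z) (at 0)"
      by (rule derivative_eq_intros refl | simp)+
    moreover have "poly (sect P t) (z + x) = F (v + x *s p)" for x
      using P(3)[of "z + x" t] by (simp add: v_def vec.scale_left_distrib algebra_simps)
    ultimately have "cdot (grad F v) p = poly (pderiv (sect P t)) z"
      by (intro cdot_gradI[OF sF(2)]) simp
    then have 1: "cdot (grad F v) p = 0" using z(2) by (simp add: pderiv_sect)
    have 2: "cdot (grad F v) v = 0" using form_grad(1)[OF sF(1), of v] Fv by simp
    have "((\<lambda>t. F (z *s p + t *s e + f)) has_field_derivative cdot (grad F v) e) (at t)"
      unfolding v_def
      by (rule grad_chain[OF sF(2), of "\<lambda>t. z *s p + t *s e + f"]) (auto intro!: derivative_eq_intros)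
    then have 3: "ev2 (tderiv P) t z = cdot (grad F v) e"
      by (intro tderiv_unique[where f = "\<lambda>t. F (z *s p + t *s e + f)"]) (simp_all add: P(3))
    show "ev2 (tderiv P) t z \<noteq> 0"
    proof
      assume "ev2 (tderiv P) t z = 0"
      then have e: "cdot (grad F v) e = 0" using 3 by simp
      then have f: "cdot (grad F v) f = 0" using 1 2 by (simp add: v_def)
      have "cdot (grad F v) w = 0" for w
        using cdet_coords[OF F(3), of w] 1 e f by (metis (no_types, lifting) cdot_add_right cdot_scale_right mult_zero_right add_0)
      then have "grad F v = 0" by (metis nonzero_cdot zero_neq_one)
      then show False using sF(3)[OF _ Fv] chart_nonzero[OF F(3)] by (simp add: v_def)
    qed
  qed
  moreover have "card {z. F (z *s p + t *s e + f) = 0} = 4"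
    if "\<not> (\<exists>z. ev2 P t z = 0 \<and> ev2 (pderiv P) t z = 0)" for t
    using rsquarefree_card_roots[of "sect P t"] that
    by (simp add: rsquarefree_roots pderiv_sect P(3) deg)
  ultimately show ?thesis by (auto elim!: finite_subset[rotated])
qed

lemma poly_four_roots:
  fixes q :: "complex poly"
  assumes "card S = 4" "\<And>z. z \<in> S \<Longrightarrow> poly q z = 0" "degree q < 4"
  shows "q = 0"
proof (rule ccontr)
  assume "q \<noteq> 0"
  then have "card S \<le> card {z. poly q z = 0}" using assms(2) by (intro card_mono poly_roots_finite) auto
  also have "\<dots> \<le> degree q" by (rule card_poly_roots_bound[OF \<open>q \<noteq> 0\<close>])
  finally show False using assms by simp
qed

lemma poly_cofinite_zero:
  fixes q :: "complex poly"
  assumes "finite S" "\<And>t. t \<notin> S \<Longrightarrow> poly q t = 0" shows "q = 0"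
proof (rule ccontr)
  assume "q \<noteq> 0"
  then have "finite ({t. poly q t = 0} \<union> S)" using assms(1) poly_roots_finite by blast
  moreover have "{t. poly q t = 0} \<union> S = UNIV" using assms(2) by blast
  ultimately show False using infinite_UNIV_char_0[where 'a = complex] by simp
qed

text \<open>On almost every fibre there are four distinct zeros, more than the degree allows; so
  each coefficient vanishes for almost all \<open>t\<close>.\<close>

lemma vanishing_on_curve:
  assumes F: "smooth_form F" "F p \<noteq> 0" "cdet p e f \<noteq> 0"
    and R: "degree R < 4" "\<And>t z. F (z *s p + t *s e + f) = 0 \<Longrightarrow> ev2 R t z = 0"
  shows "R = 0"
proof (rule poly_eqI)
  fix k
  have "coeff R k = 0"
  proof (rule poly_cofinite_zero[OF finite_bad_fibres[OF F]])
    fix t assume "t \<notin> {t. card {z. F (z *s p + t *s e + f) = 0} \<noteq> 4}"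
    then have "sect R t = 0"
      using R degree_sect_le[of R t]
      by (intro poly_four_roots[of "{z. F (z *s p + t *s e + f) = 0}"]) auto
    then show "poly (coeff R k) t = 0" by (metis coeff_sect coeff_0)
  qed
  then show "coeff R k = coeff 0 k" by simp
qed

text \<open>The remainder of \<open>H\<close> modulo the equation still vanishes on the curve, hence
  is zero. In the chart the ideal of the curve is therefore generated by \<open>F\<close>.\<close>

lemma curve_ideal:
  assumes F: "smooth_form F" "F p \<noteq> 0" "cdet p e f \<noteq> 0"
    and H: "polyfun H" "\<And>v. v \<noteq> 0 \<Longrightarrow> F v = 0 \<Longrightarrow> H v = 0"
  obtains Q where "\<And>t z. H (z *s p + t *s e + f) = F (z *s p + t *s e + f) * ev2 Q t z"
proof -
  obtain P where P: "degree P = 4" "lead_coeff P = [:F p:]" "\<And>t z. F (z *s p + t *s e + f) = ev2 P t z"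
    using quartic_chart[OF smooth_formD(1)[OF F(1)] F(2)] by metis
  obtain PH where PH: "\<And>t z. H (z *s p + t *s e + f) = ev2 PH t z"
    using polyfun_chart[OF H(1)] by metis
  obtain Q R where QR: "PH = P * Q + R" "degree R < 4"
    using const_lead_division[OF P(1,2) F(2)] by metis
  have "R = 0"
  proof (rule vanishing_on_curve[OF F QR(2)])
    fix t z assume "F (z *s p + t *s e + f) = 0"
    then show "ev2 R t z = 0"
      using H(2)[OF chart_nonzero[OF F(3)], of z t] PH[of z t] P(3)[of z t] QR(1) by simp
  qed
  then show ?thesis using QR(1) PH P(3) by (intro that[of Q]) simp
qed

lemma off_curve_indep:
  assumes "smooth_form F" "F p \<noteq> 0" "F v = 0" "v \<noteq> 0" shows "ccross p v \<noteq> 0"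
proof
  assume "ccross p v = 0"
  moreover have "p \<noteq> 0" using assms(2) form_0_vec[OF smooth_formD(1)[OF assms(1)]] by auto
  ultimately obtain c where "v = c *s p" using ccross_eq_0_imp by blast
  then show False using assms smooth_formD(4)[OF assms(1), of c p] by auto
qed

text \<open>Polynomials vanishing on the curve are multiples of the equation, hence have no derivative
  along the curve.\<close>

lemma tangent_derivative_zero:
  assumes F: "smooth_form F" and H: "polyfun H" "\<And>v. v \<noteq> 0 \<Longrightarrow> F v = 0 \<Longrightarrow> H v = 0"
    and v: "v \<noteq> 0" "F v = 0" and w: "cdot (grad F v) w = 0"
  shows "cdot (grad H v) w = 0"
proof -
  note sF = smooth_formD[OF F]
  obtain p where p: "F p \<noteq> 0" using smooth_form_nonzero[OF F] .
  have "ccross p v \<noteq> 0" by (rule off_curve_indep[OF F p v(2,1)])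
  \<comment> \<open>The chart is centred at \<open>v\<close>, which gets the coordinates
    \<open>t = z = 0\<close>.\<close>
  then obtain e where "cdet p v e \<noteq> 0" by (rule ccross_nonzero_extend)
  then have b: "cdet p e v \<noteq> 0" using cdet_perm(2)[of p e v] by simp
  obtain Q where Q: "\<And>t z. H (z *s p + t *s e + v) = F (z *s p + t *s e + v) * ev2 Q t z"
    using curve_ideal[OF F p b H] by metis
  obtain x y c where w': "w = x *s p + y *s e + c *s v" using cdet_coords[OF b] by metis
  define u where "u = x *s p + y *s e"
  have "cdot (grad F v) v = 0" using form_grad(1)[OF sF(1), of v] v by simp
  then have u: "cdot (grad F v) u = 0" using w unfolding w' u_def by simp
  obtain d where "((\<lambda>r. ev2 Q (r * y) (r * x)) has_field_derivative d) (at 0)"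
    using ev2_line_derivative by blast
  from DERIV_mult[OF grad_line[OF sF(2), of v u] this]
  have "((\<lambda>r. F (v + r *s u) * ev2 Q (r * y) (r * x)) has_field_derivative 0) (at 0)"
    using u v by simp
  moreover have "F (v + r *s u) * ev2 Q (r * y) (r * x) = H (v + r *s u)" for r
    using Q[of "r * x" "r * y"] by (simp add: u_def vec.scale_right_distrib add_ac)
  ultimately have 1: "cdot (grad H v) u = 0" by (intro cdot_gradI[OF H(1)]) simp
  \<comment> \<open>In the remaining direction \<open>v\<close> the curve is a cone.
    \<open>H\<close> is known to vanish on it only away from the origin, so \<open>r\<close> is kept
    in the unit disc, where \<open>1 + r \<noteq> 0\<close>.\<close>
  have "((\<lambda>r. 0) has_field_derivative (0::complex)) (at (0::complex))" by simp
  then have "((\<lambda>r. H (v + r *s v)) has_field_derivative 0) (at 0)"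
  proof (rule has_field_derivative_transform_within[where d = 1])
    fix r :: complex assume "dist r 0 < 1"
    then have "1 + r \<noteq> 0" by (metis add.commute add_eq_0_iff2 dist_0_norm dist_commute less_irrefl norm_minus_cancel norm_one)
    then have "(1 + r) *s v \<noteq> 0" using v by (simp only: vec.scale_eq_0_iff) simp
    moreover have "F ((1 + r) *s v) = 0" unfolding sF(4) using v by simp
    ultimately have "H ((1 + r) *s v) = 0" by (rule H(2))
    then show "0 = H (v + r *s v)" by (simp add: vec.scale_left_distrib)
  qed auto
  then have "cdot (grad H v) v = 0" by (rule cdot_gradI[OF H(1)])
  then show ?thesis using 1 by (simp add: w' u_def)
qed

section \<open>Regular sections of O(1)\<close>

lemma chart_swap:
  fixes p :: c3
  assumes "t \<noteq> 0"
  shows "z *s p + t *s e + f = t *s ((z / t) *s p + (1 / t) *s f + e)"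
  using assms by (simp add: vec.scale_right_distrib add_ac)

text \<open>The hypothesis is the transition rule between the charts \<open>t\<close> and
  \<open>1 / t\<close> for the coefficient of \<open>z ^ k\<close> of a section of O(1). Multiplied
  by a power of \<open>t\<close> it is an identity of polynomials, whose degrees bound the growth of
  \<open>a\<close> at infinity.\<close>

lemma reciprocal_relation:
  fixes a b :: "complex poly"
  assumes "finite S" "\<And>t. t \<notin> S \<Longrightarrow> t \<noteq> 0 \<Longrightarrow> poly a t * t ^ k = t * poly b (1 / t)"
  shows "a = 0 \<or> degree a + k \<le> (1::nat)"
proof -
  define n where "n = degree b"
  have "a * monom 1 (k + n) - [:0, 1:] * reflect_poly b = 0"
  proof (rule poly_cofinite_zero)
    show "finite (insert 0 S)" using assms(1) by simp
    fix t assume t: "t \<notin> insert 0 S"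
    then have "poly (reflect_poly b) t = t ^ n * poly b (1 / t)"
      by (simp add: poly_reflect_poly_nz n_def inverse_eq_divide)
    then show "poly (a * monom 1 (k + n) - [:0, 1:] * reflect_poly b) t = 0"
      using assms(2)[of t] t by (simp add: poly_monom power_add)
  qed
  then have eq: "a * monom 1 (k + n) = [:0, 1:] * reflect_poly b" by simp
  show ?thesis
  proof (cases "a = 0")
    case False
    then have "degree a + (k + n) = degree (a * monom 1 (k + n))"
      by (simp add: degree_mult_eq degree_monom_eq)
    also have "\<dots> \<le> degree [:0, 1::complex:] + degree (reflect_poly b)"
      unfolding eq by (rule degree_mult_le)
    also have "degree (reflect_poly b) \<le> n" unfolding n_def by (rule degree_reflect_poly_le)
    finally show ?thesis by simp
  qed simp
qed

lemma cdot_prescribe: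
  assumes "cdet p e f \<noteq> 0"
  obtains m where "cdot m p = a" "cdot m e = b" "cdot m f = c"
proof -
  define m where "m = (1 / cdet p e f) *s (a *s ccross e f + b *s ccross f p + c *s ccross p e)"
  have "cdot (ccross e f) p = cdet p e f" "cdot (ccross f p) e = cdet p e f" "cdot (ccross p e) f = cdet p e f"
    by (simp_all add: c3_simps algebra_simps)
  then show ?thesis using assms by (intro that[of m]) (simp_all add: m_def)
qed

text \<open>The denominators of a regular section form an ideal without zeros on the curve, which therefore
  contains 1. A section of \<open>O(1)\<close> that is polynomial in both charts is linear.\<close>

lemma section_chart:
  assumes F: "smooth_form F" "F p \<noteq> 0" "cdet p e f \<noteq> 0"
    and loc: "\<And>u. u \<noteq> 0 \<Longrightarrow> F u = 0 \<Longrightarrow> \<exists>A B. polyfun A \<and> polyfun B \<and> B u \<noteq> 0 \<and>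
      (\<forall>v. v \<noteq> 0 \<longrightarrow> F v = 0 \<longrightarrow> B v * s v = A v)"
  obtains R where "degree R < 4"
    "\<And>t z. F (z *s p + t *s e + f) = 0 \<Longrightarrow> s (z *s p + t *s e + f) = ev2 R t z"
proof -
  obtain P where P: "degree P = 4" "lead_coeff P = [:F p:]" "\<And>t z. F (z *s p + t *s e + f) = ev2 P t z"
    using quartic_chart[OF smooth_formD(1)[OF F(1)] F(2)] by metis
  \<comment> \<open>The ideal of denominators: those \<open>B\<close> for which \<open>B * s\<close>
    is polynomial on the curve.\<close>
  define J where "J = {B. \<exists>A. \<forall>t z. F (z *s p + t *s e + f) = 0 \<longrightarrow>
    ev2 B t z * s (z *s p + t *s e + f) = ev2 A t z}"
  have "1 \<in> J"
  proof (rule poly_poly_ideal_one)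
    fix B C assume "B \<in> J" "C \<in> J"
    then obtain A A' where "\<forall>t z. F (z *s p + t *s e + f) = 0 \<longrightarrow> ev2 B t z * s (z *s p + t *s e + f) = ev2 A t z"
      "\<forall>t z. F (z *s p + t *s e + f) = 0 \<longrightarrow> ev2 C t z * s (z *s p + t *s e + f) = ev2 A' t z"
      unfolding J_def by blast
    then show "B + C \<in> J" unfolding J_def by (auto intro!: exI[of _ "A + A'"] simp: distrib_right)
  next
    fix B C assume "B \<in> J"
    then obtain A where "\<forall>t z. F (z *s p + t *s e + f) = 0 \<longrightarrow> ev2 B t z * s (z *s p + t *s e + f) = ev2 A t z"
      unfolding J_def by blast
    then show "C * B \<in> J" unfolding J_def by (auto intro!: exI[of _ "C * A"] simp: mult.assoc)
  next
    fix t z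
    show "\<exists>B\<in>J. ev2 B t z \<noteq> 0"
    proof (cases "F (z *s p + t *s e + f) = 0")
      case False
      \<comment> \<open>The equation is itself a denominator, with numerator 0; it deals with the
        points off the curve.\<close>
      moreover have "P \<in> J" unfolding J_def using P(3) by (auto intro!: exI[of _ 0])
      ultimately show ?thesis using P(3) by auto
    next
      case True
      from loc[OF chart_nonzero[OF F(3)] True] obtain A B where AB: "polyfun A" "polyfun B"
        "B (z *s p + t *s e + f) \<noteq> 0" "\<And>v. v \<noteq> 0 \<Longrightarrow> F v = 0 \<Longrightarrow> B v * s v = A v" by blast
      obtain PA PB where PAB: "\<And>t z. A (z *s p + t *s e + f) = ev2 PA t z"
        "\<And>t z. B (z *s p + t *s e + f) = ev2 PB t z"
        using polyfun_chart[OF AB(1)] polyfun_chart[OF AB(2)] by metis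
      have "PB \<in> J" unfolding J_def
        using AB(4)[OF chart_nonzero[OF F(3)]] by (auto simp: PAB intro!: exI[of _ PA])
      then show ?thesis using AB(3) PAB(2) by auto
    qed
  qed
  then obtain A where A: "\<And>t z. F (z *s p + t *s e + f) = 0 \<Longrightarrow> s (z *s p + t *s e + f) = ev2 A t z"
    unfolding J_def by auto
  \<comment> \<open>Reduction changes no value on the curve and leaves a representative that is
    determined by its values on a fibre of four points.\<close>
  obtain Q R where QR: "A = P * Q + R" "degree R < 4"
    using const_lead_division[OF P(1,2) F(2)] by metis
  show ?thesis using A P(3) QR by (intro that[of R]) auto
qed

lemma regular_section_linear:
  assumes F: "smooth_form F"
    and hom: "\<And>c v. c \<noteq> 0 \<Longrightarrow> v \<noteq> 0 \<Longrightarrow> F v = 0 \<Longrightarrow> s (c *s v) = c * s v"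
    and loc: "\<And>u. u \<noteq> 0 \<Longrightarrow> F u = 0 \<Longrightarrow> \<exists>A B. polyfun A \<and> polyfun B \<and> B u \<noteq> 0 \<and>
      (\<forall>v. v \<noteq> 0 \<longrightarrow> F v = 0 \<longrightarrow> B v * s v = A v)"
  obtains m where "\<And>v. v \<noteq> 0 \<Longrightarrow> F v = 0 \<Longrightarrow> s v = cdot m v"
proof -
  note sF = smooth_formD[OF F]
  obtain p where p: "F p \<noteq> 0" using smooth_form_nonzero[OF F] .
  have p0: "p \<noteq> 0" using p form_0_vec[OF sF(1)] by auto
  obtain e f where b: "cdet p e f \<noteq> 0" using nonzero_extend_basis[OF p0] .
  then have b': "cdet p f e \<noteq> 0" using cdet_perm(2)[of p f e] by simp
  obtain R where R: "degree R < 4"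
    "\<And>t z. F (z *s p + t *s e + f) = 0 \<Longrightarrow> s (z *s p + t *s e + f) = ev2 R t z"
    using section_chart[OF F p b loc] by metis
  obtain T where T: "degree T < 4"
    "\<And>t z. F (z *s p + t *s f + e) = 0 \<Longrightarrow> s (z *s p + t *s f + e) = ev2 T t z"
    using section_chart[OF F p b' loc] by metis
  \<comment> \<open>\<open>t = 0\<close> is excluded because the second chart is entered through
    \<open>1 / t\<close>.\<close>
  define S where "S = insert 0 {t. card {z. F (z *s p + t *s e + f) = 0} \<noteq> 4}"
  have S: "finite S" using finite_bad_fibres[OF F p b] by (simp add: S_def)
  have rel: "poly (coeff R k) t * t ^ k = t * poly (coeff T k) (1 / t)" if t: "t \<notin> S" for t k
  proof -
    \<comment> \<open>Both sides of the transition rule have degree below 4 in \<open>z\<close> and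
      agree at the four points of the fibre.\<close>
    define q where "q = sect R t - smult t (pcompose (sect T (1 / t)) [:0, 1 / t:])"
    have "q = 0"
    proof (rule poly_four_roots)
      show "card {z. F (z *s p + t *s e + f) = 0} = 4" using t by (simp add: S_def)
      have "degree (pcompose (sect T (1 / t)) [:0, 1 / t:]) \<le> degree (sect T (1 / t)) * 1"
        by (rule order_trans[OF degree_pcompose_le]) auto
      then have "degree (pcompose (sect T (1 / t)) [:0, 1 / t:]) < 4"
        using degree_sect_le[of T "1 / t"] T(1) by linarith
      then show "degree q < 4" unfolding q_def
        using degree_sect_le[of R t] R(1) degree_smult_le[of t] by (intro degree_diff_less) (auto intro: le_less_trans)
    next
      fix z assume "z \<in> {z. F (z *s p + t *s e + f) = 0}"
      then have z: "F (z *s p + t *s e + f) = 0" by simp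
      have t0: "t \<noteq> 0" using t by (simp add: S_def)
      have z': "F ((z / t) *s p + (1 / t) *s f + e) = 0"
        using z t0 unfolding chart_swap[OF t0, of z p e f] sF(4) by simp
      have "ev2 R t z = t * ev2 T (1 / t) (z / t)"
        using R(2)[OF z] T(2)[OF z'] hom[OF t0 chart_nonzero[OF b'] z']
        unfolding chart_swap[OF t0, of z p e f] by simp
      then show "poly q z = 0" by (simp add: q_def poly_pcompose)
    qed
    then have "coeff (sect R t) k = coeff (smult t (pcompose (sect T (1 / t)) [:0, 1 / t:])) k"
      by (simp add: q_def)
    then show ?thesis using t by (simp add: S_def coeff_pcompose_linear field_simps)
  qed
  have rel': "poly (coeff T k) t * t ^ k = t * poly (coeff R k) (1 / t)"
    if "t \<notin> (\<lambda>t. 1 / t) ` S" "t \<noteq> 0" for t k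
  proof -
    have "1 / t \<notin> S" using that by (metis div_by_1 divide_divide_eq_right image_eqI mult_1)
    from rel[OF this, of k] show ?thesis using that(2) by (simp add: field_simps)
  qed
  have dR: "coeff R k = 0 \<or> degree (coeff R k) + k \<le> 1" for k
    using rel by (intro reciprocal_relation[OF S]) auto
  have dT: "coeff T k = 0 \<or> degree (coeff T k) + k \<le> 1" for k
    using rel' S by (intro reciprocal_relation[of "(\<lambda>t. 1 / t) ` S"]) auto
  have lin1: "ev2 P t z = poly (coeff P 0) t + z * poly (coeff P 1) t"
    if d: "\<And>k. coeff P k = 0 \<or> degree (coeff P k) + k \<le> 1" for P t z
  proof -
    have "P = [:coeff P 0, coeff P 1:]"
    proof (rule poly_eqI)
      fix k show "coeff P k = coeff [:coeff P 0, coeff P 1:] k"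
        using d[of k] by (cases k rule: nat.exhaust; cases "k - 1") auto
    qed
    then show ?thesis by (metis ev2_simps(1,8) add.right_neutral mult_zero_right)
  qed
  note linR = lin1[of R, OF dR] and linT = lin1[of T, OF dT]
  have lin: "q = [:coeff q 0, coeff q 1:]" if "degree q \<le> 1" for q :: "complex poly"
    using that by (intro poly_eqI) (auto simp: coeff_pCons coeff_eq_0 split: nat.split)
  obtain \<beta> \<alpha> where r0: "coeff R 0 = [:\<beta>, \<alpha>:]" using dR[of 0] lin[of "coeff R 0"] by fastforce
  obtain \<alpha>' \<beta>' where t0: "coeff T 0 = [:\<alpha>', \<beta>':]" using dT[of 0] lin[of "coeff T 0"] by fastforce
  obtain \<gamma> where r1: "coeff R 1 = [:\<gamma>:]" using dR[of 1] degree_eq_zeroE[of "coeff R 1"] by fastforce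
  obtain \<gamma>' where t1: "coeff T 1 = [:\<gamma>':]" using dT[of 1] degree_eq_zeroE[of "coeff T 1"] by fastforce
  have "[:\<beta>, \<alpha>:] - [:\<beta>', \<alpha>':] = 0"
  proof (rule poly_cofinite_zero[OF S])
    fix t assume "t \<notin> S"
    moreover from this have "t \<noteq> 0" by (auto simp: S_def)
    moreover from this have "t * (\<alpha>' + 1 / t * \<beta>') = \<beta>' + t * \<alpha>'" by (simp add: distrib_left)
    ultimately show "poly ([:\<beta>, \<alpha>:] - [:\<beta>', \<alpha>':]) t = 0"
      using rel[of t 0] by (simp add: r0 t0 algebra_simps)
  qed
  then have eq: "\<alpha>' = \<alpha>" "\<beta>' = \<beta>" by auto
  have "[:\<gamma>:] - [:\<gamma>':] = 0"
  proof (rule poly_cofinite_zero[OF S])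
    fix t assume "t \<notin> S"
    moreover from this have "t \<noteq> 0" by (auto simp: S_def)
    ultimately show "poly ([:\<gamma>:] - [:\<gamma>':]) t = 0" using rel[of t 1] by (simp add: r1[simplified] t1[simplified])
  qed
  then have eq': "\<gamma>' = \<gamma>" by auto
  obtain m where m: "cdot m p = \<gamma>" "cdot m e = \<alpha>" "cdot m f = \<beta>" using cdot_prescribe[OF b] .
  show ?thesis
  proof (rule that[of m])
    fix v assume v: "v \<noteq> 0" "F v = 0"
    obtain z x y where v': "v = z *s p + x *s e + y *s f" using cdet_coords[OF b] by metis
    \<comment> \<open>The two charts miss only the point \<open>p\<close>, which is not on the
      curve.\<close>
    consider "y \<noteq> 0" | "y = 0" "x \<noteq> 0" | "y = 0" "x = 0" by blast
    then show "s v = cdot m v"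
    proof cases
      case 1
      define u where "u = (z / y) *s p + (x / y) *s e + f"
      have vu: "v = y *s u" using 1 by (simp add: v' u_def vec.scale_right_distrib)
      then have "F u = 0" using v(2) 1 by (simp add: sF(4))
      then have "s u = \<beta> + \<alpha> * (x / y) + \<gamma> * (z / y)"
        using R(2)[of "z / y" "x / y"] by (simp add: u_def[symmetric] linR r0 r1[simplified] mult.commute)
      then have "s v = y * (\<beta> + \<alpha> * (x / y) + \<gamma> * (z / y))"
        using hom[OF 1 _ \<open>F u = 0\<close>] vu v(1) by auto
      also have "\<dots> = cdot m v" using 1 by (simp add: v' m field_simps)
      finally show ?thesis .
    next
      case 2
      define u where "u = (z / x) *s p + 0 *s f + e"
      have vu: "v = x *s u" using 2 by (simp add: v' u_def vec.scale_right_distrib)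
      then have "F u = 0" using v(2) 2 by (simp add: sF(4))
      then have "s u = \<alpha> + \<gamma> * (z / x)"
        using T(2)[of "z / x" 0] by (simp only: u_def[symmetric] linT t0 t1 eq eq') simp
      then have "s v = x * (\<alpha> + \<gamma> * (z / x))"
        using hom[OF 2(2) _ \<open>F u = 0\<close>] vu v(1) by auto
      also have "\<dots> = cdot m v" using 2 by (simp add: v' m field_simps)
      finally show ?thesis .
    next
      case 3
      then have "F v = z ^ 4 * F p" by (simp add: v' sF(4))
      then show ?thesis using v 3 p by (simp add: v')
    qed
  qed
qed

text \<open>A linear map fixing all points of the curve fixes three points on each of two lines through
  a common point.\<close>

lemma curve_eigenvectors:
  assumes F: "smooth_form F"
    and M: "\<And>u v. M (u + v) = M u + M v" "\<And>c v. M (c *s v) = c *s M v"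
    and eig: "\<And>v. v \<noteq> 0 \<Longrightarrow> F v = 0 \<Longrightarrow> \<exists>c. M v = c *s v"
  obtains c where "\<And>v. M v = c *s v"
proof -
  note sF = smooth_formD[OF F]
  obtain p where p: "F p \<noteq> 0" using smooth_form_nonzero[OF F] .
  have p0: "p \<noteq> 0" using p form_0_vec[OF sF(1)] by auto
  obtain e f where b: "cdet p e f \<noteq> 0" using nonzero_extend_basis[OF p0] .
  have line: "\<exists>c. M p = c *s p \<and> M w = c *s w"
    if "card {z. F (z *s p + w) = 0} = 4" "ccross p w \<noteq> 0" for w
  proof -
    have "finite {z. F (z *s p + w) = 0}" using that(1) card.infinite by fastforce
    have "3 \<le> card {z. F (z *s p + w) = 0}" using that(1) by simp
    then obtain Z where "Z \<subseteq> {z. F (z *s p + w) = 0}" "card Z = 3"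
      by (rule obtain_subset_with_card_n)
    then obtain x y z where xyz: "F (x *s p + w) = 0" "F (y *s p + w) = 0" "F (z *s p + w) = 0"
      "x \<noteq> y" "x \<noteq> z" "y \<noteq> z" by (auto simp: card_3_iff)
    have nz: "r *s p + w \<noteq> 0" for r
      using ccross_nonzero_indep(2)[OF that(2), of r 1] by auto
    obtain a b c where abc: "M (x *s p + w) = a *s (x *s p + w)" "M (y *s p + w) = b *s (y *s p + w)"
      "M (z *s p + w) = c *s (z *s p + w)"
      using eig[OF nz xyz(1)] eig[OF nz xyz(2)] eig[OF nz xyz(3)] by blast
    define u where "u = M p"
    have mw: "x *s u + M w = (a * x) *s p + a *s w" "y *s u + M w = (b * y) *s p + b *s w"
      "z *s u + M w = (c * z) *s p + c *s w"
      using abc by (simp_all add: M u_def vec.scale_right_distrib)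
    \<comment> \<open>The weights \<open>y - z\<close>, \<open>z - x\<close>, \<open>x - y\<close>
      eliminate both \<open>u\<close> and \<open>M w\<close> from the three equations; what remains
      compares the eigenvalues.\<close>
    have "((y - z) * (a * x) + (z - x) * (b * y) + (x - y) * (c * z)) *s p
        + ((y - z) * a + (z - x) * b + (x - y) * c) *s w
        = (y - z) *s ((a * x) *s p + a *s w) + (z - x) *s ((b * y) *s p + b *s w)
        + (x - y) *s ((c * z) *s p + c *s w)"
      by (simp add: vec_eq_iff algebra_simps)
    also have "\<dots> = 0" unfolding mw[symmetric] by (simp add: vec_eq_iff algebra_simps)
    finally have "(y - z) * (a * x) + (z - x) * (b * y) + (x - y) * (c * z) = 0"
      "(y - z) * a + (z - x) * b + (x - y) * c = 0"
      using ccross_nonzero_indep[OF that(2)] by blast+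
    then have "(y - z) * (x - z) * (a - c) + (z - x) * (y - z) * (b - c) = 0"
      "(y - z) * (a - c) + (z - x) * (b - c) = 0" by algebra+
    then have "(z - x) * (y - x) * (b - c) = 0" by algebra
    then have "b = c" using xyz by simp
    with \<open>(y - z) * (a - c) + (z - x) * (b - c) = 0\<close> have "a = c" using xyz by simp
    have "(x - y) *s u = ((a * x) *s p + a *s w) - ((b * y) *s p + b *s w)"
      unfolding mw[symmetric] by (simp add: vec_eq_iff algebra_simps)
    also have "\<dots> = (x - y) *s (c *s p)" using \<open>a = c\<close> \<open>b = c\<close> by (simp add: vec_eq_iff algebra_simps)
    finally have "u = c *s p" using xyz(4) by (simp only: vec.scale_left_imp_eq[of "x - y"] right_minus_eq vec.scale_cancel_left) simp
    moreover have "M w = c *s w" using mw(3) \<open>u = c *s p\<close> by (simp add: vec_eq_iff algebra_simps)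
    ultimately show ?thesis by (auto simp: u_def)
  qed
  define G where "G = {t. card {z. F (z *s p + (t *s e + f)) = 0} = 4}"
  have "- G = {t. card {z. F (z *s p + t *s e + f) = 0} \<noteq> 4}"
    by (auto simp: G_def add.assoc)
  then have "finite (- G)" using finite_bad_fibres[OF F p b] by simp
  then have inf: "infinite G"
    using infinite_UNIV_char_0[where 'a = complex] finite_compl[of "- G"] by auto
  then have "G \<noteq> {}" by auto
  then obtain t where "t \<in> G" by blast
  have "infinite (G - {t})" using inf by simp
  then have "G - {t} \<noteq> {}" by (metis finite.emptyI)
  then obtain t' where "t' \<in> G" "t' \<noteq> t" by blast
  then have t: "card {z. F (z *s p + (t *s e + f)) = 0} = 4"
    and t': "card {z. F (z *s p + (t' *s e + f)) = 0} = 4" "t' \<noteq> t"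
    using \<open>t \<in> G\<close> by (simp_all add: G_def)
  have nz: "ccross p (r *s e + f) \<noteq> 0" for r
  proof
    assume "ccross p (r *s e + f) = 0"
    then have "cdot e (ccross p (r *s e + f)) = 0" by simp
    moreover have "cdot e (ccross p (r *s e + f)) = - cdet p e f" by (simp add: c3_simps algebra_simps)
    ultimately show False using b by simp
  qed
  \<comment> \<open>Both lines contain \<open>p\<close>, so their eigenvalues agree; the difference
    of the two base vectors is a multiple of \<open>e\<close>.\<close>
  obtain c where c: "M p = c *s p" "M (t *s e + f) = c *s (t *s e + f)" using line[OF t nz] by blast
  obtain c' where c': "M p = c' *s p" "M (t' *s e + f) = c' *s (t' *s e + f)" using line[OF t'(1) nz] by blast
  have "c' = c" using c(1) c'(1) p0 by simp
  have "(t' - t) *s M e = M (t' *s e + f) - M (t *s e + f)" by (simp add: M vec_eq_iff algebra_simps)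
  also have "\<dots> = (t' - t) *s (c *s e)" unfolding c c' \<open>c' = c\<close> by (simp add: vec_eq_iff algebra_simps)
  finally have me: "M e = c *s e" using t'(2) by (metis vec.scale_cancel_left right_minus_eq)
  then have mf: "M f = c *s f" using c(2) by (simp add: M vec_eq_iff algebra_simps)
  show ?thesis
  proof (rule that[of c])
    fix v
    obtain x y z where "v = x *s p + y *s e + z *s f" using cdet_coords[OF b] by metis
    then show "M v = c *s v"
      using c(1) me mf by (simp only: M) (simp add: vec.scale_right_distrib mult.commute)
  qed
qed

section \<open>Bitangents and centers of reflections\<close>

lemma mem_span1: "v \<in> vec.span {u :: c3} \<longleftrightarrow> (\<exists>c. v = c *s u)"
  by (auto simp: vec.span_singleton)

lemma mem_span2: "v \<in> vec.span {u, w :: c3} \<longleftrightarrow> (\<exists>x y. v = x *s u + y *s w)"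
  by (auto simp: vec.span_insert vec.span_singleton algebra_simps)

lemma span1_eq: assumes "v \<in> vec.span {u :: c3}" "v \<noteq> 0" shows "vec.span {v} = vec.span {u}"
proof -
  obtain c where c: "v = c *s u" using assms(1) by (auto simp: mem_span1)
  then have "c \<noteq> 0" using assms(2) by auto
  then have "u = (1 / c) *s v" by (simp add: c)
  then have "u \<in> vec.span {v}" unfolding mem_span1 by blast
  then show ?thesis using assms(1) by (intro equalityI vec.span_minimal) auto
qed

lemma span1_eqD: "vec.span {v} = vec.span {u :: c3} \<Longrightarrow> \<exists>c. v = c *s u"
  using vec.span_base[of v "{v}"] by (auto simp: mem_span1)

lemma mem_span_scale:
  fixes x :: c3
  assumes "c \<noteq> 0" "c *s x \<in> vec.span S" shows "x \<in> vec.span S"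
  using vec.span_scale[OF assms(2), of "1 / c"] assms(1) by simp

lemma span2_eq:
  fixes u w :: c3
  assumes "ccross v v' \<noteq> 0" "v \<in> vec.span {u, w}" "v' \<in> vec.span {u, w}"
  shows "vec.span {v, v'} = vec.span {u, w}"
proof
  show "vec.span {v, v'} \<subseteq> vec.span {u, w}"
    using assms by (intro vec.span_minimal) auto
  obtain a b c d where e: "v = a *s u + b *s w" "v' = c *s u + d *s w"
    using assms(2,3) by (auto simp: mem_span2)
  have "ccross v v' = (a * d - b * c) *s ccross u w"
    by (simp add: e c3_simps algebra_simps)
  then have D: "a * d - b * c \<noteq> 0" using assms(1) by auto
  have "(a * d - b * c) *s u = d *s v + (- b) *s v'" "(a * d - b * c) *s w = (- c) *s v + a *s v'"
    by (simp_all add: e vec_eq_iff algebra_simps)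
  then have "(a * d - b * c) *s u \<in> vec.span {v, v'}" "(a * d - b * c) *s w \<in> vec.span {v, v'}"
    unfolding mem_span2 by blast+
  moreover have "x \<in> vec.span {v, v'}" if "(a * d - b * c) *s x \<in> vec.span {v, v'}" for x
    using mem_span_scale[OF D that] .
  ultimately have "u \<in> vec.span {v, v'}" "w \<in> vec.span {v, v'}" by blast+
  then show "vec.span {u, w} \<subseteq> vec.span {v, v'}" by (intro vec.span_minimal) auto
qed

lemma span2_eqI:
  fixes u w :: c3
  assumes "ccross u w \<noteq> 0" "v = a *s u + b *s w" "v' = c *s u + d *s w" "a * d - b * c \<noteq> 0"
  shows "vec.span {v, v'} = vec.span {u, w}" "ccross v v' \<noteq> 0"
proof -
  have "ccross v v' = (a * d - b * c) *s ccross u w"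
    unfolding assms(2,3) by (simp add: c3_simps algebra_simps)
  then show "ccross v v' \<noteq> 0" using assms(1,4) by (simp only: vec.scale_eq_0_iff) simp
  then show "vec.span {v, v'} = vec.span {u, w}"
    by (rule span2_eq) (unfold mem_span2 assms(2,3), blast+)
qed

lemma line_basis_at:
  fixes u w :: c3
  assumes "p \<noteq> 0" "p \<in> vec.span {u, w}" "ccross u w \<noteq> 0"
  obtains v where "ccross p v \<noteq> 0" "vec.span {u, w} = vec.span {p, v}"
proof -
  obtain x y where xy: "p = x *s u + y *s w" using assms(2) by (auto simp: mem_span2)
  have uw: "u \<in> vec.span {u, w}" "w \<in> vec.span {u, w}" by (auto intro: vec.span_base)
  have "ccross p u = (- y) *s ccross u w" "ccross p w = x *s ccross u w"
    by (simp_all add: xy c3_simps algebra_simps)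
  moreover have "x \<noteq> 0 \<or> y \<noteq> 0" using assms(1) xy by auto
  ultimately have "ccross p u \<noteq> 0 \<or> ccross p w \<noteq> 0"
    using assms(3) by (auto simp only: vec.scale_eq_0_iff neg_equal_0_iff_equal)
  then show ?thesis using span2_eq[OF _ assms(2) uw(1)] span2_eq[OF _ assms(2) uw(2)] that by metis
qed

text \<open>The divisor 2P + 2P' as a normal form of the restricted quartic: the points of tangency
  are those of \<open>u\<close> and \<open>w\<close>, or twice that of \<open>u\<close> at a
  hyperflex. A nonzero \<open>c\<close> says that \<open>L\<close> is not a component.\<close>

definition bitangent :: "(c3 \<Rightarrow> complex) \<Rightarrow> c3 set \<Rightarrow> bool" where
  "bitangent F L \<longleftrightarrow> (\<exists>u w c. ccross u w \<noteq> 0 \<and> L = vec.span {u, w} \<and> c \<noteq> 0 \<and>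
     ((\<forall>x y. F (x *s u + y *s w) = c * x\<^sup>2 * y\<^sup>2) \<or> (\<forall>x y. F (x *s u + y *s w) = c * y ^ 4)))"

lemma bitangent_line: "bitangent F L \<Longrightarrow> \<exists>u w. ccross u w \<noteq> 0 \<and> L = vec.span {u, w}"
  unfolding bitangent_def by blast

text \<open>Unlike the normal form, being a square survives every linear substitution.\<close>

lemma bitangent_square:
  assumes "bitangent F L" "v \<in> L" "v' \<in> L"
  obtains \<alpha> \<beta> \<gamma> where "\<And>x y. F (x *s v + y *s v') = (\<alpha> * x\<^sup>2 + \<beta> * x * y + \<gamma> * y\<^sup>2)\<^sup>2"
proof -
  from assms(1) obtain u w k where L: "L = vec.span {u, w}"
    and k: "(\<forall>x y. F (x *s u + y *s w) = k * x\<^sup>2 * y\<^sup>2) \<or> (\<forall>x y. F (x *s u + y *s w) = k * y ^ 4)"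
    unfolding bitangent_def by blast
  obtain a b c d where e: "v = a *s u + b *s w" "v' = c *s u + d *s w"
    using assms(2,3) by (auto simp: mem_span2 L)
  have vv: "x *s v + y *s v' = (a * x + c * y) *s u + (b * x + d * y) *s w" for x y
    by (simp add: e vec_eq_iff algebra_simps)
  define r where "r = csqrt k"
  have r: "k = r\<^sup>2" by (simp add: r_def)
  from k show ?thesis
  proof
    assume k: "\<forall>x y. F (x *s u + y *s w) = k * x\<^sup>2 * y\<^sup>2"
    have "F (x *s v + y *s v') = (r * a * b * x\<^sup>2 + r * (a * d + b * c) * x * y + r * c * d * y\<^sup>2)\<^sup>2" for x y
      unfolding vv k[rule_format] r by algebra
    then show ?thesis by (rule that)
  next
    assume k: "\<forall>x y. F (x *s u + y *s w) = k * y ^ 4"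
    have "F (x *s v + y *s v') = (r * b\<^sup>2 * x\<^sup>2 + 2 * r * b * d * x * y + r * d\<^sup>2 * y\<^sup>2)\<^sup>2" for x y
      unfolding vv k[rule_format] r by algebra
    then show ?thesis by (rule that)
  qed
qed

text \<open>Over the complex numbers the quadratic splits; distinct factors give the two points of
  tangency, \<open>\<gamma> = 0\<close> a hyperflex. The diagonal case is the one that occurs on
  lines through a center.\<close>

lemma square_bitangent:
  assumes uw: "ccross u w \<noteq> 0" and F: "\<And>x y. F (x *s u + y *s w) = (\<alpha> * x\<^sup>2 + \<gamma> * y\<^sup>2)\<^sup>2"
    and "\<alpha> \<noteq> 0"
  shows "bitangent F (vec.span {u, w})"
proof (cases "\<gamma> = 0")
  case True
  have "vec.span {w, u} = vec.span {u, w}" by (simp add: insert_commute)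
  moreover have "ccross w u \<noteq> 0" using uw ccross_swap[of w u] by simp
  moreover have "F (x *s w + y *s u) = \<alpha>\<^sup>2 * y ^ 4" for x y
    using F[of y x] True by (simp add: add.commute power_mult_distrib flip: power_mult)
  ultimately show ?thesis unfolding bitangent_def using \<open>\<alpha> \<noteq> 0\<close>
    by (intro exI[of _ w] exI[of _ u] exI[of _ "\<alpha>\<^sup>2"]) auto
next
  case False
  define r where "r = csqrt (- \<gamma> / \<alpha>)"
  have r: "\<gamma> = - \<alpha> * r\<^sup>2" using \<open>\<alpha> \<noteq> 0\<close> by (simp add: r_def)
  then have r0: "r \<noteq> 0" using False by auto
  \<comment> \<open>In this basis the coordinates are the linear factors \<open>a - r * b\<close>
    and \<open>a + r * b\<close> of \<open>a\<^sup>2 - r\<^sup>2 * b\<^sup>2\<close>.\<close>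
  define u' w' where "u' = (1/2) *s u + (-1 / (2 * r)) *s w" and "w' = (1/2) *s u + (1 / (2 * r)) *s w"
  have "(1/2) * (1 / (2 * r)) - (-1 / (2 * r)) * (1/2) \<noteq> 0" using r0 by simp
  note sp = span2_eqI[OF uw u'_def w'_def this]
  have "F (x *s u' + y *s w') = \<alpha>\<^sup>2 * x\<^sup>2 * y\<^sup>2" for x y
  proof -
    have "x *s u' + y *s w' = ((x + y) / 2) *s u + ((y - x) / (2 * r)) *s w"
      using r0 by (simp add: u'_def w'_def vec_eq_iff field_simps)
    moreover have "\<alpha> * ((x + y) / 2)\<^sup>2 + \<gamma> * ((y - x) / (2 * r))\<^sup>2 = \<alpha> * x * y"
      unfolding r using r0 by (simp add: field_simps power2_eq_square)
    ultimately show ?thesis by (simp add: F power_mult_distrib)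
  qed
  then show ?thesis unfolding bitangent_def using \<open>\<alpha> \<noteq> 0\<close> sp
    by (intro exI[of _ u'] exI[of _ w'] exI[of _ "\<alpha>\<^sup>2"]) auto
qed

text \<open>Once \<open>cdot a p = 1\<close>, the harmonic homology with center \<open>p\<close> and
  mirror \<open>cdot a v = 0\<close>.\<close>

definition reflection :: "c3 \<Rightarrow> c3 \<Rightarrow> c3 \<Rightarrow> c3" where
  "reflection p a v = v - (2 * cdot a v) *s p"

text \<open>Invariance of the form, not only of the curve, is demanded;
  \<open>reflection_preserving_curve_center\<close> recovers it from the curve.\<close>

definition is_center :: "(c3 \<Rightarrow> complex) \<Rightarrow> c3 \<Rightarrow> c3 \<Rightarrow> bool" where
  "is_center F p a \<longleftrightarrow> cdot a p = 1 \<and> (\<forall>v. F (reflection p a v) = F v)"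

lemma reflection_simps:
  "reflection p a (u + v) = reflection p a u + reflection p a v" "reflection p a (c *s v) = c *s reflection p a v"
  "cdot a p = 1 \<Longrightarrow> reflection p a (reflection p a v) = v"
  by (simp_all add: reflection_def vec_eq_iff algebra_simps)

lemma is_center_nonzero: "is_center F p a \<Longrightarrow> p \<noteq> 0"
  by (auto simp: is_center_def)

lemma quartic_poly_zero:
  fixes c0 c1 c2 c3 c4 :: complex
  assumes "\<And>y. c0 + c1 * y + c2 * y\<^sup>2 + c3 * y ^ 3 + c4 * y ^ 4 = 0"
  shows "c0 = 0" "c1 = 0" "c2 = 0" "c3 = 0" "c4 = 0"
proof -
  have "poly [:c0, c1, c2, c3, c4:] y = 0" for y
    using assms[of y] by (simp add: power_numeral_reduce algebra_simps)
  then have "[:c0, c1, c2, c3, c4:] = 0" by (metis poly_all_0_iff_0)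
  then show "c0 = 0" "c1 = 0" "c2 = 0" "c3 = 0" "c4 = 0" by auto
qed

lemma quartic_expand_grad:
  assumes "form 4 F"
  obtains h2 h3 h4 where "form 2 h2" "form 3 h3" "form 4 h4"
    "\<And>x w. F (x *s p + w) = F p * x ^ 4 + cdot (grad F p) w * x ^ 3 + h2 w * x\<^sup>2 + h3 w * x + h4 w"
proof -
  obtain a h2 h3 h4 where h: "form 2 h2" "form 3 h3" "form 4 h4"
    "\<And>x w. F (x *s p + w) = F p * x ^ 4 + cdot a w * x ^ 3 + h2 w * x\<^sup>2 + h3 w * x + h4 w"
    using quartic_expand[OF assms(1)] by metis
  have "cdot (grad F p) w = cdot a w" for w
  proof (rule cdot_gradI[OF form_polyfun[OF assms]])
    have "F (p + t *s w) = F p + t * cdot a w + t\<^sup>2 * h2 w + t ^ 3 * h3 w + t ^ 4 * h4 w" for t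
      using h(4)[of 1 "t *s w"]
      by (simp add: form_homogeneous[OF h(1)] form_homogeneous[OF h(2)] form_homogeneous[OF h(3)])
    moreover have "((\<lambda>t. F p + t * cdot a w + t\<^sup>2 * h2 w + t ^ 3 * h3 w + t ^ 4 * h4 w)
        has_field_derivative cdot a w) (at 0)"
      by (auto intro!: derivative_eq_intros)
    ultimately show "((\<lambda>t. F (p + t *s w)) has_field_derivative cdot a w) (at 0)" by simp
  qed
  then show ?thesis using that[OF h(1-3)] h(4) by simp
qed

lemma eq_cdotI: assumes "\<And>v. cdot a v = cdot b v" shows "a = b"
  using assms[of "axis _ 1"] by (simp add: vec_eq_iff)

text \<open>The symmetry kills the odd coefficients. So the gradient at \<open>p\<close> vanishes on
  the mirror and is, by Euler's identity, a multiple of \<open>a\<close>; a center on the curve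
  would be a singular point. In particular \<open>p\<close> determines \<open>a\<close>.\<close>

lemma center_expand:
  assumes F: "smooth_form F" and c: "is_center F p a"
  shows "F p \<noteq> 0" "grad F p = (4 * F p) *s a"
    "\<exists>h2 h4. form 2 h2 \<and> form 4 h4 \<and>
      (\<forall>x w. cdot a w = 0 \<longrightarrow> F (x *s p + w) = F p * x ^ 4 + h2 w * x\<^sup>2 + h4 w)"
proof -
  note sF = smooth_formD[OF F]
  have ap: "cdot a p = 1" and inv: "\<And>v. F (reflection p a v) = F v" using c by (auto simp: is_center_def)
  obtain h2 h3 h4 where h: "form 2 h2" "form 3 h3" "form 4 h4"
    "\<And>x w. F (x *s p + w) = F p * x ^ 4 + cdot (grad F p) w * x ^ 3 + h2 w * x\<^sup>2 + h3 w * x + h4 w"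
    using quartic_expand_grad[OF sF(1)] by metis
  have odd: "cdot (grad F p) w = 0 \<and> h3 w = 0" if w: "cdot a w = 0" for w
  proof -
    have "F (x *s p + w) = F ((- x) *s p + w)" for x
    proof -
      have "reflection p a (x *s p + w) = (- x) *s p + w"
        by (simp add: reflection_def ap w vec_eq_iff algebra_simps)
      then show ?thesis using inv by metis
    qed
    \<comment> \<open>Two values of \<open>x\<close> separate the two odd coefficients.\<close>
    from this[of 1] this[of 2]
    have "h3 w + cdot (grad F p) w = 0" "h3 w + 4 * cdot (grad F p) w = 0" unfolding h(4) by simp_all algebra+
    then show ?thesis by algebra
  qed
  show g: "grad F p = (4 * F p) *s a"
  proof (rule eq_cdotI)
    fix v
    have v: "v = cdot a v *s p + (v - cdot a v *s p)" by simp
    have "cdot (grad F p) (v - cdot a v *s p) = 0"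
      using odd[of "v - cdot a v *s p"] by (simp add: ap)
    then show "cdot (grad F p) v = cdot ((4 * F p) *s a) v"
      using form_grad(1)[OF sF(1), of p] by simp
  qed
  show "F p \<noteq> 0"
  proof
    assume "F p = 0"
    then show False using sF(3)[OF is_center_nonzero[OF c]] g by simp
  qed
  show "\<exists>h2 h4. form 2 h2 \<and> form 4 h4 \<and>
      (\<forall>x w. cdot a w = 0 \<longrightarrow> F (x *s p + w) = F p * x ^ 4 + h2 w * x\<^sup>2 + h4 w)"
    using h odd by (intro exI[of _ h2] exI[of _ h4]) auto
qed

section \<open>Bitangents through a center\<close>

definition bitangents_at :: "(c3 \<Rightarrow> complex) \<Rightarrow> c3 \<Rightarrow> c3 set set" where
  "bitangents_at F p = {L. bitangent F L \<and> p \<in> L}"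

text \<open>A square that vanishes at \<open>p\<close> has derivative zero there, so the line is the
  tangent at \<open>p\<close>. Hence two different bitangents never meet on the curve.\<close>

lemma bitangents_at_curve_point:
  assumes F: "smooth_form F" and p: "p \<noteq> 0" "F p = 0" and L: "L \<in> bitangents_at F p"
  shows "L = {v. cdot (grad F p) v = 0}"
proof -
  note sF = smooth_formD[OF F]
  have L': "bitangent F L" "p \<in> L" using L by (auto simp: bitangents_at_def)
  then obtain w where w: "ccross p w \<noteq> 0" "L = vec.span {p, w}"
    using bitangent_line[OF L'(1)] line_basis_at[OF p(1)] by metis
  have "w \<in> L" by (auto simp: w intro: vec.span_base)
  then obtain \<alpha> \<beta> \<gamma> where sq: "\<And>x y. F (x *s p + y *s w) = (\<alpha> * x\<^sup>2 + \<beta> * x * y + \<gamma> * y\<^sup>2)\<^sup>2"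
    using bitangent_square[OF L'] by metis
  have "\<alpha> = 0" using sq[of 1 0] p by simp
  then have "F (p + t *s w) = (\<beta> * t + \<gamma> * t\<^sup>2)\<^sup>2" for t using sq[of 1 t] by simp
  moreover have "((\<lambda>t. (\<beta> * t + \<gamma> * t\<^sup>2)\<^sup>2) has_field_derivative 0) (at 0)"
    by (auto intro!: derivative_eq_intros)
  ultimately have gw: "cdot (grad F p) w = 0" by (intro cdot_gradI[OF sF(2)]) simp
  have gp: "cdot (grad F p) p = 0" using form_grad(1)[OF sF(1), of p] p by simp
  obtain h where h: "cdet p w h \<noteq> 0" using ccross_nonzero_extend[OF w(1)] .
  have gh: "cdot (grad F p) h \<noteq> 0"
  proof
    assume "cdot (grad F p) h = 0"
    then have "cdot (grad F p) v = cdot 0 v" for v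
      using cdet_coords[OF h, of v] gp gw by (metis (no_types) cdot_add_right cdot_scale_right cdot_zero_left mult_zero_right add_0)
    then have "grad F p = 0" by (rule eq_cdotI)
    then show False using sF(3) p by blast
  qed
  show ?thesis
  proof (intro equalityI subsetI)
    fix v assume "v \<in> L"
    then show "v \<in> {v. cdot (grad F p) v = 0}" using gp gw by (auto simp: w mem_span2)
  next
    fix v assume v: "v \<in> {v. cdot (grad F p) v = 0}"
    obtain x y z where "v = x *s p + y *s w + z *s h" using cdet_coords[OF h] by metis
    moreover from this have "z = 0" using v gp gw gh by simp
    ultimately show "v \<in> L" by (auto simp: w mem_span2)
  qed
qed

lemma line_kernel_basis:
  assumes L: "bitangent F L" "p \<in> L" and a: "cdot a p = 1"
  obtains w where "L = vec.span {p, w}" "ccross p w \<noteq> 0" "cdot a w = 0"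
proof -
  have "p \<noteq> 0" using a by auto
  then obtain v where v: "ccross p v \<noteq> 0" "L = vec.span {p, v}"
    using bitangent_line[OF L(1)] line_basis_at L(2) by metis
  define w where "w = (- cdot a v) *s p + 1 *s v"
  have "p = 1 *s p + 0 *s v" by simp
  note sp = span2_eqI[OF v(1) this w_def]
  show ?thesis
  proof (rule that)
    show "L = vec.span {p, w}" "ccross p w \<noteq> 0" using sp v(2) by simp_all
    show "cdot a w = 0" using a by (simp add: w_def)
  qed
qed

lemma card_4E:
  assumes "card S = 4" obtains a b c d where "S = {a, b, c, d}" "distinct [a, b, c, d]"
  using assms by (auto simp: card_Suc_eq eval_nat_numeral)

text \<open>A cubic form on the pencil of lines vanishes on every bitangent through the point; four zeros
  force it to vanish identically.\<close>

lemma four_bitangents_center: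
  assumes F: "smooth_form F" and p: "p \<noteq> 0" and four: "card (bitangents_at F p) = 4"
  obtains a where "is_center F p a"
proof -
  note sF = smooth_formD[OF F]
  obtain L1 L2 L3 L4 where L: "bitangents_at F p = {L1, L2, L3, L4}" "distinct [L1, L2, L3, L4]"
    by (rule card_4E[OF four])
  have mem: "L1 \<in> bitangents_at F p" "L2 \<in> bitangents_at F p" "L3 \<in> bitangents_at F p"
    "L4 \<in> bitangents_at F p" by (simp_all add: L(1))
  have Fp: "F p \<noteq> 0"
  proof
    assume z: "F p = 0"
    have "L1 = L2"
      using bitangents_at_curve_point[OF F p z mem(1)] bitangents_at_curve_point[OF F p z mem(2)]
      by (rule trans[OF _ sym])
    then show False using L(2) by simp
  qed
  obtain h2 h3 h4 where h: "form 2 h2" "form 3 h3" "form 4 h4"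
    "\<And>x w. F (x *s p + w) = F p * x ^ 4 + cdot (grad F p) w * x ^ 3 + h2 w * x\<^sup>2 + h3 w * x + h4 w"
    using quartic_expand_grad[OF sF(1)] by metis
  \<comment> \<open>The mirror is taken to be the kernel of the gradient at \<open>p\<close>, which
    removes the term with \<open>x ^ 3\<close>; the factor makes \<open>cdot a p = 1\<close> by
    Euler's identity.\<close>
  define a where "a = (1 / (4 * F p)) *s grad F p"
  have g: "grad F p = (4 * F p) *s a" using Fp by (simp add: a_def)
  have ap: "cdot a p = 1" using Fp form_grad(1)[OF sF(1), of p] by (simp add: a_def)
  have ex: "\<exists>w. L = vec.span {p, w} \<and> ccross p w \<noteq> 0 \<and> cdot a w = 0 \<and> h3 w = 0"
    if "L \<in> bitangents_at F p" for L
  proof -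
    have L': "bitangent F L" "p \<in> L" using that by (auto simp: bitangents_at_def)
    obtain w where w: "L = vec.span {p, w}" "ccross p w \<noteq> 0" "cdot a w = 0"
      using line_kernel_basis[OF L' ap] .
    have "w \<in> L" by (auto simp: w intro: vec.span_base)
    then obtain \<alpha> \<beta> \<gamma> where sq: "\<And>x y. F (x *s p + y *s w) = (\<alpha> * x\<^sup>2 + \<beta> * x * y + \<gamma> * y\<^sup>2)\<^sup>2"
      using bitangent_square[OF L'] by metis
    have "(\<alpha>\<^sup>2 - F p) + (2 * \<alpha> * \<beta>) * y + (2 * \<alpha> * \<gamma> + \<beta>\<^sup>2 - h2 w) * y\<^sup>2 + (2 * \<beta> * \<gamma> - h3 w) * y ^ 3
      + (\<gamma>\<^sup>2 - h4 w) * y ^ 4 = 0" for y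
      using sq[of 1 y] h(4)[of 1 "y *s w"] w(3)
      by (simp add: g form_homogeneous[OF h(1)] form_homogeneous[OF h(2)] form_homogeneous[OF h(3)]) algebra
    \<comment> \<open>\<open>\<alpha>\<^sup>2 = F p\<close> is nonzero, so
      \<open>2 * \<alpha> * \<beta> = 0\<close> gives \<open>\<beta> = 0\<close>, and then
      \<open>h3 w = 2 * \<beta> * \<gamma> = 0\<close>.\<close>
    from quartic_poly_zero[OF this] have "h3 w = 0" using Fp by auto
    then show ?thesis using w by blast
  qed
  obtain w1 where w1: "L1 = vec.span {p, w1}" "ccross p w1 \<noteq> 0" "cdot a w1 = 0" "h3 w1 = 0" using ex[OF mem(1)] by blast
  obtain w2 where w2: "L2 = vec.span {p, w2}" "ccross p w2 \<noteq> 0" "cdot a w2 = 0" "h3 w2 = 0" using ex[OF mem(2)] by blast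
  obtain w3 where w3: "L3 = vec.span {p, w3}" "ccross p w3 \<noteq> 0" "cdot a w3 = 0" "h3 w3 = 0" using ex[OF mem(3)] by blast
  obtain w4 where w4: "L4 = vec.span {p, w4}" "ccross p w4 \<noteq> 0" "cdot a w4 = 0" "h3 w4 = 0" using ex[OF mem(4)] by blast
  have neq: "cdet p w w' \<noteq> 0" if ww: "vec.span {p, w} \<noteq> vec.span {p, w'}" "ccross p w \<noteq> 0" "ccross p w' \<noteq> 0" for w w'
  proof
    assume z: "cdet p w w' = 0"
    obtain e where e: "cdet p w e \<noteq> 0" using ccross_nonzero_extend[OF ww(2)] .
    obtain x y z where w': "w' = x *s p + y *s w + z *s e" using cdet_coords[OF e] by metis
    then have "z * cdet p w e = 0" using z cdet_comb(3)[of p w x y z e] by simp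
    then have "w' = x *s p + y *s w" using e w' by simp
    then have "w' \<in> vec.span {p, w}" unfolding mem_span2 by blast
    moreover have "p \<in> vec.span {p, w}" by (rule vec.span_base) simp
    ultimately show False using span2_eq[OF ww(3)] ww(1) by metis
  qed
  have b: "cdet p w1 w2 \<noteq> 0" using neq L(2) w1 w2 by auto
  note dec = kernel_decomp[OF ap w1(3) w2(3) b]
  obtain y3 z3 where e3: "w3 = y3 *s w1 + z3 *s w2" using dec[of w3] w3(3) by auto
  obtain y4 z4 where e4: "w4 = y4 *s w1 + z4 *s w2" using dec[of w4] w4(3) by auto
  obtain c0 c1 c2 c3 where cub: "\<And>x y. h3 (x *s w1 + y *s w2) = c0 * x ^ 3 + c1 * x\<^sup>2 * y + c2 * x * y\<^sup>2 + c3 * y ^ 3"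
    using form_3_binary[OF h(2)] by metis
  \<comment> \<open>With zeros at both basis vectors the cubic is \<open>x * y\<close> times a
    linear form; two further distinct zeros kill that form.\<close>
  have c03: "c0 = 0" "c3 = 0" using cub[of 1 0] cub[of 0 1] w1(4) w2(4) by simp_all
  have d34: "cdet p w3 w4 = (y3 * z4 - z3 * y4) * cdet p w1 w2"
    and d13: "cdet p w1 w3 = z3 * cdet p w1 w2" and d23: "cdet p w2 w3 = - y3 * cdet p w1 w2"
    and d14: "cdet p w1 w4 = z4 * cdet p w1 w2" and d24: "cdet p w2 w4 = - y4 * cdet p w1 w2"
    unfolding e3 e4 by (simp_all add: c3_simps algebra_simps)
  have nz: "y3 * z4 - z3 * y4 \<noteq> 0" "z3 \<noteq> 0" "y3 \<noteq> 0" "z4 \<noteq> 0" "y4 \<noteq> 0"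
    using neq[of w3 w4] neq[of w1 w3] neq[of w2 w3] neq[of w1 w4] neq[of w2 w4] L(2) w1 w2 w3 w4 d34 d13 d23 d14 d24
    by auto
  have "y3 * z3 * (c1 * y3 + c2 * z3) = 0" "y4 * z4 * (c1 * y4 + c2 * z4) = 0"
    using cub[of y3 z3] cub[of y4 z4] w3(4) w4(4) c03 unfolding e3 e4 by (simp_all add: power2_eq_square algebra_simps)
  then have "c1 * y3 + c2 * z3 = 0" "c1 * y4 + c2 * z4 = 0" using nz by simp_all
  then have "c1 * (y3 * z4 - z3 * y4) = 0" "c2 * (y3 * z4 - z3 * y4) = 0" by algebra+
  then have c12: "c1 = 0" "c2 = 0" using nz by simp_all
  have h3: "h3 w = 0" if "cdot a w = 0" for w
    using dec[of w] that cub c03 c12 by auto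
  have "F (reflection p a v) = F v" for v
  proof -
    define w where "w = v - cdot a v *s p"
    have aw: "cdot a w = 0" by (simp add: w_def ap)
    have "v = cdot a v *s p + w" "reflection p a v = (- cdot a v) *s p + w"
      by (simp_all add: w_def reflection_def vec_eq_iff)
    then show ?thesis using h(4)[of "cdot a v" w] h(4)[of "- cdot a v" w] aw h3[OF aw] by (simp add: g)
  qed
  then show ?thesis using ap that[of a] by (simp add: is_center_def)
qed

text \<open>The discriminant of \<open>F\<close> as a quadratic in \<open>x\<^sup>2\<close>. At a
  zero \<open>w\<close> the double root is \<open>x\<^sup>2 = - h2 w / (2 * F p)\<close>, and at
  \<open>v = x *s p + w\<close> both \<open>F\<close> and its derivative along \<open>p\<close>
  vanish. Along the mirror the derivative of the discriminant is \<open>- 4 * F p\<close> times that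
  of \<open>F\<close>, so a multiple zero would be a singular point.\<close>

lemma center_discriminant:
  assumes F: "smooth_form F" and c: "is_center F p a"
  obtains h2 h4 where "form 2 h2" "form 4 h4"
    "\<forall>x w. cdot a w = 0 \<longrightarrow> F (x *s p + w) = F p * x ^ 4 + h2 w * x\<^sup>2 + h4 w"
    "form 4 (\<lambda>w. h2 w * h2 w + (- 4 * F p) * h4 w)"
    "\<forall>w. cdot a w = 0 \<longrightarrow> w \<noteq> 0 \<longrightarrow> h2 w * h2 w + (- 4 * F p) * h4 w = 0 \<longrightarrow>
      (\<exists>w'. cdot a w' = 0 \<and> cdot (grad (\<lambda>w. h2 w * h2 w + (- 4 * F p) * h4 w) w) w' \<noteq> 0)"
proof -
  note sF = smooth_formD[OF F]
  have ap: "cdot a p = 1" using c by (simp add: is_center_def)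
  have k: "F p \<noteq> 0" using center_expand(1)[OF F c] .
  obtain h2 h4 where h: "form 2 h2" "form 4 h4"
    "\<And>x w. cdot a w = 0 \<Longrightarrow> F (x *s p + w) = F p * x ^ 4 + h2 w * x\<^sup>2 + h4 w"
    using center_expand(3)[OF F c] by blast
  define D where "D = (\<lambda>w. h2 w * h2 w + (- 4 * F p) * h4 w)"
  have fD: "form 4 D" unfolding D_def
    using form_mult[OF h(1,1)] form_scale[OF h(2), of "- 4 * F p"] by (intro form_add) simp_all
  have "\<exists>w'. cdot a w' = 0 \<and> cdot (grad D w) w' \<noteq> 0" if w: "cdot a w = 0" "w \<noteq> 0" "D w = 0" for w
  proof (rule ccontr)
    assume "\<not> ?thesis"
    then have z: "cdot (grad D w) w' = 0" if "cdot a w' = 0" for w' using that by blast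
    define x where "x = csqrt (- h2 w / (2 * F p))"
    have "x\<^sup>2 = - h2 w / (2 * F p)" by (simp add: x_def)
    then have x2: "h2 w = - 2 * F p * x\<^sup>2" using k by (simp add: field_simps)
    define v where "v = x *s p + w"
    have av: "cdot a v = x" using ap w by (simp add: v_def)
    have v0: "v \<noteq> 0"
    proof
      assume "v = 0"
      moreover from this have "x = 0" using av by simp
      ultimately show False using w(2) by (simp add: v_def)
    qed
    have "4 * F p * (F p * x ^ 4 + h2 w * x\<^sup>2 + h4 w) = - D w" unfolding D_def x2 by algebra
    then have Fv: "F v = 0" using h(3)[OF w(1), of x] k w(3) by (simp add: v_def)
    have gp: "cdot (grad F v) p = 0"
    proof (rule cdot_gradI[OF sF(2)])
      have "F (v + t *s p) = F p * (x + t) ^ 4 + h2 w * (x + t)\<^sup>2 + h4 w" for t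
        using h(3)[OF w(1), of "x + t"] by (simp add: v_def vec.scale_left_distrib add_ac)
      moreover have "((\<lambda>t. F p * (x + t) ^ 4 + h2 w * (x + t)\<^sup>2 + h4 w) has_field_derivative 0) (at 0)"
        by (rule derivative_eq_intros refl)+ (simp add: x2 power2_eq_square power3_eq_cube)
      ultimately show "((\<lambda>t. F (v + t *s p)) has_field_derivative 0) (at 0)" by simp
    qed
    have gw: "cdot (grad F v) w' = 0" if w': "cdot a w' = 0" for w'
    proof -
      define g2 g4 where "g2 = cdot (grad h2 w) w'" and "g4 = cdot (grad h4 w) w'"
      have d2: "((\<lambda>t. h2 (w + t *s w')) has_field_derivative g2) (at 0)"
        and d4: "((\<lambda>t. h4 (w + t *s w')) has_field_derivative g4) (at 0)"
        unfolding g2_def g4_def by (intro grad_line form_polyfun[OF h(1)] form_polyfun[OF h(2)])+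
      have "cdot (grad D w) w' = 2 * h2 w * g2 - 4 * F p * g4"
        unfolding D_def
        by (rule cdot_gradI[OF form_polyfun[OF fD[unfolded D_def]]])
          (rule derivative_eq_intros d2 d4 refl | simp)+
      then have "- 4 * F p * (x\<^sup>2 * g2 + g4) = 0" using z[OF w'] unfolding x2 by algebra
      then have e: "x\<^sup>2 * g2 + g4 = 0" using k by simp
      show ?thesis
      proof (rule cdot_gradI[OF sF(2)])
        have "F (v + t *s w') = F p * x ^ 4 + h2 (w + t *s w') * x\<^sup>2 + h4 (w + t *s w')" for t
          using h(3)[of "w + t *s w'" x] w w' by (simp add: v_def add_ac)
        moreover have "((\<lambda>t. F p * x ^ 4 + h2 (w + t *s w') * x\<^sup>2 + h4 (w + t *s w')) has_field_derivative 0) (at 0)"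
          by (rule derivative_eq_intros d2 d4 refl)+ (use e in \<open>simp add: mult.commute\<close>)
        ultimately show "((\<lambda>t. F (v + t *s w')) has_field_derivative 0) (at 0)" by simp
      qed
    qed
    have "grad F v = 0"
    proof (rule eq_cdotI)
      fix u
      have "cdot (grad F v) (u - cdot a u *s p) = 0" using gw[of "u - cdot a u *s p"] ap by simp
      then show "cdot (grad F v) u = cdot 0 u" using gp by simp
    qed
    then show False using sF(3)[OF v0 Fv] by simp
  qed
  then show ?thesis using that[OF h(1,2)] h(3) fD unfolding D_def by blast
qed

lemma form_2_poly:
  assumes "form 2 H"
  obtains q where "degree q \<le> 2" "\<And>t. H (t *s e + f) = poly q t"
proof -
  obtain a b c where "\<And>x y. H (x *s e + y *s f) = a * x\<^sup>2 + b * x * y + c * y\<^sup>2"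
    using form_2_binary[OF assms] by metis
  from this[of _ 1] show ?thesis
    by (intro that[of "[:c, b, a:]"]) (simp_all add: power2_eq_square algebra_simps)
qed

lemma form_4_poly:
  assumes "form 4 H" "H e \<noteq> 0"
  obtains q where "degree q = 4" "\<And>t. H (t *s e + f) = poly q t"
proof -
  obtain a b c d g where e: "\<And>x y. H (x *s e + y *s f) = a * x ^ 4 + b * x ^ 3 * y + c * x\<^sup>2 * y\<^sup>2 + d * x * y ^ 3 + g * y ^ 4"
    using form_4_binary[OF assms(1)] by metis
  have "a \<noteq> 0" using e[of 1 0] assms(2) by simp
  then show ?thesis using e[of _ 1]
    by (intro that[of "[:g, d, c, b, a:]"]) (simp_all add: power_numeral_reduce algebra_simps)
qed

text \<open>The pencil is parametrised so that the discriminant does not vanish at \<open>e\<close>,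
  the value at infinity of \<open>t\<close>. Hence \<open>d\<close> has full degree 4 and no
  bitangent through \<open>p\<close> is lost.\<close>

lemma center_pencil:
  assumes F: "smooth_form F" and c: "is_center F p a"
  obtains h2 h4 e f d where "form 2 h2" "form 4 h4"
    "\<forall>x w. cdot a w = 0 \<longrightarrow> F (x *s p + w) = F p * x ^ 4 + h2 w * x\<^sup>2 + h4 w"
    "cdot a e = 0" "cdot a f = 0" "cdet p e f \<noteq> 0"
    "degree d = 4" "rsquarefree d" "\<forall>t. (h2 (t *s e + f))\<^sup>2 - 4 * F p * h4 (t *s e + f) = poly d t"
    "(h2 e)\<^sup>2 - 4 * F p * h4 e \<noteq> 0"
proof -
  have ap: "cdot a p = 1" using c by (simp add: is_center_def)
  obtain h2 h4 where h: "form 2 h2" "form 4 h4"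
    "\<forall>x w. cdot a w = 0 \<longrightarrow> F (x *s p + w) = F p * x ^ 4 + h2 w * x\<^sup>2 + h4 w"
    and fD: "form 4 (\<lambda>w. h2 w * h2 w + (- 4 * F p) * h4 w)"
    and sD: "\<forall>w. cdot a w = 0 \<longrightarrow> w \<noteq> 0 \<longrightarrow> h2 w * h2 w + (- 4 * F p) * h4 w = 0 \<longrightarrow>
      (\<exists>w'. cdot a w' = 0 \<and> cdot (grad (\<lambda>w. h2 w * h2 w + (- 4 * F p) * h4 w) w) w' \<noteq> 0)"
    by (rule center_discriminant[OF F c])
  define D where "D = (\<lambda>w. h2 w * h2 w + (- 4 * F p) * h4 w)"
  note fD = fD[folded D_def]
  have sD: "\<exists>w'. cdot a w' = 0 \<and> cdot (grad D w) w' \<noteq> 0" if "cdot a w = 0" "w \<noteq> 0" "D w = 0" for w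
    using sD that unfolding D_def by blast
  obtain e0 f0 where e0: "cdot a e0 = 0" "cdot a f0 = 0" "cdet p e0 f0 \<noteq> 0"
    using kernel_basis[OF ap] .
  have "\<exists>e. cdot a e = 0 \<and> D e \<noteq> 0"
  proof (rule ccontr)
    assume "\<not> ?thesis"
    then have z: "D w = 0" if "cdot a w = 0" for w using that by blast
    have "cdot (grad D e0) w = 0" if "cdot a w = 0" for w
      using z e0 that by (intro cdot_gradI[OF form_polyfun[OF fD]]) simp
    then show False using sD[OF e0(1) _ z[OF e0(1)]] cdet_nonzero(2)[OF e0(3)] by blast
  qed
  then obtain e where e: "cdot a e = 0" "D e \<noteq> 0" by blast
  have "ccross p e \<noteq> 0"
  proof
    assume "ccross p e = 0"
    then obtain r where "e = r *s p" using ccross_eq_0_imp is_center_nonzero[OF c] by metis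
    then have "e = 0" using e(1) ap by simp
    then show False using e(2) form_0_vec[OF fD] by simp
  qed
  then obtain f1 where f1: "cdet p e f1 \<noteq> 0" by (rule ccross_nonzero_extend)
  define f where "f = f1 - cdot a f1 *s p"
  have af: "cdot a f = 0" using ap by (simp add: f_def)
  have pef: "cdet p e f \<noteq> 0"
    using f1 cdet_comb(3)[of p e "- cdot a f1" 0 1 f1] by (simp add: f_def cdet_def)
  obtain d where d: "degree d = 4" "\<And>t. D (t *s e + f) = poly d t"
    using form_4_poly[OF fD e(2)] by metis
  have "rsquarefree d"
    unfolding rsquarefree_roots
  proof (intro allI notI)
    fix t assume t: "poly d t = 0 \<and> poly (pderiv d) t = 0"
    define w where "w = t *s e + f"
    have w: "cdot a w = 0" "D w = 0" "w \<noteq> 0"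
      using e af t d(2) chart_nonzero[OF pef, of 0 t] by (simp_all add: w_def)
    have "D (w + x *s e) = poly d (t + x)" for x
      using d(2)[of "t + x"] by (simp add: w_def vec.scale_left_distrib add_ac)
    moreover have "((\<lambda>x. poly d (t + x)) has_field_derivative poly (pderiv d) t) (at 0)"
      by (rule derivative_eq_intros refl | simp)+
    ultimately have "cdot (grad D w) e = poly (pderiv d) t"
      by (intro cdot_gradI[OF form_polyfun[OF fD]]) simp
    then have ge: "cdot (grad D w) e = 0" using t by simp
    have "cdot (grad D w) w = 0" using form_grad(1)[OF fD, of w] w by simp
    then have gf: "cdot (grad D w) f = 0" using ge by (simp add: w_def)
    obtain w' where w': "cdot a w' = 0" "cdot (grad D w) w' \<noteq> 0" using sD[OF w(1,3,2)] by blast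
    obtain y z where "w' = cdot a w' *s p + y *s e + z *s f" using kernel_decomp[OF ap e(1) af pef] .
    then have "w' = y *s e + z *s f" using w' by simp
    then show False using w' ge gf by simp
  qed
  then show ?thesis using e d
    by (intro that[OF h e(1) af pef d(1)]) (simp_all add: D_def power2_eq_square)
qed

lemma span_center_line:
  assumes "cdet p e f \<noteq> 0" "vec.span {p, s *s e + f} = vec.span {p, t *s e + f}"
  shows "s = t"
proof -
  have "s *s e + f \<in> vec.span {p, t *s e + f}" unfolding assms(2)[symmetric] by (rule vec.span_base) simp
  then obtain x y where "s *s e + f = x *s p + y *s (t *s e + f)" unfolding mem_span2 by blast
  then have "0 *s p + s *s e + 1 *s f = x *s p + (y * t) *s e + y *s f"
    by (simp add: vec.scale_right_distrib add_ac)
  from cdet_unique[OF assms(1) this] show ?thesis by auto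
qed

lemma center_bitangents_at:
  assumes F: "smooth_form F" and c: "is_center F p a"
  shows "card (bitangents_at F p) = 4"
proof -
  have ap: "cdot a p = 1" using c by (simp add: is_center_def)
  have k: "F p \<noteq> 0" using center_expand(1)[OF F c] .
  obtain h2 h4 e f d where h: "form 2 h2" "form 4 h4"
    "\<forall>x w. cdot a w = 0 \<longrightarrow> F (x *s p + w) = F p * x ^ 4 + h2 w * x\<^sup>2 + h4 w"
    and ef: "cdot a e = 0" "cdot a f = 0" "cdet p e f \<noteq> 0"
    and d: "degree d = 4" "rsquarefree d" "\<forall>t. (h2 (t *s e + f))\<^sup>2 - 4 * F p * h4 (t *s e + f) = poly d t"
    and De: "(h2 e)\<^sup>2 - 4 * F p * h4 e \<noteq> 0"
    by (rule center_pencil[OF F c])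
  have Fxy: "F (x *s p + y *s w) = F p * x ^ 4 + h2 w * x\<^sup>2 * y\<^sup>2 + h4 w * y ^ 4" if "cdot a w = 0" for x y w
    using h(3)[rule_format, of "y *s w" x] that by (simp add: form_homogeneous[OF h(1)] form_homogeneous[OF h(2)])
  have "bitangents_at F p = (\<lambda>t. vec.span {p, t *s e + f}) ` {t. poly d t = 0}"
  proof (intro equalityI subsetI)
    fix L assume "L \<in> bitangents_at F p"
    then have L: "bitangent F L" "p \<in> L" by (auto simp: bitangents_at_def)
    obtain w where w: "L = vec.span {p, w}" "ccross p w \<noteq> 0" "cdot a w = 0"
      using line_kernel_basis[OF L ap] .
    have "w \<in> L" unfolding w(1) by (rule vec.span_base) simp
    then obtain \<alpha> \<beta> \<gamma> where sq: "\<And>x y. F (x *s p + y *s w) = (\<alpha> * x\<^sup>2 + \<beta> * x * y + \<gamma> * y\<^sup>2)\<^sup>2"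
      using bitangent_square[OF L] by metis
    have "(\<alpha>\<^sup>2 - F p) + (2 * \<alpha> * \<beta>) * y + (2 * \<alpha> * \<gamma> + \<beta>\<^sup>2 - h2 w) * y\<^sup>2 + (2 * \<beta> * \<gamma>) * y ^ 3
      + (\<gamma>\<^sup>2 - h4 w) * y ^ 4 = 0" for y
      using sq[of 1 y] Fxy[OF w(3), of 1 y] by simp algebra
    note co = quartic_poly_zero[OF this]
    then have "\<beta> = 0" using k by auto
    then have Dw: "(h2 w)\<^sup>2 - 4 * F p * h4 w = 0" using co by algebra
    obtain y z where yz: "w = y *s e + z *s f" using kernel_decomp[OF ap ef, of w] w(3) by auto
    \<comment> \<open>The line joining \<open>p\<close> and \<open>e\<close> is no bitangent, as the
      discriminant is nonzero at \<open>e\<close>.\<close>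
    have "z \<noteq> 0"
    proof
      assume z: "z = 0"
      then have "y ^ 4 * ((h2 e)\<^sup>2 - 4 * F p * h4 e) = 0"
        using Dw by (simp add: yz form_homogeneous[OF h(1)] form_homogeneous[OF h(2)]) algebra
      then have "w = 0" using De z yz by simp
      then show False using w(2) by simp
    qed
    define t where "t = y / z"
    have wt: "w = z *s (t *s e + f)" using \<open>z \<noteq> 0\<close> by (simp add: t_def yz vec.scale_right_distrib)
    have "z ^ 4 * poly d t = 0" unfolding d(3)[rule_format, symmetric]
      using Dw unfolding wt form_homogeneous[OF h(1)] form_homogeneous[OF h(2)] by algebra
    then have "poly d t = 0" using \<open>z \<noteq> 0\<close> by simp
    moreover have "L = vec.span {p, t *s e + f}"
    proof -
      have pw: "p = 1 *s p + 0 *s (t *s e + f)" "w = 0 *s p + z *s (t *s e + f)" by (simp_all add: wt)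
      have "ccross p (t *s e + f) \<noteq> 0"
        using w(2) unfolding wt by (metis ccross_scale_right vec.scale_zero_right)
      from span2_eqI(1)[OF this pw] show ?thesis unfolding w(1) using \<open>z \<noteq> 0\<close> by simp
    qed
    ultimately show "L \<in> (\<lambda>t. vec.span {p, t *s e + f}) ` {t. poly d t = 0}" by blast
  next
    fix L assume "L \<in> (\<lambda>t. vec.span {p, t *s e + f}) ` {t. poly d t = 0}"
    then obtain t where t: "poly d t = 0" "L = vec.span {p, t *s e + f}" by blast
    define w where "w = t *s e + f"
    have w: "cdot a w = 0" using ef by (simp add: w_def)
    have "ccross p w \<noteq> 0"
    proof
      assume "ccross p w = 0"
      then have "cdot e (ccross p w) = 0" by simp
      moreover have "cdot e (ccross p w) = - cdet p e f" by (simp add: w_def c3_simps algebra_simps)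
      ultimately show False using ef by simp
    qed
    moreover define r where "r = csqrt (F p)"
    have r: "r\<^sup>2 = F p" "r \<noteq> 0" using k by (simp_all add: r_def)
    have h4w: "(h2 w)\<^sup>2 = 4 * r\<^sup>2 * h4 w" using t d(3)[rule_format, of t] by (simp add: w_def r)
    \<comment> \<open>With \<open>F p = r\<^sup>2\<close>, the vanishing discriminant makes the
      restriction the square of \<open>r * x\<^sup>2 + m * y\<^sup>2\<close>.\<close>
    define m where "m = h2 w / (2 * r)"
    have m2: "h2 w = 2 * r * m" using r(2) by (simp add: m_def)
    then have "4 * r\<^sup>2 * h4 w = 4 * r\<^sup>2 * m\<^sup>2" using h4w by algebra
    then have m4: "h4 w = m\<^sup>2" using r(2) by simp
    have "F (x *s p + y *s w) = (r * x\<^sup>2 + m * y\<^sup>2)\<^sup>2" for x y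
      unfolding Fxy[OF w] r(1)[symmetric] m2 m4 by algebra
    ultimately have "bitangent F L" unfolding t(2) w_def[symmetric] using r(2) by (intro square_bitangent)
    moreover have "p \<in> L" unfolding t(2) by (rule vec.span_base) simp
    ultimately show "L \<in> bitangents_at F p" by (simp add: bitangents_at_def)
  qed
  moreover have "inj_on (\<lambda>t. vec.span {p, t *s e + f}) {t. poly d t = 0}"
    using span_center_line[OF ef(3)] by (auto intro!: inj_onI)
  ultimately show ?thesis using rsquarefree_card_roots[OF d(2)] d(1) by (simp add: card_image)
qed

section \<open>Centers on a given bitangent\<close>

lemma grad_form:
  assumes "form 4 F" shows "form 3 (\<lambda>v. cdot (grad F v) r)"
proof -
  obtain h2 h3 h4 where h: "form 2 h2" "form 3 h3" "form 4 h4"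
    "\<And>x w. F (x *s r + w) = F r * x ^ 4 + cdot (grad F r) w * x ^ 3 + h2 w * x\<^sup>2 + h3 w * x + h4 w"
    using quartic_expand_grad[OF assms] by metis
  have "cdot (grad F w) r = h3 w" for w
  proof (rule cdot_gradI[OF form_polyfun[OF assms]])
    have "((\<lambda>x. F r * x ^ 4 + cdot (grad F r) w * x ^ 3 + h2 w * x\<^sup>2 + h3 w * x + h4 w)
      has_field_derivative h3 w) (at 0)"
      by (auto intro!: derivative_eq_intros)
    then show "((\<lambda>t. F (w + t *s r)) has_field_derivative h3 w) (at 0)"
      using h(4)[of _ w] by (simp add: add.commute)
  qed
  then show ?thesis using h(2) by simp
qed

lemma center_grad:
  assumes "polyfun F" "is_center F p a"
  shows "cdot (grad F (reflection p a v)) (reflection p a w) = cdot (grad F v) w"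
proof -
  have "F (reflection p a v + t *s reflection p a w) = F (v + t *s w)" for t
    using assms(2) by (simp add: is_center_def flip: reflection_simps)
  then show ?thesis using grad_line[OF assms(1), of "reflection p a v" "reflection p a w"]
    by (intro cdot_gradI[OF assms(1), symmetric]) simp
qed

text \<open>A reflection whose center lies on a bitangent exchanges the two points of tangency; comparing
  the gradients there determines the cube of the coordinate of the center. At a hyperflex the
  center is unique.\<close>

lemma bitangent_centers_le:
  assumes F: "smooth_form F" and L: "bitangent F L"
  shows "finite {vec.span {p} |p a. is_center F p a \<and> p \<in> L}"
    and "card {vec.span {p} |p a. is_center F p a \<and> p \<in> L} \<le> 3"
proof -
  note sF = smooth_formD[OF F]
  obtain u w c where uw: "ccross u w \<noteq> 0" "L = vec.span {u, w}" "c \<noteq> 0"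
    and cases: "(\<forall>x y. F (x *s u + y *s w) = c * x\<^sup>2 * y\<^sup>2) \<or> (\<forall>x y. F (x *s u + y *s w) = c * y ^ 4)"
    using L unfolding bitangent_def by blast
  obtain r where r: "cdet u w r \<noteq> 0" using ccross_nonzero_extend[OF uw(1)] .
  have Fu: "F u = 0" using cases spec[of _ 1] by (metis (no_types, lifting) add.right_neutral mult_zero_right power_zero_numeral vec.scale_one vec.scale_zero_left)
  \<comment> \<open>The derivative transverse to the line. At \<open>u\<close> the derivatives
    within the line vanish, so smoothness makes this one nonzero.\<close>
  define g where "g = (\<lambda>v. cdot (grad F v) r)"
  have gu: "g u \<noteq> 0"
  proof
    assume gz: "g u = 0"
    have "((\<lambda>t. F (u + t *s w)) has_field_derivative 0) (at 0)"
    proof -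
      have "(\<forall>t. F (u + t *s w) = c * t\<^sup>2) \<or> (\<forall>t. F (u + t *s w) = c * t ^ 4)"
        using cases by (metis mult.right_neutral one_power2 vec.scale_one)
      moreover have "((\<lambda>t. c * t\<^sup>2) has_field_derivative 0) (at 0)" "((\<lambda>t. c * t ^ 4) has_field_derivative 0) (at 0)"
        by (auto intro!: derivative_eq_intros)
      ultimately show ?thesis by auto
    qed
    then have w0: "cdot (grad F u) w = 0" by (rule cdot_gradI[OF sF(2)])
    have u0: "cdot (grad F u) u = 0" using form_grad(1)[OF sF(1), of u] Fu by simp
    have "grad F u = 0"
    proof (rule eq_cdotI)
      fix v
      obtain x y z where "v = x *s u + y *s w + z *s r" using cdet_coords[OF r] by metis
      then show "cdot (grad F u) v = cdot 0 v" using w0 u0 gz by (simp add: g_def)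
    qed
    then show False using sF(3)[OF _ Fu] cdet_nonzero(1)[OF r] by simp
  qed
  have span: "vec.span {x *s u + y *s w} = vec.span {(x / y) *s u + w}" if "y \<noteq> 0" for x y
  proof -
    have e: "x *s u + y *s w = y *s ((x / y) *s u + w)" using that by (simp add: vec.scale_right_distrib)
    have "x *s u + y *s w \<in> vec.span {(x / y) *s u + w}" unfolding mem_span1 e by blast
    moreover have "x *s u + y *s w \<noteq> 0" using ccross_nonzero_indep(2)[OF uw(1)] that by blast
    ultimately show ?thesis by (rule span1_eq)
  qed
  \<comment> \<open>A center on \<open>L\<close> is recorded by the ratio \<open>x / y\<close> of
    its coordinates. In both cases the ratio is a root of a polynomial whose leading coefficient is
    a nonzero multiple of \<open>g u\<close>.\<close>
  have ratio: "\<exists>q. q \<noteq> 0 \<and> degree q \<le> 3 \<and>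
     {vec.span {p} |p a. is_center F p a \<and> p \<in> L} \<subseteq> (\<lambda>z. vec.span {z *s u + w}) ` {z. poly q z = 0}"
    using cases
  proof
    assume c2: "\<forall>x y. F (x *s u + y *s w) = c * x\<^sup>2 * y\<^sup>2"
    have "poly [:g w, 0, 0, g u:] (x / y) = 0" "y \<noteq> 0"
      if pc: "is_center F p a" and p: "p = x *s u + y *s w" for p a x y
    proof -
      have "F p \<noteq> 0" using center_expand(1)[OF F pc] .
      then have xy: "x \<noteq> 0" "y \<noteq> 0" using c2 p by auto
      then show "y \<noteq> 0" by simp
      define m n where "m = cdot a u" and "n = cdot a w"
      have mn: "m * x + n * y = 1" using pc by (simp add: is_center_def p m_def n_def mult.commute)
      have ru: "reflection p a u = (1 - 2 * m * x) *s u + (- 2 * m * y) *s w"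
        and rw: "reflection p a w = (- 2 * n * x) *s u + (1 - 2 * n * y) *s w"
        by (simp_all add: reflection_def p m_def n_def vec_eq_iff algebra_simps)
      \<comment> \<open>The images of \<open>u\<close> and \<open>w\<close> lie on \<open>L\<close>
        and on the curve, so one coordinate of each vanishes. Together with \<open>mn\<close> this
        leaves only the exchange of the two points.\<close>
      have "F (reflection p a u) = F (1 *s u + 0 *s w)" "F (reflection p a w) = F (0 *s u + 1 *s w)"
        using pc by (simp_all add: is_center_def)
      then have "m * (1 - 2 * m * x) = 0" "n * (1 - 2 * n * y) = 0"
        unfolding ru rw c2[rule_format] using uw(3) xy by auto
      then have "2 * m * x = 1" "2 * n * y = 1" using mn by algebra+
      then have rw': "reflection p a w = (- (x / y)) *s u"
        unfolding rw using xy by (simp add: field_simps)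
      have rr: "reflection p a r = r - (2 * cdot a r) *s p" by (simp add: reflection_def)
      have "((\<lambda>t. F (u + t *s p)) has_field_derivative 0) (at 0)"
      proof -
        have "F (u + t *s p) = c * (1 + t * x)\<^sup>2 * (t * y)\<^sup>2" for t
          using c2[rule_format, of "1 + t * x" "t * y"]
          by (simp add: p vec.scale_right_distrib vec.scale_left_distrib add_ac)
        moreover have "((\<lambda>t. c * (1 + t * x)\<^sup>2 * (t * y)\<^sup>2) has_field_derivative 0) (at 0)"
          by (rule derivative_eq_intros refl | simp)+
        ultimately show ?thesis by simp
      qed
      then have gp: "cdot (grad F u) p = 0" by (rule cdot_gradI[OF sF(2)])
      have gs: "cdot (grad F (k *s u)) v = k ^ 3 * cdot (grad F u) v" if "k \<noteq> 0" for k v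
        using form_grad(2)[OF sF(1), of k u v] that by (simp add: power_numeral_reduce)
      \<comment> \<open>The gradient is carried from \<open>w\<close> to a multiple of
        \<open>u\<close>. There the part of the reflected \<open>r\<close> along \<open>p\<close>
        drops out, because \<open>p\<close> is tangent at \<open>u\<close>.\<close>
      have "g w = cdot (grad F (reflection p a w)) (reflection p a r)"
        unfolding g_def by (rule center_grad[OF sF(2) pc, symmetric])
      also have "\<dots> = (- (x / y)) ^ 3 * g u"
        unfolding rw' rr using xy gs[of "- (x / y)"] gp by (simp add: g_def)
      finally show "poly [:g w, 0, 0, g u:] (x / y) = 0"
        by (simp add: power3_eq_cube field_simps)
    qed
    with span have "{vec.span {p} |p a. is_center F p a \<and> p \<in> L}
        \<subseteq> (\<lambda>z. vec.span {z *s u + w}) ` {z. poly [:g w, 0, 0, g u:] z = 0}"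
      unfolding uw(2) mem_span2 by blast
    then show ?thesis using gu by (intro exI[of _ "[:g w, 0, 0, g u:]"]) auto
  next
    assume c4: "\<forall>x y. F (x *s u + y *s w) = c * y ^ 4"
    obtain g1 g2 g3 where g: "\<And>x y. g (x *s u + y *s w) = g u * x ^ 3 + g1 * x\<^sup>2 * y + g2 * x * y\<^sup>2 + g3 * y ^ 3"
    proof -
      obtain g0 g1 g2 g3 where "\<And>x y. g (x *s u + y *s w) = g0 * x ^ 3 + g1 * x\<^sup>2 * y + g2 * x * y\<^sup>2 + g3 * y ^ 3"
        using form_3_binary[OF grad_form[OF sF(1), of r]] unfolding g_def by metis
      moreover from this[of 1 0] have "g0 = g u" by simp
      ultimately show ?thesis using that by blast
    qed
    have "poly [:g1, 3 * g u:] (x / y) = 0" "y \<noteq> 0"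
      if pc: "is_center F p a" and p: "p = x *s u + y *s w" for p a x y
    proof -
      have "F p \<noteq> 0" using center_expand(1)[OF F pc] .
      then have y: "y \<noteq> 0" using c4 p by auto
      then show "y \<noteq> 0" .
      define m n s where "m = cdot a u" and "n = cdot a w" and "s = 2 * cdot a r"
      have mn: "m * x + n * y = 1" using pc by (simp add: is_center_def p m_def n_def mult.commute)
      have ru: "reflection p a u = (1 - 2 * m * x) *s u + (- 2 * m * y) *s w"
        by (simp add: reflection_def p m_def vec_eq_iff algebra_simps)
      have "F (reflection p a u) = F (1 *s u + 0 *s w)" using pc by (simp add: is_center_def)
      \<comment> \<open>\<open>u\<close> is the only point of the curve on \<open>L\<close>, hence
        fixed; as \<open>y \<noteq> 0\<close>, it lies on the mirror.\<close>
      then have m: "m = 0" unfolding ru c4[rule_format] using uw(3) y by auto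
      have n: "n = 1 / y" using mn m y by (simp add: field_simps)
      define z where "z = x / y"
      have rv: "reflection p a (1 *s u + t *s w) = (1 - 2 * z * t) *s u + (- t) *s w" for t
        using y unfolding reflection_def cdot_add_right cdot_scale_right m_def[symmetric] n_def[symmetric] m n
        by (simp add: p z_def vec_eq_iff field_simps)
      have rr: "reflection p a r = r - s *s p" by (simp add: reflection_def s_def)
      have gp: "cdot (grad F (b *s u + t *s w)) p = 4 * c * t ^ 3 * y" for b t
      proof (rule cdot_gradI[OF sF(2)])
        have "F (b *s u + t *s w + q *s p) = c * (t + q * y) ^ 4" for q
          using c4[rule_format, of "b + q * x" "t + q * y"]
          by (simp add: p vec.scale_right_distrib vec.scale_left_distrib add_ac)
        moreover have "((\<lambda>q. c * (t + q * y) ^ 4) has_field_derivative 4 * c * t ^ 3 * y) (at 0)"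
          by (rule derivative_eq_intros refl | simp)+
        ultimately show "((\<lambda>q. F (b *s u + t *s w + q *s p)) has_field_derivative 4 * c * t ^ 3 * y) (at 0)" by simp
      qed
      have eq: "g ((1 - 2 * z * t) *s u + (- t) *s w) - s * (4 * c * (- t) ^ 3 * y) = g (1 *s u + t *s w)" for t
        using center_grad[OF sF(2) pc, of "1 *s u + t *s w" r] unfolding rv rr
        by (simp only: g_def cdot_diff_right cdot_scale_right gp)
      \<comment> \<open>The unknown \<open>s\<close> enters only with \<open>t ^ 3\<close>, so the
        coefficient of \<open>t\<close> is a linear equation for \<open>z\<close> alone.\<close>
      have "0 + (- 6 * z * g u - 2 * g1) * t + (12 * z\<^sup>2 * g u + 4 * z * g1) * t\<^sup>2
        + (- 8 * z ^ 3 * g u - 4 * z\<^sup>2 * g1 - 2 * z * g2 - 2 * g3 + 4 * s * c * y) * t ^ 3 + 0 * t ^ 4 = 0" for t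
        using eq[of t] unfolding g power_one mult_1_left mult_1_right by algebra
      from quartic_poly_zero(2)[OF this] have "g1 + z * (3 * g u) = 0" by algebra
      then show "poly [:g1, 3 * g u:] (x / y) = 0" by (simp add: z_def)
    qed
    with span have "{vec.span {p} |p a. is_center F p a \<and> p \<in> L}
        \<subseteq> (\<lambda>z. vec.span {z *s u + w}) ` {z. poly [:g1, 3 * g u:] z = 0}"
      unfolding uw(2) mem_span2 by blast
    then show ?thesis using gu by (intro exI[of _ "[:g1, 3 * g u:]"]) auto
  qed
  then obtain q where q: "q \<noteq> 0" "degree q \<le> 3"
    "{vec.span {p} |p a. is_center F p a \<and> p \<in> L} \<subseteq> (\<lambda>z. vec.span {z *s u + w}) ` {z. poly q z = 0}"
    by blast
  have fin: "finite {z. poly q z = 0}" using poly_roots_finite[OF q(1)] .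
  then show "finite {vec.span {p} |p a. is_center F p a \<and> p \<in> L}"
    using finite_subset[OF q(3)] by blast
  have "card {vec.span {p} |p a. is_center F p a \<and> p \<in> L} \<le> card {z. poly q z = 0}"
    using card_mono[OF finite_imageI[OF fin] q(3)] card_image_le[OF fin] order_trans by blast
  also have "\<dots> \<le> degree q" by (rule card_poly_roots_bound[OF q(1)])
  finally show "card {vec.span {p} |p a. is_center F p a \<and> p \<in> L} \<le> 3" using q(2) by simp
qed

section \<open>Counting bitangents and centers\<close>

lemma rsquarefree_factor:
  fixes d :: "complex poly"
  assumes "rsquarefree d" "d = p * q" shows "rsquarefree p"
  using assms by (auto simp: rsquarefree_roots pderiv_mult)

lemma rsquarefree_quadratic:
  fixes p :: "complex poly"
  assumes "rsquarefree p" "degree p = 2" "poly p r = 0"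
  obtains s t where "s \<noteq> r" "t \<noteq> 0" "poly p s = 0" "p = smult t ([:- r, 1:] * [:- s, 1:])"
proof -
  have "card {z. poly p z = 0} = 2" using rsquarefree_card_roots[OF assms(1)] assms(2) by simp
  then obtain x y where xy: "{z. poly p z = 0} = {x, y}" "x \<noteq> y" by (auto simp: card_2_iff)
  then have "r = x \<or> r = y" using assms(3) by blast
  then obtain s where s: "{z. poly p z = 0} = {r, s}" "s \<noteq> r" using xy by (metis insert_commute)
  have "smult (lead_coeff p) (\<Prod>z|poly p z = 0. [:-z, 1:]) = p"
    using complex_poly_decompose_rsquarefree[OF assms(1)] .
  then have "p = smult (lead_coeff p) ([:- r, 1:] * [:- s, 1:])" unfolding s(1) using s(2) by simp
  moreover have "lead_coeff p \<noteq> 0" using assms(2) by (metis degree_0 leading_coeff_0_iff zero_neq_numeral)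
  moreover have "poly p s = 0" using s(1) by blast
  ultimately show ?thesis using that s(2) by metis
qed

lemma card_square_root_le:
  fixes m :: "complex poly"
  shows "finite {(\<alpha>, \<beta>). [:\<beta>, \<alpha>:]\<^sup>2 = m}" and "card {(\<alpha>, \<beta>). [:\<beta>, \<alpha>:]\<^sup>2 = m} \<le> 2"
proof -
  have "\<exists>x y. {(\<alpha>, \<beta>). [:\<beta>, \<alpha>:]\<^sup>2 = m} \<subseteq> {x, y}"
  proof (cases "{(\<alpha>, \<beta>). [:\<beta>, \<alpha>:]\<^sup>2 = m} = {}")
    case False
    then obtain a b where ab: "[:b, a:]\<^sup>2 = m" by blast
    have "(\<alpha>, \<beta>) \<in> {(a, b), (- a, - b)}" if "[:\<beta>, \<alpha>:]\<^sup>2 = m" for \<alpha> \<beta>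
    proof -
      have "[:\<beta>, \<alpha>:]\<^sup>2 = [:b, a:]\<^sup>2" using that ab by simp
      then have "[:\<beta>, \<alpha>:] = [:b, a:] \<or> [:\<beta>, \<alpha>:] = - [:b, a:]" by (rule power2_eq_iff[THEN iffD1])
      then show ?thesis by auto
    qed
    then show ?thesis by blast
  qed auto
  then obtain x y where xy: "{(\<alpha>, \<beta>). [:\<beta>, \<alpha>:]\<^sup>2 = m} \<subseteq> {x, y}" by blast
  show "finite {(\<alpha>, \<beta>). [:\<beta>, \<alpha>:]\<^sup>2 = m}" using finite_subset[OF xy] by simp
  have "card {(\<alpha>, \<beta>). [:\<beta>, \<alpha>:]\<^sup>2 = m} \<le> card {x, y}" using xy by (intro card_mono) auto
  also have "\<dots> \<le> 2" using card_insert_le_m1[of 2 "{y}" x] by simp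
  finally show "card {(\<alpha>, \<beta>). [:\<beta>, \<alpha>:]\<^sup>2 = m} \<le> 2" .
qed

lemma card_UN_le_mult:
  assumes "finite I" "card I \<le> m" "\<And>i. i \<in> I \<Longrightarrow> card (A i) \<le> n"
  shows "card (\<Union>i\<in>I. A i) \<le> m * n"
proof -
  have "card (\<Union>i\<in>I. A i) \<le> (\<Sum>i\<in>I. card (A i))" by (rule card_UN_le[OF assms(1)])
  also have "\<dots> \<le> card I * n" using sum_bounded_above[of I "\<lambda>i. card (A i)" n] assms(3) by simp
  also have "\<dots> \<le> m * n" using assms(2) by simp
  finally show ?thesis .
qed

text \<open>If \<open>A\<close> and \<open>B\<close> are quadratics with product \<open>d\<close>, the roots of \<open>d\<close> are split into two pairs,
  which determines \<open>A = \<tau> u\<close> and \<open>B = v / \<tau>\<close> up to \<open>\<tau>\<close>; the requirement that \<open>A + B - 2 q\<close> be a square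
  is a quartic equation for \<open>\<tau>\<close>.\<close>

lemma square_completions_le:
  fixes d q :: "complex poly"
  assumes d: "degree d = 4" "rsquarefree d" and k: "k \<noteq> 0"
  shows "finite {(\<alpha>, \<beta>). \<exists>S. degree S \<le> 2 \<and> (smult k ([:\<beta>, \<alpha>:]\<^sup>2) + q)\<^sup>2 - S\<^sup>2 = d \<and> degree q \<le> 2}"
    and "card {(\<alpha>, \<beta>). \<exists>S. degree S \<le> 2 \<and> (smult k ([:\<beta>, \<alpha>:]\<^sup>2) + q)\<^sup>2 - S\<^sup>2 = d \<and> degree q \<le> 2} \<le> 24"
proof -
  define N where "N = {(\<alpha>, \<beta>). \<exists>S. degree S \<le> 2 \<and> (smult k ([:\<beta>, \<alpha>:]\<^sup>2) + q)\<^sup>2 - S\<^sup>2 = d \<and> degree q \<le> 2}"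
  have d0: "d \<noteq> 0" using d(1) by auto
  define R where "R = {z. poly d z = 0}"
  have cR: "card R = 4" using rsquarefree_card_roots[OF d(2)] d(1) by (simp add: R_def)
  then have fR: "finite R" using card.infinite by fastforce
  \<comment> \<open>Fixing one root avoids counting a splitting twice: \<open>A\<close> will be the
    factor that vanishes at \<open>r\<close>, and \<open>s\<close> its other root.\<close>
  obtain r where r: "r \<in> R" using cR by fastforce
  define u where "u s = [:- r, 1:] * [:- s, 1::complex:]" for s
  define v where "v s = d div u s" for s
  \<comment> \<open>The coefficients of \<open>\<tau>\<^sup>2 u + v - 2 \<tau> q\<close>, as
    polynomials in \<tau>; \<open>T\<close> is the discriminant of this quadratic.\<close>
  define c where "c i s = [:coeff (v s) i, - 2 * coeff q i, coeff (u s) i:]" for i s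
  define T where "T s = (c 1 s)\<^sup>2 - smult 4 (c 0 s * c 2 s)" for s
  define m where "m t s = smult (1 / (2 * k * t)) (smult (t\<^sup>2) (u s) + v s - smult (2 * t) q)" for t s
  \<comment> \<open>The leading coefficient of \<open>T s\<close> is the discriminant of
    \<open>u s\<close>, nonzero for \<open>s \<noteq> r\<close>.\<close>
  have T4: "coeff (T s) 4 = (r - s)\<^sup>2" for s
    by (simp add: T_def c_def u_def power2_eq_square coeff_mult numeral_eq_Suc algebra_simps)
  have degT: "degree (T s) \<le> 4" for s
  proof -
    have dc: "degree (c i s) \<le> 2" for i by (simp add: c_def)
    then have "degree (c 1 s * c 1 s) \<le> 2 + 2" "degree (c 0 s * c 2 s) \<le> 2 + 2"
      using degree_mult_le[of "c 1 s" "c 1 s"] degree_mult_le[of "c 0 s" "c 2 s"] add_mono[OF dc dc]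
      by (meson le_trans)+
    then show ?thesis unfolding T_def
      by (intro degree_diff_le order_trans[OF degree_smult_le]) (simp_all add: power2_eq_square)
  qed
  define roots where "roots s = {t. poly (T s) t = 0}" for s
  have froots: "finite (roots s)" "card (roots s) \<le> 4" if "s \<in> R - {r}" for s
  proof -
    have "T s \<noteq> 0" using T4[of s] that by auto
    then show "finite (roots s)" "card (roots s) \<le> 4"
      using poly_roots_finite[of "T s"] card_poly_roots_bound[of "T s"] degT[of s]
      by (auto simp: roots_def)
  qed
  have key: "\<exists>s\<in>R - {r}. \<exists>t\<in>roots s. [:\<beta>, \<alpha>:]\<^sup>2 = m t s"
    if S: "degree S \<le> 2" "(smult k ([:\<beta>, \<alpha>:]\<^sup>2) + q)\<^sup>2 - S\<^sup>2 = d" "degree q \<le> 2"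
      and rS: "poly (smult k ([:\<beta>, \<alpha>:]\<^sup>2) + q - S) r = 0" for \<alpha> \<beta> S
  proof -
    define A where "A = smult k ([:\<beta>, \<alpha>:]\<^sup>2) + q - S"
    define B where "B = smult k ([:\<beta>, \<alpha>:]\<^sup>2) + q + S"
    have AB: "d = A * B" unfolding S(2)[symmetric] A_def B_def by (simp add: power2_eq_square algebra_simps)
    have l2: "degree (smult k ([:\<beta>, \<alpha>:]\<^sup>2)) \<le> 2"
      by (rule order_trans[OF degree_smult_le]) (simp add: power2_eq_square)
    have "degree A \<le> 2" "degree B \<le> 2" unfolding A_def B_def
      by (intro degree_diff_le degree_add_le l2 S)+
    moreover have "degree A + degree B = 4" using AB d(1) d0 by (metis degree_mult_eq mult_eq_0_iff)
    ultimately have degA: "degree A = 2" by simp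
    obtain s t where st: "s \<noteq> r" "t \<noteq> 0" "poly A s = 0" "A = smult t (u s)"
      using rsquarefree_quadratic[OF rsquarefree_factor[OF d(2) AB] degA] rS
      unfolding A_def[symmetric] u_def by metis
    have sR: "s \<in> R - {r}" using st AB by (simp add: R_def)
    have u0: "u s \<noteq> 0" by (simp add: u_def)
    have du: "d = u s * smult t B" using AB st(4) by simp
    have "v s = smult t B" unfolding v_def by (subst du) (rule nonzero_mult_div_cancel_left[OF u0])
    then have "smult (t\<^sup>2) (u s) + v s - smult (2 * t) q = smult t (A + B - smult 2 q)"
      using st(4) by (simp add: smult_add_right smult_diff_right power2_eq_square mult.commute)
    also have "A + B - smult 2 q = smult (2 * k) ([:\<beta>, \<alpha>:]\<^sup>2)"
    proof -
      have "smult 2 q = q + q" "smult (2 * k) ([:\<beta>, \<alpha>:]\<^sup>2) = smult k ([:\<beta>, \<alpha>:]\<^sup>2) + smult k ([:\<beta>, \<alpha>:]\<^sup>2)"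
        by (metis smult_add_left one_add_one smult_1_left) (simp flip: smult_add_left)
      then show ?thesis unfolding A_def B_def by simp
    qed
    finally have e: "smult (t\<^sup>2) (u s) + v s - smult (2 * t) q = smult (2 * k * t) ([:\<beta>, \<alpha>:]\<^sup>2)"
      by (simp add: mult.commute)
    then have "[:\<beta>, \<alpha>:]\<^sup>2 = m t s" unfolding m_def using k st(2) by simp
    moreover have "poly (T s) t = 0"
    proof -
      have ci: "poly (c i s) t = 2 * k * t * coeff ([:\<beta>, \<alpha>:]\<^sup>2) i" for i
        using arg_cong[OF e, of "\<lambda>p. coeff p i"] unfolding c_def
        by (simp only: coeff_smult coeff_add coeff_diff poly_pCons poly_0) algebra
      have "coeff ([:\<beta>, \<alpha>:]\<^sup>2) 0 = \<beta>\<^sup>2" "coeff ([:\<beta>, \<alpha>:]\<^sup>2) 1 = 2 * \<alpha> * \<beta>" "coeff ([:\<beta>, \<alpha>:]\<^sup>2) 2 = \<alpha>\<^sup>2"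
        by (simp_all add: power2_eq_square coeff_mult numeral_eq_Suc)
      then show ?thesis unfolding T_def by (simp add: ci del: One_nat_def) (simp add: power2_eq_square)
    qed
    ultimately show ?thesis using sR by (auto simp: roots_def)
  qed
  have sub: "N \<subseteq> (\<Union>s\<in>R - {r}. \<Union>t\<in>roots s. {(\<alpha>, \<beta>). [:\<beta>, \<alpha>:]\<^sup>2 = m t s})"
  proof
    fix x assume "x \<in> N"
    then obtain \<alpha> \<beta> S where x: "x = (\<alpha>, \<beta>)" and S: "degree S \<le> 2"
      "(smult k ([:\<beta>, \<alpha>:]\<^sup>2) + q)\<^sup>2 - S\<^sup>2 = d" "degree q \<le> 2" unfolding N_def by blast
    have "poly (smult k ([:\<beta>, \<alpha>:]\<^sup>2) + q - S) r * poly (smult k ([:\<beta>, \<alpha>:]\<^sup>2) + q - (- S)) r = poly d r"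
      unfolding S(2)[symmetric] by (simp add: power2_eq_square algebra_simps)
    then have "poly (smult k ([:\<beta>, \<alpha>:]\<^sup>2) + q - S) r = 0 \<or> poly (smult k ([:\<beta>, \<alpha>:]\<^sup>2) + q - (- S)) r = 0"
      using r by (simp add: R_def)
    \<comment> \<open>Changing the sign of \<open>S\<close> exchanges the two factors.\<close>
    then have "\<exists>s\<in>R - {r}. \<exists>t\<in>roots s. [:\<beta>, \<alpha>:]\<^sup>2 = m t s"
      using key[OF S] key[of "- S" \<beta> \<alpha>] S by auto
    then show "x \<in> (\<Union>s\<in>R - {r}. \<Union>t\<in>roots s. {(\<alpha>, \<beta>). [:\<beta>, \<alpha>:]\<^sup>2 = m t s})" by (auto simp: x)
  qed
  have fin: "finite (\<Union>s\<in>R - {r}. \<Union>t\<in>roots s. {(\<alpha>, \<beta>). [:\<beta>, \<alpha>:]\<^sup>2 = m t s})"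
    using fR froots card_square_root_le(1) by (intro finite_UN_I) auto
  \<comment> \<open>Three partners of \<open>r\<close>, at most four values of \<tau>, at most two
    square roots.\<close>
  have "card (\<Union>s\<in>R - {r}. \<Union>t\<in>roots s. {(\<alpha>, \<beta>). [:\<beta>, \<alpha>:]\<^sup>2 = m t s}) \<le> 3 * (4 * 2)"
    using fR cR r froots card_square_root_le(2) by (intro card_UN_le_mult) simp_all
  then show "finite N" "card N \<le> 24"
    using finite_subset[OF sub fin] card_mono[OF fin sub] by simp_all
qed

text \<open>Over the pencil at \<open>p\<close>, a line missing \<open>p\<close> is a graph
  \<open>l = \<beta> + t * \<alpha>\<close>. Multiplying
  \<open>k * l ^ 4 + q * l\<^sup>2 + h4 = s\<^sup>2\<close> by \<open>4 * k\<close> and completing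
  the square gives \<open>(2 * k * l\<^sup>2 + q)\<^sup>2 - 4 * k * s\<^sup>2 = d\<close>, the
  equation counted by \<open>square_completions_le\<close>.\<close>

lemma bitangents_le_28:
  assumes F: "smooth_form F" and c: "is_center F p a"
  shows "finite {L. bitangent F L}" "card {L. bitangent F L} \<le> 28"
proof -
  have ap: "cdot a p = 1" using c by (simp add: is_center_def)
  define k where "k = F p"
  have k: "k \<noteq> 0" using center_expand(1)[OF F c] by (simp add: k_def)
  obtain h2 h4 e f d where h: "form 2 h2" "form 4 h4"
    "\<forall>x w. cdot a w = 0 \<longrightarrow> F (x *s p + w) = F p * x ^ 4 + h2 w * x\<^sup>2 + h4 w"
    and ef: "cdot a e = 0" "cdot a f = 0" "cdet p e f \<noteq> 0"
    and d: "degree d = 4" "rsquarefree d" "\<forall>t. (h2 (t *s e + f))\<^sup>2 - 4 * F p * h4 (t *s e + f) = poly d t"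
    and De: "(h2 e)\<^sup>2 - 4 * F p * h4 e \<noteq> 0"
    by (rule center_pencil[OF F c])
  obtain q where q: "degree q \<le> 2" "\<And>t. h2 (t *s e + f) = poly q t"
    using form_2_poly[OF h(1)] by metis
  define N where "N = {(\<alpha>, \<beta>). \<exists>S. degree S \<le> 2 \<and> (smult (2 * k) ([:\<beta>, \<alpha>:]\<^sup>2) + q)\<^sup>2 - S\<^sup>2 = d \<and> degree q \<le> 2}"
  have N: "finite N" "card N \<le> 24"
    unfolding N_def using square_completions_le[OF d(1,2), of "2 * k" q] k by simp_all
  have other: "\<exists>(\<alpha>, \<beta>)\<in>N. L = vec.span {\<alpha> *s p + e, \<beta> *s p + f}"
    if L: "bitangent F L" "p \<notin> L" for L
  proof -
    obtain u w where uw: "ccross u w \<noteq> 0" "L = vec.span {u, w}" using bitangent_line[OF L(1)] by blast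
    obtain h' where h': "cdet u w h' \<noteq> 0" using ccross_nonzero_extend[OF uw(1)] .
    obtain x y z where p: "p = x *s u + y *s w + z *s h'" using cdet_coords[OF h'] by metis
    have "z \<noteq> 0" using L(2) unfolding uw(2) mem_span2 by (metis p add.right_neutral vec.scale_zero_left)
    then have uwp: "cdet u w p \<noteq> 0" using h' cdet_comb(3)[of u w x y z h'] by (simp add: p)
    obtain x1 y1 z1 where e1: "e = x1 *s u + y1 *s w + z1 *s p" using cdet_coords[OF uwp] by metis
    obtain x2 y2 z2 where f1: "f = x2 *s u + y2 *s w + z2 *s p" using cdet_coords[OF uwp] by metis
    \<comment> \<open>Since \<open>u\<close>, \<open>w\<close>, \<open>p\<close> form a basis,
      \<open>e\<close> and \<open>f\<close> can be moved into \<open>L\<close> along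
      \<open>p\<close>.\<close>
    define \<alpha> \<beta> where "\<alpha> = - z1" and "\<beta> = - z2"
    have in_L: "\<alpha> *s p + e \<in> L" "\<beta> *s p + f \<in> L"
      unfolding uw(2) mem_span2 \<alpha>_def \<beta>_def by (auto simp: e1 f1)
    have "cdet p (\<alpha> *s p + e) (\<beta> *s p + f) = cdet p e f" by (simp add: c3_simps algebra_simps)
    then have "ccross (\<alpha> *s p + e) (\<beta> *s p + f) \<noteq> 0"
      using ef(3) cdet_nonzero(5)[of p "\<alpha> *s p + e" "\<beta> *s p + f"] by metis
    then have Leq: "L = vec.span {\<alpha> *s p + e, \<beta> *s p + f}"
      using span2_eq in_L unfolding uw(2) by metis
    obtain A B C where sq: "\<And>x y. F (x *s (\<alpha> *s p + e) + y *s (\<beta> *s p + f)) = (A * x\<^sup>2 + B * x * y + C * y\<^sup>2)\<^sup>2"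
      using bitangent_square[OF L(1) in_L] by metis
    \<comment> \<open>Absorbs the factor \<open>4 * k\<close> into the square.\<close>
    define g where "g = csqrt (4 * k)"
    define S where "S = smult g [:C, B, A:]"
    have "poly ((smult (2 * k) ([:\<beta>, \<alpha>:]\<^sup>2) + q)\<^sup>2 - S\<^sup>2 - d) t = 0" for t
    proof -
      define l where "l = \<beta> + t * \<alpha>"
      have g2: "g * g = 4 * k" unfolding g_def by (metis power2_csqrt power2_eq_square)
      have "t *s (\<alpha> *s p + e) + 1 *s (\<beta> *s p + f) = l *s p + (t *s e + f)"
        by (simp add: l_def vec_eq_iff algebra_simps)
      then have "F (l *s p + (t *s e + f)) = (A * t\<^sup>2 + B * t + C)\<^sup>2"
        using sq[of t 1] by (simp only: mult_1_right power_one)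
      then have 1: "k * l ^ 4 + poly q t * l\<^sup>2 + h4 (t *s e + f) = (A * t\<^sup>2 + B * t + C)\<^sup>2"
        using h(3)[rule_format, of "t *s e + f" l] ef by (simp add: k_def q)
      have dt: "poly d t = (poly q t)\<^sup>2 - 4 * k * h4 (t *s e + f)"
        using d(3)[rule_format, of t] by (simp add: q(2) k_def)
      have "poly ((smult (2 * k) ([:\<beta>, \<alpha>:]\<^sup>2) + q)\<^sup>2 - S\<^sup>2 - d) t
        = (2 * k * l\<^sup>2 + poly q t)\<^sup>2 - (g * g) * (A * t\<^sup>2 + B * t + C)\<^sup>2 - ((poly q t)\<^sup>2 - 4 * k * h4 (t *s e + f))"
        by (simp add: dt S_def l_def power2_eq_square algebra_simps)
      also have "\<dots> = 0" unfolding g2 1[symmetric] by algebra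
      finally show ?thesis .
    qed
    then have "(smult (2 * k) ([:\<beta>, \<alpha>:]\<^sup>2) + q)\<^sup>2 - S\<^sup>2 - d = 0" by (metis poly_all_0_iff_0)
    then have "(smult (2 * k) ([:\<beta>, \<alpha>:]\<^sup>2) + q)\<^sup>2 - S\<^sup>2 = d" by simp
    moreover have "degree S \<le> 2" unfolding S_def by (rule order_trans[OF degree_smult_le]) simp
    ultimately have "(\<alpha>, \<beta>) \<in> N" unfolding N_def using q(1) by blast
    then show ?thesis using Leq by blast
  qed
  define M where "M = (\<lambda>(\<alpha>, \<beta>). vec.span {\<alpha> *s p + e, \<beta> *s p + f}) ` N"
  have M: "finite M" "card M \<le> 24"
    unfolding M_def using N card_image_le[OF N(1)] by (auto intro: order_trans)
  have B: "finite (bitangents_at F p)" "card (bitangents_at F p) = 4"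
    using center_bitangents_at[OF F c] card.infinite by fastforce+
  have sub: "{L. bitangent F L} \<subseteq> bitangents_at F p \<union> M"
    using other by (fastforce simp: bitangents_at_def M_def)
  show "finite {L. bitangent F L}" using finite_subset[OF sub] B M by simp
  have "card {L. bitangent F L} \<le> card (bitangents_at F p \<union> M)"
    using B M by (intro card_mono sub) simp
  also have "\<dots> \<le> 28" using card_Un_le[of "bitangents_at F p" M] B M by simp
  finally show "card {L. bitangent F L} \<le> 28" .
qed

definition centers :: "(c3 \<Rightarrow> complex) \<Rightarrow> c3 set set" where
  "centers F = {vec.span {p} |p a. is_center F p a}"

lemma span1_subset_iff: "vec.span {p :: c3} \<subseteq> vec.span S \<longleftrightarrow> p \<in> vec.span S"
  by (meson insert_subset vec.span_base vec.span_minimal vec.subspace_span empty_subsetI singletonI subset_iff)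

lemma centers_le_21:
  assumes F: "smooth_form F"
  shows "finite (centers F)" "card (centers F) \<le> 21"
proof -
  have "finite (centers F) \<and> card (centers F) \<le> 21"
  \<comment> \<open>The bound of 28 becomes available once a center is given.\<close>
  proof (cases "centers F = {}")
    case False
    then obtain p a where c: "is_center F p a" by (auto simp: centers_def)
    define B where "B = {L. bitangent F L}"
    have B: "finite B" "card B \<le> 28" using bitangents_le_28[OF F c] by (auto simp: B_def)
    have iff: "vec.span {p} \<subseteq> L \<longleftrightarrow> p \<in> L" if "L \<in> B" for p L
      using bitangent_line[of F L] that span1_subset_iff by (auto simp: B_def)
    have four: "card {L \<in> B. P \<subseteq> L} = 4" if P: "P \<in> centers F" for P
    proof -
      obtain p a where p: "P = vec.span {p}" "is_center F p a" using P by (auto simp: centers_def)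
      have "{L \<in> B. P \<subseteq> L} = bitangents_at F p" using iff by (auto simp: p bitangents_at_def B_def)
      then show ?thesis using center_bitangents_at[OF F p(2)] by simp
    qed
    have three: "finite {P \<in> centers F. P \<subseteq> L} \<and> card {P \<in> centers F. P \<subseteq> L} \<le> 3" if L: "L \<in> B" for L
    proof -
      have "{P \<in> centers F. P \<subseteq> L} = {vec.span {p} |p a. is_center F p a \<and> p \<in> L}"
        using iff[OF L] unfolding centers_def by blast
      then show ?thesis using bitangent_centers_le[OF F] L by (simp add: B_def)
    qed
    have "centers F \<subseteq> (\<Union>L\<in>B. {P \<in> centers F. P \<subseteq> L})"
    proof
      fix P assume P: "P \<in> centers F"
      then have "{L \<in> B. P \<subseteq> L} \<noteq> {}" using four[OF P] by (metis card.empty zero_neq_numeral)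
      then show "P \<in> (\<Union>L\<in>B. {P \<in> centers F. P \<subseteq> L})" using P by blast
    qed
    then have fin: "finite (centers F)" using B(1) three by (meson finite_UN_I finite_subset)
    have "(\<Sum>L\<in>B. card {P \<in> centers F. P \<subseteq> L}) = (\<Sum>P\<in>centers F. 4)"
      using sum_multicount_gen[OF B(1) fin, of "\<lambda>L P. P \<subseteq> L" "\<lambda>_. 4"] four by simp
    moreover have "(\<Sum>L\<in>B. card {P \<in> centers F. P \<subseteq> L}) \<le> card B * 3"
      using sum_bounded_above[of B "\<lambda>L. card {P \<in> centers F. P \<subseteq> L}" 3] three by simp
    ultimately show ?thesis using fin B(2) by simp
  qed simp
  then show "finite (centers F)" "card (centers F) \<le> 21" by auto
qed

section \<open>Regular involutions are linear\<close>

lemma grad_mult: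
  assumes "polyfun H" "polyfun K"
  shows "cdot (grad (\<lambda>v. H v * K v) v) w = cdot (grad H v) w * K v + H v * cdot (grad K v) w"
  by (rule cdot_gradI[OF polyfun_mult[OF assms]])
    (rule derivative_eq_intros grad_line assms refl | simp)+

lemma grad_diff:
  assumes "polyfun H" "polyfun K"
  shows "cdot (grad (\<lambda>v. H v - K v) v) w = cdot (grad H v) w - cdot (grad K v) w"
  by (rule cdot_gradI[OF polyfun_diff[OF assms]])
    (rule derivative_eq_intros grad_line assms refl | simp)+

lemma jac_ccross:
  assumes "polymap G" "polymap H"
  shows "jac (\<lambda>v. ccross (G v) (H v)) v w = ccross (jac G v w) (H v) + ccross (G v) (jac H v w)"
  using assms
  by (simp add: vec_eq_iff forall_3 jac_def ccross_def vector_3 grad_mult grad_diff polyfun_mult polymapD algebra_simps)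

lemma grad_homogeneous_3:
  assumes "form 4 F" "c \<noteq> 0" shows "grad F (c *s v) = c ^ 3 *s grad F v"
proof (rule eq_cdotI)
  fix w
  have "c * cdot (grad F (c *s v)) w = c * (c ^ 3 * cdot (grad F v) w)"
    using form_grad(2)[OF assms(1), of c v w] by (simp add: power_numeral_reduce algebra_simps)
  then show "cdot (grad F (c *s v)) w = cdot (c ^ 3 *s grad F v) w" using assms(2) by simp
qed

definition vform :: "nat \<Rightarrow> (c3 \<Rightarrow> c3) \<Rightarrow> bool" where
  "vform d G \<longleftrightarrow> (\<forall>i. form d (\<lambda>v. G v $ i))"

lemma vformD:
  assumes "vform d G"
  shows "polymap G" "G (c *s v) = c ^ d *s G v" "jac G v v = of_nat d *s G v"
    "c *s jac G (c *s v) w = c ^ d *s jac G v w"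
  using assms form_polyfun form_homogeneous[of d _ c v] form_grad[of d]
  by (auto simp: vform_def polymap_def vec_eq_iff jac_def)

text \<open>\<open>G\<close> describes \<open>f\<close> on the part of the curve where it does not
  vanish. The positive degree gives \<open>G 0 = 0\<close>, so relations between representatives
  extend trivially to the other points.\<close>

definition rep :: "(c3 \<Rightarrow> complex) \<Rightarrow> (c3 set \<Rightarrow> c3 set) \<Rightarrow> nat \<Rightarrow> (c3 \<Rightarrow> c3) \<Rightarrow> bool" where
  "rep F f d G \<longleftrightarrow> 0 < d \<and> vform d G \<and> (\<forall>v. v \<noteq> 0 \<longrightarrow> F v = 0 \<longrightarrow> G v \<noteq> 0 \<longrightarrow>
     F (G v) = 0 \<and> f (vec.span {v}) = vec.span {G v})"

text \<open>Along the curve \<open>v \<times> dv = \<omega> \<nabla>F\<close> for the residue form \<open>\<omega>\<close>; \<open>pullback F G v J\<close> says that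
  \<open>G\<^sup>* \<omega> = J \<omega>\<close> at \<open>v\<close>, the tangent vectors at \<open>v\<close> being parametrised as \<open>e \<times> \<nabla>F\<close>. The sections
  \<open>J G\<^sub>i\<close> of \<open>O(1)\<close> represent the pullbacks of the regular differentials \<open>x\<^sub>i \<omega>\<close>, so they do not depend
  on \<open>G\<close> and are linear forms.\<close>

definition pullback :: "(c3 \<Rightarrow> complex) \<Rightarrow> (c3 \<Rightarrow> c3) \<Rightarrow> c3 \<Rightarrow> complex \<Rightarrow> bool" where
  "pullback F G v J \<longleftrightarrow> (\<forall>e. ccross (G v) (jac G v (ccross e (grad F v))) = (- cdot v e * J) *s grad F (G v))"

text \<open>\<open>F\<close> composed with \<open>G\<close> vanishes on the whole curve, so its
  derivative along a tangent vector is zero; the chain rule does the rest.\<close>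

lemma rep_tangent:
  assumes F: "smooth_form F" and G: "rep F f d G" and v: "v \<noteq> 0" "F v = 0"
    and w: "cdot (grad F v) w = 0"
  shows "cdot (grad F (G v)) (jac G v w) = 0"
proof -
  note sF = smooth_formD[OF F]
  have pG: "polymap G" using G vformD(1) by (auto simp: rep_def)
  have "cdot (grad (\<lambda>v. F (G v)) v) w = 0"
  proof (rule tangent_derivative_zero[OF F polyfun_comp[OF sF(2) pG] _ v w])
    fix u assume "u \<noteq> 0" "F u = 0"
    then show "F (G u) = 0" using G form_0_vec[OF sF(1)] by (cases "G u = 0") (auto simp: rep_def)
  qed
  then show ?thesis by (simp add: grad_comp[OF sF(2) pG])
qed

lemma ccross_parallel:
  assumes "n \<noteq> 0" "cdot n a = 0" "cdot n b = 0" obtains k where "ccross a b = k *s n"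
proof -
  have "ccross n (ccross a b) = 0" by (simp add: ccross_ccross assms)
  then show ?thesis using ccross_eq_0_imp[OF _ assms(1)] that by metis
qed

text \<open>The point \<open>G v\<close> and the image of a tangent vector are both orthogonal to
  the gradient at \<open>G v\<close>, so their cross product is a multiple of it. The multiple is
  linear in \<open>e\<close> and vanishes with \<open>cdot v e\<close>, because then the tangent
  vector is a multiple of \<open>v\<close> and Euler's identity sends it to a multiple of
  \<open>G v\<close>.\<close>

lemma pullback_exists:
  assumes F: "smooth_form F" and G: "rep F f d G" and v: "v \<noteq> 0" "F v = 0" and Gv: "G v \<noteq> 0"
  obtains J where "pullback F G v J"
proof -
  note sF = smooth_formD[OF F]
  have vG: "vform d G" and FG: "F (G v) = 0" using G v Gv by (auto simp: rep_def)
  define n where "n = grad F (G v)"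
  define K where "K e = ccross (G v) (jac G v (ccross e (grad F v)))" for e
  have n: "n \<noteq> 0" using sF(3)[OF Gv FG] by (simp add: n_def)
  have "cdot n (G v) = 0" using form_grad(1)[OF sF(1), of "G v"] FG by (simp add: n_def)
  moreover have "cdot n (jac G v (ccross e (grad F v))) = 0" for e
    unfolding n_def by (rule rep_tangent[OF F G v]) simp
  ultimately have par: "\<exists>k. K e = k *s n" for e
    unfolding K_def using ccross_parallel[OF n] by metis
  have Kadd: "K (a + b) = K a + K b" and Kscale: "K (c *s a) = c *s K a" for a b c
    by (simp_all add: K_def jac_add jac_scale)
  have K0: "K e = 0" if "cdot v e = 0" for e
  proof -
    have gv: "cdot v (grad F v) = 0"
      using form_grad(1)[OF sF(1), of v] v by (simp add: cdot_commute)
    have "ccross v (ccross e (grad F v)) = 0" by (simp add: ccross_ccross that gv)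
    then obtain c where "ccross e (grad F v) = c *s v" using ccross_eq_0_imp[OF _ v(1)] by metis
    then show ?thesis by (simp add: K_def jac_scale vformD(3)[OF vG])
  qed
  obtain e0 where e0: "cdot v e0 = 1" using nonzero_cdot[OF v(1)] .
  obtain J where J: "K e0 = J *s n" using par by blast
  have "K e = (cdot v e * J) *s n" for e
  proof -
    have "K e = K (cdot v e *s e0 + (e - cdot v e *s e0))" by simp
    also have "\<dots> = cdot v e *s K e0 + K (e - cdot v e *s e0)" by (simp only: Kadd Kscale)
    also have "K (e - cdot v e *s e0) = 0" by (rule K0) (simp add: e0)
    finally show ?thesis by (simp add: J)
  qed
  then show ?thesis by (intro that[of "- J"]) (simp add: pullback_def K_def n_def)
qed

text \<open>Two representatives differ by a factor \<open>r\<close> depending on the point.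
  Differentiating the relation \<open>ccross (G u) (G' u) = 0\<close> avoids differentiating
  \<open>r\<close>: the left side of \<open>pullback\<close> scales by \<open>r\<^sup>2\<close>, the
  gradient by \<open>r ^ 3\<close>, hence \<open>J\<close> by \<open>1 / r\<close>.\<close>

lemma pullback_unique:
  assumes F: "smooth_form F" and v: "v \<noteq> 0" "F v = 0"
    and G: "rep F f d G" "G v \<noteq> 0" "pullback F G v J"
    and G': "rep F f d' G'" "G' v \<noteq> 0" "pullback F G' v J'"
  shows "J' *s G' v = J *s G v"
proof -
  note sF = smooth_formD[OF F]
  have FG: "F (G v) = 0" using G v by (auto simp: rep_def)
  have pG: "polymap G" "polymap G'" using G(1) G'(1) vformD(1) by (auto simp: rep_def)
  have par: "ccross (G u) (G' u) = 0" if "u \<noteq> 0" "F u = 0" for u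
  proof (cases "G u = 0 \<or> G' u = 0")
    case False
    then have "vec.span {G' u} = vec.span {G u}" using G(1) G'(1) that by (auto simp: rep_def)
    then obtain c where "G' u = c *s G u" using span1_eqD by blast
    then show ?thesis by simp
  qed auto
  obtain r where r: "G' v = r *s G v" using ccross_eq_0_imp[OF par[OF v] G(2)] by metis
  have r0: "r \<noteq> 0" using r G'(2) by auto
  obtain e where e: "cdot v e = 1" using nonzero_cdot[OF v(1)] .
  define w where "w = ccross e (grad F v)"
  have w: "cdot (grad F v) w = 0" by (simp add: w_def)
  have "jac (\<lambda>v. ccross (G v) (G' v)) v w $ i = 0" for i
    unfolding jac_def
    using tangent_derivative_zero[OF F polymapD[OF polymap_ccross[OF pG]] _ v w] par by simp
  then have "jac (\<lambda>v. ccross (G v) (G' v)) v w = 0" by (simp add: vec_eq_iff)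
  then have "ccross (G v) (jac G' v w) = ccross (G' v) (jac G v w)"
    using jac_ccross[OF pG, of v w] ccross_swap[of "jac G v w" "G' v"] by simp
  then have "ccross (G' v) (jac G' v w) = r\<^sup>2 *s ccross (G v) (jac G v w)"
    by (simp add: r power2_eq_square)
  then have "(- J') *s grad F (r *s G v) = r\<^sup>2 *s ((- J) *s grad F (G v))"
    using G(3) G'(3) e unfolding pullback_def w_def r[symmetric] by simp
  then have "(r\<^sup>2 * J' * r) *s grad F (G v) = (r\<^sup>2 * J) *s grad F (G v)"
    by (simp add: grad_homogeneous_3[OF sF(1) r0] power_numeral_reduce mult_ac)
  then have "r\<^sup>2 * J' * r = r\<^sup>2 * J"
    using sF(3)[OF G(2) FG] by (metis vec.scale_cancel_right)
  then have "J' * r = J" using r0 by simp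
  then show ?thesis by (simp add: r)
qed

text \<open>\<open>J\<close> is homogeneous of degree 1 - d, so \<open>J *s G\<close> has degree 1
  whatever the degree of \<open>G\<close>.\<close>

lemma pullback_scale:
  assumes F: "smooth_form F" and G: "rep F f d G" and J: "pullback F G v J" and c: "c \<noteq> 0"
  shows "pullback F G (c *s v) (c * J / c ^ d)"
  unfolding pullback_def
proof
  fix e
  note sF = smooth_formD[OF F]
  have vG: "vform d G" using G by (auto simp: rep_def)
  define W where "W = ccross e (grad F v)"
  have cd: "c ^ d \<noteq> 0" using c by simp
  have "c *s ccross (G (c *s v)) (jac G (c *s v) (ccross e (grad F (c *s v))))
    = (c ^ d * c ^ 3) *s ccross (G v) (c *s jac G (c *s v) W)"
    by (simp add: grad_homogeneous_3[OF sF(1) c] vformD(2)[OF vG] W_def jac_scale mult_ac)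
  also have "\<dots> = (c ^ d * c ^ 3 * c ^ d) *s ccross (G v) (jac G v W)"
    by (simp add: vformD(4)[OF vG] mult_ac)
  also have "\<dots> = (c ^ d * c ^ 3 * c ^ d * (- cdot v e * J)) *s grad F (G v)"
    using J by (simp add: pullback_def W_def)
  also have "\<dots> = c *s ((- cdot (c *s v) e * (c * J / c ^ d)) *s grad F (G (c *s v)))"
    using cd by (simp add: grad_homogeneous_3[OF sF(1) cd] vformD(2)[OF vG] power_numeral_reduce field_simps)
  finally show "ccross (G (c *s v)) (jac G (c *s v) (ccross e (grad F (c *s v))))
    = (- cdot (c *s v) e * (c * J / c ^ d)) *s grad F (G (c *s v))"
    using c by (metis vec.scale_cancel_left)
qed

text \<open>If \<open>J\<close> vanished, \<open>G\<close> would be constant to first order, and so would \<open>G' \<circ> G\<close>, which represents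
  the identity.\<close>

lemma pullback_nonzero:
  assumes F: "smooth_form F" and v: "v \<noteq> 0" "F v = 0"
    and G: "rep F f d G" "G v \<noteq> 0" "pullback F G v J"
    and G': "rep F f d' G'" "G' (G v) \<noteq> 0"
    and inv: "\<And>u. u \<noteq> 0 \<Longrightarrow> F u = 0 \<Longrightarrow> f (f (vec.span {u})) = vec.span {u}"
  shows "J \<noteq> 0"
proof
  assume J: "J = 0"
  note sF = smooth_formD[OF F]
  have vG: "vform d G" "vform d' G'" "0 < d'" using G G' by (auto simp: rep_def)
  note pG = vformD(1)[OF vG(1)] and pG' = vformD(1)[OF vG(2)]
  have ff: "\<exists>c. G' (G u) = c *s u" if u: "u \<noteq> 0" "F u = 0" for u
  proof (cases "G u = 0 \<or> G' (G u) = 0")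
    case True
    have "G' 0 = 0" using vformD(2)[OF vG(2), of 0 0] vG(3) by (simp add: power_0_left)
    then show ?thesis using True by (intro exI[of _ 0]) auto
  next
    case False
    then have 1: "F (G u) = 0" "f (vec.span {u}) = vec.span {G u}" using G(1) u by (auto simp: rep_def)
    then have "f (vec.span {G u}) = vec.span {G' (G u)}" using G'(1) False by (auto simp: rep_def)
    then have "vec.span {G' (G u)} = vec.span {u}" using inv[OF u] 1 by simp
    then show ?thesis by (rule span1_eqD)
  qed
  obtain r where r: "G' (G v) = r *s v" using ff[OF v] by blast
  have r0: "r \<noteq> 0" using r G'(2) by auto
  have pGG: "polymap (\<lambda>u. G' (G u))" by (rule polymap_comp[OF pG' pG])
  obtain e where e: "cdot v e = 1" using nonzero_cdot[OF v(1)] .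
  define w where "w = ccross e (grad F v)"
  have w: "cdot (grad F v) w = 0" by (simp add: w_def)
  have "ccross (G v) (jac G v w) = 0" using G(3) J by (simp add: pullback_def w_def)
  then obtain c where c: "jac G v w = c *s G v" using ccross_eq_0_imp[OF _ G(2)] by metis
  have jGG: "jac (\<lambda>u. G' (G u)) v w = (c * of_nat d' * r) *s v"
    by (simp add: jac_comp[OF pG' pG] c jac_scale vformD(3)[OF vG(2)] r)
  \<comment> \<open>The derivative of the composite is parallel to \<open>v\<close>, so this
    relation leaves \<open>r *s ccross w v = 0\<close>; but \<open>ccross v w\<close> is minus the
    gradient.\<close>
  have "jac (\<lambda>u. ccross u (G' (G u))) v w $ i = 0" for i
    unfolding jac_def
    using tangent_derivative_zero[OF F polymapD[OF polymap_ccross[OF polymap_id pGG]] _ v w] ff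
    by fastforce
  then have "jac (\<lambda>u. ccross u (G' (G u))) v w = 0" by (simp add: vec_eq_iff)
  moreover have "cdot (grad (\<lambda>u. u $ i) v) w = w $ i" for i
    by (rule cdot_gradI[OF polyfun_nth]) (auto intro!: derivative_eq_intros)
  then have "jac (\<lambda>u. u) v w = w" by (simp add: jac_def vec_eq_iff)
  ultimately have "r *s ccross w v = 0"
    using jac_ccross[OF polymap_id pGG, of v w] by (simp add: r jGG)
  then have "ccross v w = 0" using r0 ccross_swap[of v w] by (simp add: vec.scale_eq_0_iff)
  moreover have "ccross v w = - grad F v"
  proof -
    have "cdot v (grad F v) = 0" using form_grad(1)[OF sF(1), of v] v by (simp add: cdot_commute)
    then show ?thesis by (simp add: w_def ccross_ccross e)
  qed
  ultimately show False using sF(3)[OF v] by simp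
qed

lemma regular_involution_linear:
  assumes F: "smooth_form F"
    and reg: "\<And>v. v \<noteq> 0 \<Longrightarrow> F v = 0 \<Longrightarrow> \<exists>d G. rep F f d G \<and> G v \<noteq> 0"
    and inv: "\<And>u. u \<noteq> 0 \<Longrightarrow> F u = 0 \<Longrightarrow> f (f (vec.span {u})) = vec.span {u}"
  obtains m :: "3 \<Rightarrow> c3" where "\<And>v. v \<noteq> 0 \<Longrightarrow> F v = 0 \<Longrightarrow>
    (\<chi> i. cdot (m i) v) \<noteq> 0 \<and> F (\<chi> i. cdot (m i) v) = 0 \<and> f (vec.span {v}) = vec.span {\<chi> i. cdot (m i) v}"
proof -
  note sF = smooth_formD[OF F]
  \<comment> \<open>The value \<open>J *s G v\<close> for any representative that is nonzero at
    \<open>v\<close>; \<open>pullback_unique\<close> makes it single-valued.\<close>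
  define S where "S v a \<longleftrightarrow> (\<exists>d G J. rep F f d G \<and> G v \<noteq> 0 \<and> pullback F G v J \<and> a = J *s G v)" for v a
  have ex: "\<exists>a. S v a" if v: "v \<noteq> 0" "F v = 0" for v
  proof -
    obtain d G where "rep F f d G" "G v \<noteq> 0" using reg[OF v] by blast
    moreover from this obtain J where "pullback F G v J" using pullback_exists[OF F _ v] by blast
    ultimately show ?thesis unfolding S_def by blast
  qed
  have uniq: "a = b" if "v \<noteq> 0" "F v = 0" "S v a" "S v b" for v a b
    using that pullback_unique[OF F that(1,2)] unfolding S_def by metis
  define s where "s v = (THE a. S v a)" for v
  have sI: "s v = a" if "v \<noteq> 0" "F v = 0" "S v a" for v a
    unfolding s_def using that uniq[OF that(1,2)] by blast
  have sS: "S v (s v)" if "v \<noteq> 0" "F v = 0" for v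
    using ex[OF that] sI[OF that] by metis
  have scale: "s (c *s v) = c *s s v" if c: "c \<noteq> 0" and v: "v \<noteq> 0" "F v = 0" for c v
  proof -
    obtain d G J where G: "rep F f d G" "G v \<noteq> 0" "pullback F G v J" "s v = J *s G v"
      using sS[OF v] unfolding S_def by blast
    have "vform d G" using G(1) by (auto simp: rep_def)
    then have Gc: "G (c *s v) = c ^ d *s G v" by (rule vformD(2))
    have "S (c *s v) (c *s s v)" unfolding S_def
      using pullback_scale[OF F G(1,3) c] G c Gc
      by (intro exI[of _ d] exI[of _ G] exI[of _ "c * J / c ^ d"]) auto
    moreover have "c *s v \<noteq> 0" "F (c *s v) = 0" using c v by (simp_all add: vec.scale_eq_0_iff sF(4))
    ultimately show ?thesis using sI by blast
  qed
  have loc: "\<exists>A B. polyfun A \<and> polyfun B \<and> B u \<noteq> 0 \<and> (\<forall>v. v \<noteq> 0 \<longrightarrow> F v = 0 \<longrightarrow> B v * s v $ i = A v)"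
    if u: "u \<noteq> 0" "F u = 0" for u i
  proof -
    obtain d G where G: "rep F f d G" "G u \<noteq> 0" using reg[OF u] by blast
    have pG: "polymap G" using G(1) vformD(1) by (auto simp: rep_def)
    have "F (G u) = 0" using G u by (auto simp: rep_def)
    then obtain k where k: "grad F (G u) $ k \<noteq> 0"
      using sF(3)[OF G(2)] by (auto simp: vec_eq_iff)
    obtain e where e: "cdot u e = 1" using nonzero_cdot[OF u(1)] .
    \<comment> \<open>Component \<open>k\<close> of the pullback identity, multiplied by
      \<open>G v $ i\<close>, exhibits the section as a quotient with denominator \<open>B\<close>,
      nonzero at \<open>u\<close>.\<close>
    define B where "B = (\<lambda>v. cdot v e * grad F (G v) $ k)"
    define A where "A = (\<lambda>v. - (G v $ i * ccross (G v) (jac G v (ccross e (grad F v))) $ k))"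
    have "polyfun B" unfolding B_def
      by (intro polyfun_mult polyfun_cdot_map polymap_id polymap_const
          polymapD[OF polymap_comp[OF polymap_grad[OF sF(2)] pG]])
    moreover have "polyfun A" unfolding A_def
      by (intro polyfun_uminus polyfun_mult polymapD[OF pG] polymapD[OF polymap_ccross] pG
          polymap_jac polymap_ccross polymap_const polymap_grad sF(2))
    moreover have "B u \<noteq> 0" using k e by (simp add: B_def)
    moreover have "B v * s v $ i = A v" if v: "v \<noteq> 0" "F v = 0" for v
    proof (cases "G v = 0")
      case True
      \<comment> \<open>Where the representative vanishes, \<open>A\<close> and \<open>B\<close> are
        both zero: the gradient at the origin equals 8 times itself.\<close>
      have "2 *s grad F (2 *s 0) = 2 *s (2 ^ 3 *s grad F 0)"
        using grad_homogeneous_3[OF sF(1), of 2 0] by simp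
      then have "7 *s grad F 0 = 0" by (simp add: vec_eq_iff)
      then have "grad F 0 = 0" by (simp add: vec_eq_iff)
      then show ?thesis using True by (simp add: A_def B_def)
    next
      case False
      obtain J where J: "pullback F G v J" using pullback_exists[OF F G(1) v False] .
      then have "s v = J *s G v" using G(1) False by (intro sI[OF v]) (auto simp: S_def)
      then show ?thesis using J by (simp add: A_def B_def pullback_def algebra_simps)
    qed
    ultimately show ?thesis by blast
  qed
  have "\<exists>m. \<forall>v. v \<noteq> 0 \<longrightarrow> F v = 0 \<longrightarrow> s v $ i = cdot m v" for i
  proof (rule regular_section_linear[OF F, of "\<lambda>v. s v $ i"])
    fix c :: complex and v :: c3 assume "c \<noteq> 0" "v \<noteq> 0" "F v = 0"
    then show "s (c *s v) $ i = c * s v $ i" using scale by simp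
  qed (use loc in blast)+
  then obtain m where m: "\<And>i v. v \<noteq> 0 \<Longrightarrow> F v = 0 \<Longrightarrow> s v $ i = cdot (m i) v" by metis
  show ?thesis
  proof (rule that[of m])
    fix v assume v: "v \<noteq> 0" "F v = 0"
    have s: "s v = (\<chi> i. cdot (m i) v)" using m[OF v] by (simp add: vec_eq_iff)
    obtain d G J where G: "rep F f d G" "G v \<noteq> 0" "pullback F G v J" "s v = J *s G v"
      using sS[OF v] unfolding S_def by blast
    have FG: "F (G v) = 0" "f (vec.span {v}) = vec.span {G v}" using G v by (auto simp: rep_def)
    obtain d' G' where G': "rep F f d' G'" "G' (G v) \<noteq> 0" using reg[OF G(2) FG(1)] by blast
    have J: "J \<noteq> 0" by (rule pullback_nonzero[OF F v G(1,2,3) G' inv])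
    then have "s v \<noteq> 0" using G(2,4) by (simp add: vec.scale_eq_0_iff)
    moreover have "F (s v) = 0" using FG(1) by (simp add: G(4) sF(4))
    moreover have "vec.span {s v} = vec.span {G v}"
      using \<open>s v \<noteq> 0\<close> by (intro span1_eq) (auto simp: mem_span1 G(4))
    ultimately show "(\<chi> i. cdot (m i) v) \<noteq> 0 \<and> F (\<chi> i. cdot (m i) v) = 0 \<and>
        f (vec.span {v}) = vec.span {\<chi> i. cdot (m i) v}"
      unfolding s[symmetric] using FG(2) by simp
  qed
qed

text \<open>\<open>K p = 0\<close> brings the degree in the coordinate along \<open>p\<close> below
  four, so \<open>vanishing_on_curve\<close> applies in every chart. Consequently a quartic form
  vanishing on the curve is a scalar multiple of \<open>F\<close>, with the scalar read off at
  \<open>p\<close>.\<close>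

lemma quartic_vanishing_on_curve:
  assumes F: "smooth_form F" and p: "F p \<noteq> 0" and K: "form 4 K" "K p = 0"
    and z: "\<And>v. v \<noteq> 0 \<Longrightarrow> F v = 0 \<Longrightarrow> K v = 0"
  shows "K v = 0"
proof -
  have p0: "p \<noteq> 0" using p form_0_vec[OF smooth_formD(1)[OF F]] by auto
  have chart: "K (x *s p + t *s e + f) = 0" if b: "cdet p e f \<noteq> 0" for x t e f
  proof -
    obtain a h2 h3 h4 where h: "form 2 h2" "form 3 h3" "form 4 h4"
      "\<And>x w. K (x *s p + w) = K p * x ^ 4 + cdot a w * x ^ 3 + h2 w * x\<^sup>2 + h3 w * x + h4 w"
      using quartic_expand[OF K(1)] by metis
    obtain q1 q2 q3 q4 where q: "\<And>t. cdot a (t *s e + f) = poly q1 t" "\<And>t. h2 (t *s e + f) = poly q2 t"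
      "\<And>t. h3 (t *s e + f) = poly q3 t" "\<And>t. h4 (t *s e + f) = poly q4 t"
      using polyfun_chart1 form_polyfun[OF h(1)] form_polyfun[OF h(2)] form_polyfun[OF h(3)] polyfun_cdot[of a]
      by metis
    define R where "R = [:q4, q3, q2, q1:]"
    have ev: "K (x *s p + t *s e + f) = ev2 R t x" for t x
      using h(4)[of x "t *s e + f"] unfolding q R_def
      by (simp add: K(2) add.assoc power_numeral_reduce algebra_simps)
    have "R = 0"
    proof (rule vanishing_on_curve[OF F p b])
      show "degree R < 4" by (simp add: R_def)
      show "ev2 R t x = 0" if "F (x *s p + t *s e + f) = 0" for t x
        using z[OF chart_nonzero[OF b] that] ev by simp
    qed
    then show ?thesis using ev by simp
  qed
  obtain e f where b: "cdet p e f \<noteq> 0" using nonzero_extend_basis[OF p0] .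
  have off: "K (x *s p + y *s e + r *s f) = 0" if "r \<noteq> 0" for x y r
  proof -
    have "cdet p e (r *s f) \<noteq> 0" using b cdet_comb(3)[of p e 0 0 r f] that by simp
    from chart[OF this] show ?thesis .
  qed
  obtain x y r where v: "v = x *s p + y *s e + r *s f" using cdet_coords[OF b] by metis
  \<comment> \<open>The plane spanned by \<open>p\<close> and \<open>e\<close> lies outside these
    charts; its points are reached as values at \<open>t = 0\<close> of a polynomial that vanishes
    for almost all \<open>t\<close>.\<close>
  obtain c0 c1 c2 c3 c4 where c: "\<And>s t. K (s *s v + t *s f) = c0 * s ^ 4 + c1 * s ^ 3 * t + c2 * s\<^sup>2 * t\<^sup>2 + c3 * s * t ^ 3 + c4 * t ^ 4"
    using form_4_binary[OF K(1)] by metis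
  have "[:c0, c1, c2, c3, c4:] = 0"
  proof (rule poly_cofinite_zero[of "{- r}"])
    fix t assume "t \<notin> {- r}"
    then have "r + t \<noteq> 0" by (metis add_eq_0_iff singletonI)
    have e: "1 *s v + t *s f = x *s p + y *s e + (r + t) *s f" by (simp add: v vec_eq_iff algebra_simps)
    have "K (1 *s v + t *s f) = 0" unfolding e by (rule off[OF \<open>r + t \<noteq> 0\<close>])
    then show "poly [:c0, c1, c2, c3, c4:] t = 0" unfolding c
      by (simp add: power_numeral_reduce algebra_simps)
  qed simp
  then show ?thesis using c[of 1 0] by simp
qed

section \<open>Linear involutions that preserve the curve\<close>

lemma form_reflection: "form d H \<Longrightarrow> form d (\<lambda>v. H (reflection p a v))"
proof (induction rule: form.induct)
  case (form_cdot d H b)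
  have "cdot b (reflection p a v) = cdot (b - (2 * cdot b p) *s a) v" for v
    by (simp add: reflection_def algebra_simps)
  then show ?case using form.form_cdot[OF form_cdot.IH, of "b - (2 * cdot b p) *s a"] by simp
qed (auto intro: form.intros)

lemma reflection_decomp:
  assumes "cdot a p = 1"
  obtains w where "cdot a w = 0" "v = cdot a v *s p + w" "reflection p a v = (- cdot a v) *s p + w"
  by (rule that[of "v - cdot a v *s p"]) (simp_all add: assms reflection_def vec_eq_iff)

text \<open>The reflection multiplies \<open>F\<close> by some \<open>c\<close> with
  \<open>c * c = 1\<close>. For \<open>c = - 1\<close> the mirror would be a component of the curve,
  and the curve would be singular where the residual cubic, given on the mirror by
  \<open>h3\<close>, meets it.\<close>

lemma reflection_preserving_curve_center:
  assumes F: "smooth_form F" and ap: "cdot a p = 1"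
    and z: "\<And>v. v \<noteq> 0 \<Longrightarrow> F v = 0 \<Longrightarrow> F (reflection p a v) = 0"
  shows "is_center F p a"
proof -
  note sF = smooth_formD[OF F]
  obtain q where q: "F q \<noteq> 0" using smooth_form_nonzero[OF F] .
  define c where "c = F (reflection p a q) / F q"
  have Fc: "F (reflection p a v) = c * F v" for v
  proof -
    have "form 4 (\<lambda>v. F (reflection p a v) + (- c) * F v)" by (intro form_add form_reflection form_scale sF(1))
    from quartic_vanishing_on_curve[OF F q this, of v] show ?thesis
      using q z by (simp add: c_def)
  qed
  have "F q = c * (c * F q)" using Fc[of "reflection p a q"] Fc[of q] by (simp add: reflection_simps(3)[OF ap])
  then have "c * c = 1" using q by simp
  then have "c = 1 \<or> c = - 1" by (simp add: square_eq_1_iff)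
  moreover have "c \<noteq> - 1"
  proof
    assume c: "c = - 1"
    obtain h2 h3 h4 where h: "form 2 h2" "form 3 h3" "form 4 h4"
      "\<And>x w. F (x *s p + w) = F p * x ^ 4 + cdot (grad F p) w * x ^ 3 + h2 w * x\<^sup>2 + h3 w * x + h4 w"
      using quartic_expand_grad[OF sF(1)] by metis
    have W: "F w = 0" if "cdot a w = 0" for w
    proof -
      have "reflection p a w = w" by (simp add: reflection_def that)
      then show ?thesis using Fc[of w] c by simp
    qed
    obtain e f where ef: "cdot a e = 0" "cdot a f = 0" "cdet p e f \<noteq> 0" using kernel_basis[OF ap] .
    have "\<exists>w. cdot a w = 0 \<and> w \<noteq> 0 \<and> h3 w = 0"
    proof (cases "h3 e = 0")
      case True
      then show ?thesis using ef cdet_nonzero(2)[OF ef(3)] by blast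
    next
      case False
      obtain c0 c1 c2 c3 where cub: "\<And>x y. h3 (x *s e + y *s f) = c0 * x ^ 3 + c1 * x\<^sup>2 * y + c2 * x * y\<^sup>2 + c3 * y ^ 3"
        using form_3_binary[OF h(2)] by metis
      have "c0 \<noteq> 0" using cub[of 1 0] False by simp
      then obtain t where "poly [:c3, c2, c1, c0:] t = 0"
        using complex_poly_root[of "[:c3, c2, c1, c0:]"] by auto
      then have "h3 (t *s e + 1 *s f) = 0" unfolding cub by (simp add: power_numeral_reduce algebra_simps)
      then show ?thesis using ef chart_nonzero[OF ef(3), of 0 t] by (intro exI[of _ "t *s e + f"]) simp
    qed
    then obtain w where w: "cdot a w = 0" "w \<noteq> 0" "h3 w = 0" by blast
    have "((\<lambda>x. F p * x ^ 4 + cdot (grad F p) w * x ^ 3 + h2 w * x\<^sup>2 + h3 w * x + h4 w)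
      has_field_derivative h3 w) (at 0)"
      by (auto intro!: derivative_eq_intros)
    then have "((\<lambda>t. F (w + t *s p)) has_field_derivative h3 w) (at 0)"
      using h(4)[of _ w] by (simp add: add.commute)
    then have gp: "cdot (grad F w) p = 0" using w(3) cdot_gradI[OF sF(2)] by simp
    have gw: "cdot (grad F w) w' = 0" if "cdot a w' = 0" for w'
      using W w that by (intro cdot_gradI[OF sF(2)]) simp
    have "grad F w = 0"
    proof (rule eq_cdotI)
      fix u
      obtain w' where "cdot a w' = 0" "u = cdot a u *s p + w'" using reflection_decomp[OF ap] .
      then show "cdot (grad F w) u = cdot 0 u"
        using gp gw by (metis cdot_add_right cdot_scale_right cdot_zero_left mult_zero_right add_0)
    qed
    then show False using sF(3)[OF w(2) W[OF w(1)]] by simp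
  qed
  ultimately have "c = 1" by blast
  then show ?thesis using Fc ap by (simp add: is_center_def)
qed

text \<open>Both eigenvalues 1 and -1 occur. A third vector splits into eigencomponents, one of
  which completes a basis. The simple eigenvalue belongs to the center, and
  \<open>\<epsilon>\<close> is the double one.\<close>

lemma linear_involution_reflection:
  assumes N: "\<And>u v. N (u + v) = N u + N v" "\<And>c v. N (c *s v) = c *s N v" and NN: "\<And>v. N (N v) = (v :: c3)"
    and ne: "\<exists>v. N v \<noteq> v" "\<exists>v. N v \<noteq> - v"
  obtains p a \<epsilon> where "cdot a p = 1" "\<epsilon> = 1 \<or> \<epsilon> = - 1" "\<And>v. N v = \<epsilon> *s reflection p a v"
proof -
  have neg: "N (- v) = - N v" for v using N(2)[of "-1" v] by simp
  have dif: "N (u - v) = N u - N v" for u v using N(1)[of u "- v"] neg by simp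
  obtain x y where xy: "N x \<noteq> x" "N y \<noteq> - y" using ne by blast
  define u where "u = x - N x"
  define v where "v = y + N y"
  have u: "u \<noteq> 0" "N u = - u" using xy by (simp_all add: u_def dif NN)
  have v: "v \<noteq> 0" "N v = v" using xy by (auto simp: v_def N NN add.commute add_eq_0_iff)
  have uv: "ccross u v \<noteq> 0"
  proof
    assume "ccross u v = 0"
    then obtain c where c: "v = c *s u" using ccross_eq_0_imp u(1) by metis
    then have "v = - v" using u v N(2)[of c u] by (simp add: c)
    then show False using v(1) by (simp add: vec_eq_iff)
  qed
  obtain h where h: "cdet u v h \<noteq> 0" using ccross_nonzero_extend[OF uv] .
  define h1 h2 where "h1 = h + N h" and "h2 = h - N h"
  have Nh: "N h1 = h1" "N h2 = - h2" by (simp_all add: h1_def h2_def N dif NN add.commute)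
  have "2 * cdet u v h = cdet u v h1 + cdet u v h2"
    by (simp add: h1_def h2_def cdet_def)
  then have "cdet u v h1 \<noteq> 0 \<or> cdet u v h2 \<noteq> 0" using h by auto
  then show ?thesis
  proof
    assume b: "cdet u v h1 \<noteq> 0"
    obtain a where a: "cdot a u = 1" "cdot a v = 0" "cdot a h1 = 0" using cdot_prescribe[OF b] .
    have "N w = 1 *s reflection u a w" for w
    proof -
      obtain x y z where w: "w = x *s u + y *s v + z *s h1" using cdet_coords[OF b] by metis
      have "N w = x *s (- u) + y *s v + z *s h1" unfolding w by (simp only: N u v Nh)
      moreover have "cdot a w = x" using a by (simp add: w)
      ultimately show ?thesis by (simp add: reflection_def) (simp add: w vec_eq_iff algebra_simps)
    qed
    then show ?thesis using a(1) that[of a u 1] by blast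
  next
    assume b: "cdet u v h2 \<noteq> 0"
    obtain a where a: "cdot a u = 0" "cdot a v = 1" "cdot a h2 = 0" using cdot_prescribe[OF b] .
    have "N w = (- 1) *s reflection v a w" for w
    proof -
      obtain x y z where w: "w = x *s u + y *s v + z *s h2" using cdet_coords[OF b] by metis
      have "N w = x *s (- u) + y *s v + z *s (- h2)" unfolding w by (simp only: N u v Nh)
      moreover have "cdot a w = y" using a by (simp add: w)
      ultimately show ?thesis by (simp add: reflection_def) (simp add: w vec_eq_iff algebra_simps)
    qed
    then show ?thesis using a(2) that[of a v "- 1"] by blast
  qed
qed

text \<open>The square of the linear map fixes all points of the curve, so it is a scalar by
  \<open>curve_eigenvectors\<close>. Dividing by a square root of it yields a linear involution,
  which is not plus or minus the identity since \<open>f\<close> moves a point.\<close>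

lemma linear_involution_center:
  fixes m :: "3 \<Rightarrow> c3"
  assumes F: "smooth_form F"
    and M: "\<And>v. v \<noteq> 0 \<Longrightarrow> F v = 0 \<Longrightarrow>
      (\<chi> i. cdot (m i) v) \<noteq> 0 \<and> F (\<chi> i. cdot (m i) v) = 0 \<and> f (vec.span {v}) = vec.span {\<chi> i. cdot (m i) v}"
    and inv: "\<And>u. u \<noteq> 0 \<Longrightarrow> F u = 0 \<Longrightarrow> f (f (vec.span {u})) = vec.span {u}"
    and ne: "v0 \<noteq> 0" "F v0 = 0" "f (vec.span {v0}) \<noteq> vec.span {v0}"
  obtains p a where "is_center F p a" "\<And>v. v \<noteq> 0 \<Longrightarrow> F v = 0 \<Longrightarrow> f (vec.span {v}) = vec.span {reflection p a v}"
proof -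
  note sF = smooth_formD[OF F]
  define T where "T v = (\<chi> i. cdot (m i) v)" for v
  note M = M[folded T_def]
  have lin: "T (u + v) = T u + T v" "T (c *s v) = c *s T v" for u v c
    by (simp_all add: T_def vec_eq_iff)
  have "\<exists>c. T (T v) = c *s v" if "v \<noteq> 0" "F v = 0" for v
    using M[OF that] M[of "T v"] inv[OF that] span1_eqD by metis
  then obtain c where c: "\<And>v. T (T v) = c *s v"
    using curve_eigenvectors[OF F, of "\<lambda>v. T (T v)"] lin by metis
  have c0: "c \<noteq> 0" using M[OF ne(1,2)] M[of "T v0"] c[of v0] by auto
  define r where "r = csqrt c"
  have r: "r * r = c" "r \<noteq> 0" using c0 by (auto simp: r_def) (metis power2_csqrt power2_eq_square)
  define N where "N v = (1 / r) *s T v" for v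
  have TN: "T v = r *s N v" for v using r(2) by (simp add: N_def)
  have span: "f (vec.span {v}) = vec.span {k *s N v}" if "v \<noteq> 0" "F v = 0" "k \<noteq> 0" for v k
  proof -
    have "k *s N v = (k / r) *s T v" by (simp add: N_def)
    moreover have "(k / r) *s T v \<noteq> 0" using M[OF that(1,2)] that(3) r(2) by (simp add: vec.scale_eq_0_iff)
    ultimately have "vec.span {k *s N v} = vec.span {T v}"
      by (intro span1_eq) (auto simp: mem_span1)
    then show ?thesis using M[OF that(1,2)] by simp
  qed
  obtain p a \<epsilon> where R: "cdot a p = 1" "\<epsilon> = 1 \<or> \<epsilon> = - 1" "\<And>v. N v = \<epsilon> *s reflection p a v"
  proof (rule linear_involution_reflection[of N])
    show "N (u + v) = N u + N v" "N (c *s v) = c *s N v" for u v c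
      by (simp_all add: N_def lin vec.scale_right_distrib mult.commute)
    show "N (N v) = v" for v
    proof -
      have "1 / r * (1 / r * c) = 1" unfolding r(1)[symmetric] using r(2) by simp
      moreover have "N (N v) = (1 / r * (1 / r * c)) *s v"
        unfolding N_def lin c by (simp only: vec.scale_scale mult.assoc)
      ultimately show ?thesis by simp
    qed
    show "\<exists>v. N v \<noteq> v"
    proof (intro exI[of _ v0] notI)
      assume e: "N v0 = v0"
      have "f (vec.span {v0}) = vec.span {1 *s N v0}" by (rule span[OF ne(1,2)]) simp
      then show False using ne(3) unfolding e by (simp only: vec.scale_one)
    qed
    show "\<exists>v. N v \<noteq> - v"
    proof (intro exI[of _ v0] notI)
      assume "N v0 = - v0"
      then have e: "(- 1) *s N v0 = v0" by simp
      have "f (vec.span {v0}) = vec.span {(- 1) *s N v0}" by (rule span[OF ne(1,2)]) simp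
      then show False using ne(3) unfolding e by simp
    qed
  qed blast
  have eps: "\<epsilon> \<noteq> 0" "\<epsilon> * \<epsilon> = 1" using R(2) by auto
  have Rv: "reflection p a v = \<epsilon> *s N v" for v using R(3) eps(2) by simp
  show ?thesis
  proof (rule that)
    show "is_center F p a"
    proof (rule reflection_preserving_curve_center[OF F R(1)])
      fix v assume v: "v \<noteq> 0" "F v = 0"
      have "reflection p a v = (\<epsilon> / r) *s T v" by (simp add: Rv N_def)
      then show "F (reflection p a v) = 0" using M[OF v] sF(4) by simp
    qed
    show "f (vec.span {v}) = vec.span {reflection p a v}" if "v \<noteq> 0" "F v = 0" for v
      unfolding Rv by (rule span[OF that eps(1)])
  qed
qed

text \<open>By \<open>center_expand\<close> the gradient at \<open>p\<close> determines
  \<open>a\<close>; scaling \<open>p\<close> by \<open>k\<close> scales \<open>a\<close> by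
  \<open>1 / k\<close>, and the two effects cancel.\<close>

lemma reflection_eqI:
  assumes F: "smooth_form F" and c: "is_center F p a" "is_center F p' a'"
    and eq: "vec.span {p} = vec.span {p'}"
  shows "reflection p a = reflection p' a'"
proof -
  note sF = smooth_formD[OF F]
  obtain k where k: "p' = k *s p" using span1_eqD eq by metis
  have k0: "k \<noteq> 0" using k is_center_nonzero[OF c(2)] by auto
  have Fp: "F p \<noteq> 0" using center_expand(1)[OF F c(1)] .
  have "(4 * (k ^ 4 * F p)) *s a' = k ^ 3 *s ((4 * F p) *s a)"
    using center_expand(2)[OF F c(2)] center_expand(2)[OF F c(1)]
    unfolding k sF(4) grad_homogeneous_3[OF sF(1) k0] by simp
  then have "(4 * k ^ 3 * F p) *s (k *s a') = (4 * k ^ 3 * F p) *s a"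
    by (simp add: power_numeral_reduce mult_ac)
  moreover have "4 * k ^ 3 * F p \<noteq> 0" using k0 Fp by simp
  ultimately have "k *s a' = a" by (metis vec.scale_cancel_left)
  then have "a = k *s a'" by simp
  then show ?thesis by (simp add: fun_eq_iff reflection_def k mult_ac)
qed

lemma reflection_fixes: "cdot a v = 0 \<Longrightarrow> reflection p a v = v"
  by (simp add: reflection_def)

lemma reflection_center: "cdot a p = 1 \<Longrightarrow> reflection p a p = - p"
  by (simp add: reflection_def vec_eq_iff)

lemma reflection_not_scalar:
  assumes "cdot a p = 1" shows "\<exists>v. reflection p a v \<noteq> c *s v"
proof (rule ccontr)
  assume "\<not> ?thesis"
  then have s: "reflection p a v = c *s v" for v by blast
  obtain e f where e: "cdot a e = 0" "cdot a f = 0" "cdet p e f \<noteq> 0" using kernel_basis[OF assms] .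
  have "e = c *s e" using s[of e] reflection_fixes[OF e(1), of p] by simp
  then have "(1 - c) *s e = 0" by (simp add: vec.scale_left_diff_distrib)
  then have "c = 1" using cdet_nonzero(2)[OF e(3)] by (simp only: vec.scale_eq_0_iff) simp
  moreover have "p \<noteq> 0" using assms by auto
  ultimately show False using s[of p] reflection_center[OF assms] by (simp add: vec_eq_iff)
qed

text \<open>The composite of the two reflections fixes all points of the curve, hence is a scalar.
  Two mirrors always share a nonzero vector, on which this scalar is 1.\<close>

lemma span_eqI_reflection:
  assumes F: "smooth_form F" and c: "is_center F p a" "is_center F p' a'"
    and eq: "\<And>v. v \<noteq> 0 \<Longrightarrow> F v = 0 \<Longrightarrow> vec.span {reflection p a v} = vec.span {reflection p' a' v}"
  shows "vec.span {p} = vec.span {p'}"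
proof -
  have a: "cdot a p = 1" "cdot a' p' = 1" using c by (auto simp: is_center_def)
  have "\<exists>k. reflection p' a' (reflection p a v) = k *s v" if v: "v \<noteq> 0" "F v = 0" for v
  proof -
    obtain k where "reflection p a v = k *s reflection p' a' v" using span1_eqD[OF eq[OF v]] by blast
    then show ?thesis by (simp add: reflection_simps(2,3) a)
  qed
  then obtain k where k: "\<And>v. reflection p' a' (reflection p a v) = k *s v"
    using curve_eigenvectors[OF F, of "\<lambda>v. reflection p' a' (reflection p a v)"] by (auto simp: reflection_simps)
  have "\<exists>v. v \<noteq> 0 \<and> cdot a v = 0 \<and> cdot a' v = 0"
  proof (cases "ccross a a' = 0")
    case True
    moreover have "a \<noteq> 0" using a by auto
    ultimately obtain t where "a' = t *s a" using ccross_eq_0_imp by metis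
    moreover obtain e f where "cdot a e = 0" "cdot a f = 0" "cdet p e f \<noteq> 0" using kernel_basis[OF a(1)] .
    ultimately show ?thesis using cdet_nonzero(2) by (intro exI[of _ e]) auto
  qed (auto intro!: exI[of _ "ccross a a'"])
  then obtain v where v: "v \<noteq> 0" "cdot a v = 0" "cdot a' v = 0" by blast
  then have "v = k *s v" using k[of v] by (simp add: reflection_fixes)
  then have "(1 - k) *s v = 0" by (simp add: vec.scale_left_diff_distrib)
  then have "k = 1" using v(1) by (simp only: vec.scale_eq_0_iff) simp
  then have "reflection p' a' (- p) = p" using k[of p] reflection_center[OF a(1)] by simp
  then have "p = cdot a' p *s p'" by (simp add: reflection_def vec_eq_iff)
  then have "p \<in> vec.span {p'}" unfolding mem_span1 by blast
  then show ?thesis using is_center_nonzero[OF c(1)] by (rule span1_eq)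
qed

section \<open>Evaluation, tangency and quadruple points\<close>

definition monomial :: "(3 \<Rightarrow>\<^sub>0 nat) \<Rightarrow> c3 \<Rightarrow> complex" where
  "monomial m v = (\<Prod>i\<in>UNIV. (v $ i) ^ Poly_Mapping.lookup m i)"

lemma monomial_3: "monomial m v = v $ 1 ^ Poly_Mapping.lookup m 1 * v $ 2 ^ Poly_Mapping.lookup m 2 * v $ 3 ^ Poly_Mapping.lookup m 3"
  unfolding monomial_def UNIV_3 by (simp add: mult.assoc)

lemma monomial_0 [simp]: "monomial 0 v = 1"
  by (simp add: monomial_3)

lemma monomial_add: "monomial (m + n) v = monomial m v * monomial n v"
  by (simp add: monomial_3 lookup_add power_add)

lemma eval_alt: "eval F v = (\<Sum>m\<in>Poly_Mapping.keys F. Poly_Mapping.lookup F m * monomial m v)"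
  by (simp add: eval_def subst_def monomial_def)

lemma eval_0 [simp]: "eval 0 v = 0"
  by (simp add: eval_alt)

lemma eval_single [simp]: "eval (Poly_Mapping.single m c) v = c * monomial m v"
  by (simp add: eval_alt)

lemma eval_add [simp]: "eval (F + G) v = eval F v + eval G v"
  unfolding eval_alt by (rule setsum_keys_plus_distrib) (auto simp: distrib_right)

lemma eval_sum: "eval (\<Sum>i\<in>S. F i) v = (\<Sum>i\<in>S. eval (F i) v)"
  by (induction S rule: infinite_finite_induct) auto

lemma poly_mapping_sum_single:
  "F = (\<Sum>m\<in>Poly_Mapping.keys F. Poly_Mapping.single m (Poly_Mapping.lookup F m))"
  by (rule poly_mapping_eqI) (simp add: lookup_sum lookup_single when_def in_keys_iff)

lemma eval_mult [simp]: "eval (F * G) v = eval F v * eval G v"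
proof -
  have "F * G = (\<Sum>m\<in>Poly_Mapping.keys F. \<Sum>n\<in>Poly_Mapping.keys G.
    Poly_Mapping.single (m + n) (Poly_Mapping.lookup F m * Poly_Mapping.lookup G n))"
    by (subst (1) poly_mapping_sum_single[of F], subst (1) poly_mapping_sum_single[of G])
      (simp add: sum_product mult_single)
  then show ?thesis
    by (simp add: eval_sum monomial_add eval_alt[of F] eval_alt[of G] sum_product mult_ac)
qed

lemma eval_one [simp]: "eval 1 v = 1"
  using eval_single[of 0 1 v] by (simp del: eval_single)

lemma eval_power [simp]: "eval (F ^ n) v = eval F v ^ n"
  by (induction n) auto

lemma eval_X [simp]: "eval (X i) v = v $ i"
  using exhaust_3[of i] by (auto simp: X_def monomial_3 lookup_single)

lemma eval_const [simp]: "eval (const c) v = c"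
  by (simp add: const_def)

lemma homogeneous_add: "homogeneous d F \<Longrightarrow> homogeneous d G \<Longrightarrow> homogeneous d (F + G)"
  unfolding homogeneous_def using keys_add[of F G] by blast

lemma homogeneous_mult: "homogeneous d F \<Longrightarrow> homogeneous e G \<Longrightarrow> homogeneous (d + e) (F * G)"
  unfolding homogeneous_def using keys_mult[of F G]
  by (fastforce simp: lookup_add sum.distrib)

lemma homogeneous_const: "homogeneous 0 (const c)"
  by (simp add: homogeneous_def const_def)

lemma homogeneous_X: "homogeneous 1 (X i)"
  using exhaust_3[of i] by (auto simp: homogeneous_def X_def sum_3 lookup_single)

lemma homogeneous_power: "homogeneous d F \<Longrightarrow> homogeneous (n * d) (F ^ n)"
proof (induction n)
  case 0 then show ?case using homogeneous_const[of 1] by (simp add: const_def)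
qed (auto intro: homogeneous_mult)

lemma form_monomial: "form (\<Sum>i\<in>UNIV. Poly_Mapping.lookup m i) (monomial m)"
proof -
  have 1: "form n (\<lambda>v. v $ i ^ n)" for n i
    using form_power[OF form_linear[of "axis i 1"], of n] by simp
  show ?thesis
    using form_mult[OF form_mult[OF 1[of "Poly_Mapping.lookup m 1" 1] 1[of "Poly_Mapping.lookup m 2" 2]]
        1[of "Poly_Mapping.lookup m 3" 3]]
    by (simp add: monomial_3[abs_def] sum_3 add.assoc)
qed

lemma homogeneous_form: "homogeneous d F \<Longrightarrow> form d (eval F)"
  unfolding eval_alt[abs_def] homogeneous_def
  by (intro form_sum form_scale) (auto, metis form_monomial)

lemma monomial_derivative:
  "((\<lambda>t. monomial m (v + t *s axis i 1)) has_field_derivative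
     of_nat (Poly_Mapping.lookup m i) * monomial (m - Poly_Mapping.single i 1) v) (at 0)"
proof -
  have *: "((\<lambda>t. v $ j + t * axis i 1 $ j) has_field_derivative axis i 1 $ j) (at 0)" for j
    by (auto intro!: derivative_eq_intros)
  show ?thesis
    using exhaust_3[of i] unfolding monomial_3
    by (auto simp: axis_def lookup_minus lookup_single intro!: derivative_eq_intros)
qed

lemma eval_partial_deriv:
  assumes "homogeneous d F" shows "eval (partial_deriv i F) v = grad (eval F) v $ i"
proof -
  have "((\<lambda>t. eval F (v + t *s axis i 1)) has_field_derivative eval (partial_deriv i F) v) (at 0)"
    unfolding eval_alt[of F]
    by (rule derivative_eq_intros monomial_derivative refl)+
      (simp add: partial_deriv_def eval_sum mult_ac)
  then have "cdot (grad (eval F) v) (axis i 1) = eval (partial_deriv i F) v"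
    by (rule cdot_gradI[OF form_polyfun[OF homogeneous_form[OF assms]]])
  then show ?thesis by simp
qed

text \<open>The passage from polynomials to functions: formal partial derivatives are the components
  of \<open>grad\<close>.\<close>

lemma smooth_quartic_iff: "smooth_quartic F \<longleftrightarrow> homogeneous 4 F \<and> smooth_form (eval F)"
proof -
  have "grad (eval F) v = 0 \<longleftrightarrow> (\<forall>i. eval (partial_deriv i F) v = 0)" if "homogeneous 4 F" for v
    using eval_partial_deriv[OF that] by (simp add: vec_eq_iff)
  then show ?thesis using homogeneous_form[of 4 F]
    unfolding smooth_quartic_def smooth_curve_def smooth_form_def by blast
qed

section \<open>Projective points and lines, intersection multiplicities\<close>

lemma proj_points_iff: "P \<in> proj_points \<longleftrightarrow> (\<exists>u. u \<noteq> 0 \<and> P = vec.span {u})"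
proof
  assume "P \<in> proj_points"
  then have P: "vec.subspace P" "vec.dim P = 1" by (auto simp: proj_points_def)
  obtain B where B: "B \<subseteq> P" "vec.independent B" "P \<subseteq> vec.span B" "card B = vec.dim P"
    using vec.basis_exists[of P] by metis
  then obtain u where u: "B = {u}" using P(2) by (metis card_1_singletonE)
  then have "u \<noteq> 0" using B(2) by (simp add: vec.dependent_single)
  moreover have "P = vec.span {u}" using B P(1) vec.span_minimal[of B P] u by blast
  ultimately show "\<exists>u. u \<noteq> 0 \<and> P = vec.span {u}" by blast
next
  assume "\<exists>u. u \<noteq> 0 \<and> P = vec.span {u}"
  then obtain u where u: "u \<noteq> 0" "P = vec.span {u}" by blast
  have "vec.independent {u}" using u(1) by (simp add: vec.dependent_single)
  then show "P \<in> proj_points"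
    using vec.dim_eq_card_independent[of "{u}"] by (simp add: proj_points_def u(2) vec.dim_span)
qed

lemma ccross_independent: "u \<noteq> w \<Longrightarrow> vec.independent {u, w :: c3} \<longleftrightarrow> ccross u w \<noteq> 0"
  using vec.independent_insert[of w "{u}"] ccross_eq_0_iff[of u w]
  by (cases "u = 0") (auto simp: vec.dependent_single mem_span1 insert_commute vec.dependent_zero)

lemma proj_lines_iff: "L \<in> proj_lines \<longleftrightarrow> (\<exists>u w. ccross u w \<noteq> 0 \<and> L = vec.span {u, w})"
proof
  assume "L \<in> proj_lines"
  then have L: "vec.subspace L" "vec.dim L = 2" by (auto simp: proj_lines_def)
  obtain B where B: "B \<subseteq> L" "vec.independent B" "L \<subseteq> vec.span B" "card B = vec.dim L"
    using vec.basis_exists[of L] by metis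
  then obtain u w where u: "B = {u, w}" "u \<noteq> w" using L(2) by (metis card_2_iff)
  then have "ccross u w \<noteq> 0" using B(2) by (simp add: ccross_independent)
  moreover have "L = vec.span {u, w}" using B L(1) vec.span_minimal[of B L] u by blast
  ultimately show "\<exists>u w. ccross u w \<noteq> 0 \<and> L = vec.span {u, w}" by blast
next
  assume "\<exists>u w. ccross u w \<noteq> 0 \<and> L = vec.span {u, w}"
  then obtain u w where u: "ccross u w \<noteq> 0" "L = vec.span {u, w}" by blast
  then have "u \<noteq> w" by auto
  then have "vec.independent {u, w}" using u(1) by (simp add: ccross_independent)
  then show "L \<in> proj_lines"
    using vec.dim_eq_card_independent[of "{u, w}"] \<open>u \<noteq> w\<close> by (simp add: proj_lines_def u(2) vec.dim_span)
qed

lemma poly_restrict_to_line: "poly (restrict_to_line F u w) t = eval F (u + t *s w)"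
  by (simp add: restrict_to_line_def eval_def subst_def poly_sum poly_prod mult.commute)

lemma restrict_to_lineI: "(\<And>t. eval F (u + t *s w) = poly r t) \<Longrightarrow> restrict_to_line F u w = r"
  by (simp flip: poly_eq_poly_eq_iff add: fun_eq_iff poly_restrict_to_line)

lemma order_0_coeff:
  fixes r :: "complex poly"
  assumes "k < order 0 r" "r \<noteq> 0" shows "coeff r k = 0"
proof -
  have "[:- 0, 1:] ^ order 0 r dvd r" by (rule order_1)
  then have "monom 1 (order 0 r) dvd r" by (simp add: monom_altdef)
  then show ?thesis using assms(1) by (simp add: monom_1_dvd_iff')
qed

lemma meets_order:
  assumes "meets_with_mult F L (vec.span {p}) n" "p \<noteq> 0" "w \<in> L" "ccross p w \<noteq> 0"
  shows "restrict_to_line F p w \<noteq> 0" "order 0 (restrict_to_line F p w) = n"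
proof -
  have "p \<in> vec.span {p} - {0}" using assms(2) vec.span_base[of p "{p}"] by simp
  moreover have "w \<in> L - vec.span {p}" using assms(3,4) by (auto simp: mem_span1)
  ultimately show "restrict_to_line F p w \<noteq> 0" "order 0 (restrict_to_line F p w) = n"
    using assms(1) unfolding meets_with_mult_def by blast+
qed

lemma order_power_mult: "p \<noteq> 0 \<Longrightarrow> order a ((p :: complex poly) ^ n) = n * order a p"
  by (induction n) (simp_all add: order_mult)

lemma order_0_linear: "[:x, y:] \<noteq> 0 \<Longrightarrow> order 0 [:x, y :: complex:] = (if x = 0 then 1 else 0)"
proof (cases "x = 0")
  case True
  assume "[:x, y:] \<noteq> 0"
  then have "y \<noteq> 0" using True by simp
  then have eq: "[:x, y:] = smult y [:- 0, 1:]" using True by simp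
  have "order 0 (smult y [:- 0, 1:]) = order 0 [:- 0, 1 :: complex:]" by (rule order_smult[OF \<open>y \<noteq> 0\<close>])
  also have "\<dots> = 1" using order_power_n_n[of "0 :: complex" 1] by (simp only: power_one_right)
  finally show ?thesis using True unfolding eq by simp
qed (simp add: order_0I)

text \<open>In a basis adapted to the points of tangency, the prescribed orders kill the low
  coefficients seen from either end of the line, and a single monomial survives.\<close>

lemma bitangents_imp:
  assumes hom: "homogeneous 4 F" and L: "L \<in> bitangents F"
  shows "bitangent (eval F) L"
proof -
  note fF = homogeneous_form[OF hom]
  obtain u0 w0 where uw: "ccross u0 w0 \<noteq> 0" "L = vec.span {u0, w0}"
    using L by (auto simp: bitangents_def proj_lines_iff)
  obtain P P' where P: "P \<in> proj_points" "P' \<in> proj_points" "P \<subseteq> L" "P' \<subseteq> L"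
    and m: "\<And>Q. Q \<in> proj_points \<Longrightarrow> Q \<subseteq> L \<Longrightarrow>
      meets_with_mult F L Q ((if Q = P then 2 else 0) + (if Q = P' then 2 else 0))"
    using L unfolding bitangents_def by blast
  obtain p p' where p: "p \<noteq> 0" "P = vec.span {p}" "p' \<noteq> 0" "P' = vec.span {p'}"
    using P(1,2) by (auto simp: proj_points_iff)
  have pL: "p \<in> L" "p' \<in> L" using P(3,4) p vec.span_base by blast+
  show ?thesis
  proof (cases "P = P'")
    case True
    obtain w where w: "ccross p w \<noteq> 0" "L = vec.span {p, w}"
      using line_basis_at[OF p(1) _ uw(1)] pL(1) uw(2) by metis
    have wL: "w \<in> L" unfolding w(2) by (rule vec.span_base) simp
    obtain a b c d e where F: "\<And>x y. eval F (x *s p + y *s w) = a * x ^ 4 + b * x ^ 3 * y + c * x\<^sup>2 * y\<^sup>2 + d * x * y ^ 3 + e * y ^ 4"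
      using form_4_binary[OF fF] by metis
    have r: "restrict_to_line F p w = [:a, b, c, d, e:]"
      using F[of 1] by (intro restrict_to_lineI) (simp add: power_numeral_reduce algebra_simps)
    have "meets_with_mult F L (vec.span {p}) 4" using m[OF P(1,3)] True unfolding p(2) by simp
    note o = meets_order[OF this p(1) wL w(1), unfolded r]
    have z: "coeff [:a, b, c, d, e:] k = 0" if "k < 4" for k using order_0_coeff[of k "[:a, b, c, d, e:]"] o that by simp
    have "a = 0" "b = 0" "c = 0" "d = 0" using z[of 0] z[of 1] z[of 2] z[of 3] by (simp_all add: numeral_eq_Suc)
    moreover from this have "e \<noteq> 0" using o(1) by auto
    ultimately show ?thesis using w F unfolding bitangent_def
      by (intro exI[of _ p] exI[of _ w] exI[of _ e]) simp
  next
    case False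
    have cr: "ccross p p' \<noteq> 0"
    proof
      assume "ccross p p' = 0"
      then obtain c where "p' = c *s p" using ccross_eq_0_imp p(1) by metis
      then have "p' \<in> vec.span {p}" unfolding mem_span1 by blast
      then show False using span1_eq[OF _ p(3)] False p by metis
    qed
    then have cr': "ccross p' p \<noteq> 0" using ccross_swap[of p p'] by auto
    have Lp: "L = vec.span {p, p'}" using span2_eq[OF cr] pL uw(2) by metis
    obtain a b c d e where F: "\<And>x y. eval F (x *s p + y *s p') = a * x ^ 4 + b * x ^ 3 * y + c * x\<^sup>2 * y\<^sup>2 + d * x * y ^ 3 + e * y ^ 4"
      using form_4_binary[OF fF] by metis
    have r: "restrict_to_line F p p' = [:a, b, c, d, e:]"
      using F[of 1] by (intro restrict_to_lineI) (simp add: power_numeral_reduce algebra_simps)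
    have r': "restrict_to_line F p' p = [:e, d, c, b, a:]"
      using F[of _ 1] by (intro restrict_to_lineI) (simp add: power_numeral_reduce algebra_simps)
    have mm: "meets_with_mult F L (vec.span {p}) 2" "meets_with_mult F L (vec.span {p'}) 2"
      using m[OF P(1,3)] m[OF P(2,4)] False unfolding p(2,4) by (simp_all add: numeral_2_eq_2)
    note o = meets_order[OF mm(1) p(1) pL(2) cr, unfolded r] meets_order[OF mm(2) p(3) pL(1) cr', unfolded r']
    have "coeff [:a, b, c, d, e:] k = 0" "coeff [:e, d, c, b, a:] k = 0" if "k < 2" for k
      using order_0_coeff[OF _ o(1), of k] order_0_coeff[OF _ o(3), of k] that unfolding o(2,4) by blast+
    from this[of 0] this[of 1] have "a = 0" "b = 0" "e = 0" "d = 0" by simp_all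
    moreover from this have "c \<noteq> 0" using o(1) by auto
    ultimately show ?thesis using cr Lp F unfolding bitangent_def
      by (intro exI[of _ p] exI[of _ p'] exI[of _ c]) simp
  qed
qed

lemma bitangents_if:
  assumes "bitangent (eval F) L" shows "L \<in> bitangents F"
proof -
  obtain u w c where uw: "ccross u w \<noteq> 0" "L = vec.span {u, w}" "c \<noteq> 0"
    and cases: "(\<forall>x y. eval F (x *s u + y *s w) = c * x\<^sup>2 * y\<^sup>2) \<or> (\<forall>x y. eval F (x *s u + y *s w) = c * y ^ 4)"
    using assms unfolding bitangent_def by blast
  have uw0: "u \<noteq> 0" "w \<noteq> 0" using uw(1) by auto
  have pp: "vec.span {u} \<in> proj_points" "vec.span {w} \<in> proj_points"
    using uw0 by (auto simp: proj_points_iff)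
  have uwL: "vec.span {u} \<subseteq> L" "vec.span {w} \<subseteq> L"
    unfolding uw(2) by (intro vec.span_mono; simp)+
  have L: "L \<in> proj_lines" using uw by (auto simp: proj_lines_iff)
  \<comment> \<open>\<open>meets_with_mult\<close> allows any parametrisation
    \<open>v + t *s v'\<close> of the line at \<open>Q\<close>. In the basis \<open>u\<close>,
    \<open>w\<close> it becomes a pair of linear polynomials in \<open>t\<close>, neither of them
    zero because \<open>v\<close> and \<open>v'\<close> are independent.\<close>
  have local: "restrict_to_line F v v' \<noteq> 0 \<and> order 0 (restrict_to_line F v v') = n"
    if Q: "Q \<in> proj_points" "Q \<subseteq> L" and v: "v \<in> Q - {0}" "v' \<in> L - Q"
      and n: "\<And>x y x' y'. v = x *s u + y *s w \<Longrightarrow> v' = x' *s u + y' *s w \<Longrightarrow>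
        [:x, x':] \<noteq> 0 \<Longrightarrow> [:y, y':] \<noteq> 0 \<Longrightarrow> (Q = vec.span {u} \<longleftrightarrow> y = 0) \<Longrightarrow> (Q = vec.span {w} \<longleftrightarrow> x = 0) \<Longrightarrow>
        restrict_to_line F v v' \<noteq> 0 \<and> order 0 (restrict_to_line F v v') = n" for Q v v' n
  proof -
    obtain q where q: "q \<noteq> 0" "Q = vec.span {q}" using Q(1) by (auto simp: proj_points_iff)
    have Qv: "Q = vec.span {v}" using v span1_eq[of v q] by (auto simp: q)
    have "v \<in> L" "v' \<in> L" using v Q by auto
    then obtain x y x' y' where xy: "v = x *s u + y *s w" "v' = x' *s u + y' *s w"
      unfolding uw(2) mem_span2 by blast
    have v0: "v \<noteq> 0" and v': "\<And>k. v' \<noteq> k *s v" using v by (auto simp: Qv mem_span1)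
    have par: "\<not> (v = k *s b \<and> v' = k' *s b)" for k k' b
    proof
      assume e: "v = k *s b \<and> v' = k' *s b"
      then have "k \<noteq> 0" using v0 by auto
      then have "v' = (k' / k) *s v" using e by simp
      then show False using v' by blast
    qed
    have "[:x, x':] \<noteq> 0" using par[of y w y'] xy by auto
    moreover have "[:y, y':] \<noteq> 0" using par[of x u x'] xy by auto
    moreover have "Q = vec.span {b} \<longleftrightarrow> (\<exists>k. v = k *s b)" for b
      using span1_eq[OF _ v0] span1_eqD unfolding Qv mem_span1 by metis
    moreover have "(\<exists>k. v = k *s u) \<longleftrightarrow> y = 0"
      using ccross_nonzero_indep(2)[OF uw(1), of "x - _" y] xy(1)
      by (fastforce simp: vec_eq_iff algebra_simps)
    moreover have "(\<exists>k. v = k *s w) \<longleftrightarrow> x = 0"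
      using ccross_nonzero_indep(1)[OF uw(1), of x "y - _"] xy(1)
      by (fastforce simp: vec_eq_iff algebra_simps)
    ultimately show ?thesis using n[OF xy] by blast
  qed
  have comb: "x *s u + y *s w + t *s (x' *s u + y' *s w) = poly [:x, x':] t *s u + poly [:y, y':] t *s w" for x y x' y' t
    by (simp add: vec_eq_iff algebra_simps)
  from cases show ?thesis
  proof
    assume F: "\<forall>x y. eval F (x *s u + y *s w) = c * x\<^sup>2 * y\<^sup>2"
    have "meets_with_mult F L Q ((if Q = vec.span {u} then 2 else 0) + (if Q = vec.span {w} then 2 else 0))"
      if Q: "Q \<in> proj_points" "Q \<subseteq> L" for Q
      unfolding meets_with_mult_def
    proof (intro ballI, rule local[OF Q])
      fix v v' x y x' y' assume a: "v = x *s u + y *s w" "v' = x' *s u + y' *s w"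
        "[:x, x':] \<noteq> 0" "[:y, y':] \<noteq> 0" "Q = vec.span {u} \<longleftrightarrow> y = 0" "Q = vec.span {w} \<longleftrightarrow> x = 0"
      have r: "restrict_to_line F v v' = smult c ([:x, x':] ^ 2 * [:y, y':] ^ 2)"
        unfolding a(1,2) by (rule restrict_to_lineI) (unfold comb F[rule_format], simp only: poly_smult poly_mult poly_power mult.assoc)
      have nz: "[:x, x':] ^ 2 * [:y, y':] ^ 2 \<noteq> 0" using a(3,4) by simp
      have "order 0 ([:x, x':] ^ 2 * [:y, y':] ^ 2) = 2 * (if x = 0 then 1 else 0) + 2 * (if y = 0 then 1 else 0)"
        using nz a(3,4) by (simp only: order_mult order_power_mult order_0_linear not_False_eq_True)
      then show "restrict_to_line F v v' \<noteq> 0 \<and> order 0 (restrict_to_line F v v')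
          = (if Q = vec.span {u} then 2 else 0) + (if Q = vec.span {w} then 2 else 0)"
        unfolding r using nz uw(3) a(5,6) by (simp add: order_smult del: power_mult_distrib)
    qed
    then show ?thesis unfolding bitangents_def using L uwL pp by blast
  next
    assume F: "\<forall>x y. eval F (x *s u + y *s w) = c * y ^ 4"
    have "meets_with_mult F L Q ((if Q = vec.span {u} then 2 else 0) + (if Q = vec.span {u} then 2 else 0))"
      if Q: "Q \<in> proj_points" "Q \<subseteq> L" for Q
      unfolding meets_with_mult_def
    proof (intro ballI, rule local[OF Q])
      fix v v' x y x' y' assume a: "v = x *s u + y *s w" "v' = x' *s u + y' *s w"
        "[:x, x':] \<noteq> 0" "[:y, y':] \<noteq> 0" "Q = vec.span {u} \<longleftrightarrow> y = 0" "Q = vec.span {w} \<longleftrightarrow> x = 0"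
      have r: "restrict_to_line F v v' = smult c ([:y, y':] ^ 4)"
        unfolding a(1,2) by (rule restrict_to_lineI) (unfold comb F[rule_format], simp only: poly_smult poly_mult poly_power)
      have "order 0 ([:y, y':] ^ 4) = 4 * (if y = 0 then 1 else 0)"
        using a(4) by (simp only: order_power_mult order_0_linear not_False_eq_True)
      then show "restrict_to_line F v v' \<noteq> 0 \<and> order 0 (restrict_to_line F v v')
          = (if Q = vec.span {u} then 2 else 0) + (if Q = vec.span {u} then 2 else 0)"
        unfolding r using uw(3) a(4,5) by (simp add: order_smult)
    qed
    then show ?thesis unfolding bitangents_def using L uwL pp by blast
  qed
qed

lemma bitangents_eq: "homogeneous 4 F \<Longrightarrow> bitangents F = {L. bitangent (eval F) L}"
  using bitangents_imp bitangents_if by blast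

lemma quadruple_points_eq:
  assumes "smooth_quartic F" shows "quadruple_points (bitangents F) = centers (eval F)"
proof -
  have F: "homogeneous 4 F" "smooth_form (eval F)" using assms by (simp_all add: smooth_quartic_iff)
  have at: "{L \<in> bitangents F. vec.span {p} \<subseteq> L} = bitangents_at (eval F) p" for p
    unfolding bitangents_eq[OF F(1)] bitangents_at_def
    using bitangent_line[of "eval F"] span1_subset_iff by blast
  have "P \<in> quadruple_points (bitangents F) \<longleftrightarrow> (\<exists>p. p \<noteq> 0 \<and> P = vec.span {p} \<and> card (bitangents_at (eval F) p) = 4)" for P
    unfolding quadruple_points_def proj_points_iff using at by auto
  moreover have "(p \<noteq> 0 \<and> card (bitangents_at (eval F) p) = 4) \<longleftrightarrow> (\<exists>a. is_center (eval F) p a)" for p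
    using four_bitangents_center[OF F(2)] center_bitangents_at[OF F(2)] is_center_nonzero by metis
  ultimately show ?thesis unfolding centers_def by blast
qed

section \<open>Involutions and centers\<close>

lemma curve_iff:
  assumes "homogeneous 4 F"
  shows "P \<in> curve F \<longleftrightarrow> (\<exists>v. v \<noteq> 0 \<and> eval F v = 0 \<and> P = vec.span {v})"
proof -
  have "(\<forall>u\<in>vec.span {v}. eval F u = 0) \<longleftrightarrow> eval F v = 0" for v
    using form_homogeneous[OF homogeneous_form[OF assms]] vec.span_base[of v "{v}"]
    by (auto simp: mem_span1)
  then show ?thesis by (auto simp: curve_def proj_points_iff)
qed

lemma reflection_image: "reflection p a ` vec.span {v} = vec.span {reflection p a v}"
proof -
  show ?thesis by (simp add: vec.span_singleton image_image reflection_simps(2))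
qed

lemma linear_map_forms:
  "\<exists>G. (\<forall>i. homogeneous 1 (G i)) \<and> (\<forall>v. apply_forms G v = (\<chi> i. cdot (r i) v))"
proof -
  define G where "G i = const (r i $ 1) * X 1 + (const (r i $ 2) * X 2 + const (r i $ 3) * X 3)" for i
  have "homogeneous 1 (const c * X j)" for c j
    using homogeneous_mult[OF homogeneous_const homogeneous_X] by simp
  then have "homogeneous 1 (G i)" for i unfolding G_def by (intro homogeneous_add)
  moreover have "apply_forms G v = (\<chi> i. cdot (r i) v)" for v
    by (simp add: apply_forms_def G_def cdot_def vec_eq_iff add.assoc)
  ultimately show ?thesis by blast
qed

definition reflection_map :: "tpoly \<Rightarrow> c3 \<Rightarrow> c3 \<Rightarrow> c3 set \<Rightarrow> c3 set" where
  "reflection_map F p a = (\<lambda>Q\<in>curve F. reflection p a ` Q)"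

lemma reflection_map_span:
  assumes "homogeneous 4 F" "v \<noteq> 0" "eval F v = 0"
  shows "reflection_map F p a (vec.span {v}) = vec.span {reflection p a v}"
  using assms by (auto simp: reflection_map_def curve_iff reflection_image)

lemma reflection_nonzero: "cdot a p = 1 \<Longrightarrow> v \<noteq> 0 \<Longrightarrow> reflection p a v \<noteq> 0"
  using reflection_simps(3)[of a p v] reflection_simps(2)[of p a 0 0] by auto

lemma reflection_map_regular:
  assumes F: "homogeneous 4 F" and c: "is_center (eval F) p a"
    and h: "\<And>Q. Q \<in> curve F \<Longrightarrow> h Q = reflection p a ` Q"
  shows "regular_self_map F h"
proof -
  have ap: "cdot a p = 1" using c by (simp add: is_center_def)
  obtain G where G: "\<And>i. homogeneous 1 (G i)"
    "\<And>v. apply_forms G v = (\<chi> i. cdot (axis i 1 - (2 * p $ i) *s a) v)"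
    using linear_map_forms[of "\<lambda>i. axis i 1 - (2 * p $ i) *s a"] by blast
  have Gr: "apply_forms G v = reflection p a v" for v
    by (simp add: G(2) reflection_def vec_eq_iff)
  have span: "h (vec.span {v}) = vec.span {reflection p a v}" if "v \<noteq> 0" "eval F v = 0" for v
    using h[of "vec.span {v}"] that by (auto simp: curve_iff[OF F] reflection_image)
  have "h \<in> curve F \<rightarrow> curve F"
  proof
    fix Q assume "Q \<in> curve F"
    then obtain v where v: "v \<noteq> 0" "eval F v = 0" "Q = vec.span {v}" by (auto simp: curve_iff[OF F])
    then show "h Q \<in> curve F" using span[OF v(1,2)] c reflection_nonzero[OF ap v(1)]
      by (auto simp: curve_iff[OF F] is_center_def)
  qed
  moreover have "\<exists>d G. (\<forall>i. homogeneous d (G i)) \<and> (\<exists>v\<in>P - {0}. apply_forms G v \<noteq> 0) \<and>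
        (\<forall>Q\<in>curve F. \<forall>v\<in>Q - {0}. apply_forms G v \<noteq> 0 \<longrightarrow> h Q = vec.span {apply_forms G v})"
    if P: "P \<in> curve F" for P
  proof -
    obtain v where v: "v \<noteq> 0" "P = vec.span {v}" using P by (auto simp: curve_iff[OF F])
    then have "v \<in> P - {0}" "apply_forms G v \<noteq> 0"
      using vec.span_base[of v "{v}"] reflection_nonzero[OF ap v(1)] by (auto simp: Gr)
    moreover have "h Q = vec.span {apply_forms G u}" if Q: "Q \<in> curve F" "u \<in> Q - {0}" for Q u
    proof -
      obtain w where w: "w \<noteq> 0" "eval F w = 0" "Q = vec.span {w}" using Q(1) by (auto simp: curve_iff[OF F])
      then have "Q = vec.span {u}" using Q(2) span1_eq[of u w] by auto
      moreover have "eval F u = 0" using Q by (auto simp: curve_def)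
      ultimately show ?thesis using span[of u] Q(2) by (simp add: Gr)
    qed
    ultimately show ?thesis using G(1) by blast
  qed
  ultimately show ?thesis unfolding regular_self_map_def by blast
qed

lemma reflection_map_involution:
  assumes sm: "smooth_quartic F" and c: "is_center (eval F) p a"
  shows "reflection_map F p a \<in> involutions F"
proof -
  have F: "homogeneous 4 F" "smooth_form (eval F)" using sm by (simp_all add: smooth_quartic_iff)
  have ap: "cdot a p = 1" and inv: "\<And>v. eval F (reflection p a v) = eval F v" using c by (auto simp: is_center_def)
  define h where "h = reflection_map F p a"
  have hQ: "h Q = reflection p a ` Q" if "Q \<in> curve F" for Q using that by (simp add: h_def reflection_map_def)
  have maps: "h Q \<in> curve F" if "Q \<in> curve F" for Q
    using reflection_map_regular[OF F(1) c hQ] that by (auto simp: regular_self_map_def)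
  have hh: "h (h Q) = Q" if "Q \<in> curve F" for Q
    using maps[OF that] hQ[OF that] by (simp add: hQ image_image reflection_simps(3)[OF ap])
  have bij: "bij_betw h (curve F) (curve F)"
    by (rule bij_betwI[where g = h]) (use maps hh in auto)
  have "inv_into (curve F) h Q = reflection p a ` Q" if "Q \<in> curve F" for Q
    using inv_into_f_eq[of h "curve F" "h Q" Q] bij maps[OF that] hh[OF that] hQ[OF that]
    by (simp add: bij_betw_def)
  then have "h \<in> automorphisms F"
    unfolding automorphisms_def
    using bij reflection_map_regular[OF F(1) c hQ] reflection_map_regular[OF F(1) c]
    by (auto simp: h_def reflection_map_def)
  moreover have "compose (curve F) h h = (\<lambda>P\<in>curve F. P)"
    by (rule ext) (simp add: compose_def hh)
  moreover have "h \<noteq> (\<lambda>P\<in>curve F. P)"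
  proof
    assume id: "h = (\<lambda>P\<in>curve F. P)"
    \<comment> \<open>Acting trivially on the curve would make the reflection a scalar map.\<close>
    have "\<exists>k. reflection p a v = k *s v" if v: "v \<noteq> 0" "eval F v = 0" for v
    proof -
      have "vec.span {v} \<in> curve F" using v by (auto simp: curve_iff[OF F(1)])
      then have "vec.span {reflection p a v} = vec.span {v}"
        using hQ[of "vec.span {v}"] id by (simp add: reflection_image)
      then show ?thesis by (rule span1_eqD)
    qed
    then obtain k where "\<And>v. reflection p a v = k *s v"
      using curve_eigenvectors[OF F(2), of "reflection p a"] reflection_simps(1,2) by metis
    then show False using reflection_not_scalar[OF ap] by blast
  qed
  ultimately show ?thesis by (simp add: involutions_def h_def)
qed

text \<open>The local forms are multiplied by a linear form with value 1 at \<open>v\<close>: this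
  makes the degree positive, as \<open>rep\<close> demands, and keeps the value at \<open>v\<close>
  nonzero.\<close>

lemma regular_self_map_rep:
  assumes F: "homogeneous 4 F" and reg: "regular_self_map F f" and v: "v \<noteq> 0" "eval F v = 0"
  shows "\<exists>d G. rep (eval F) f d G \<and> G v \<noteq> 0"
proof -
  have P: "vec.span {v} \<in> curve F" using v by (auto simp: curve_iff[OF F])
  obtain d H u where H: "\<And>i. homogeneous d (H i)" "u \<in> vec.span {v} - {0}" "apply_forms H u \<noteq> 0"
    "\<And>Q w. Q \<in> curve F \<Longrightarrow> w \<in> Q - {0} \<Longrightarrow> apply_forms H w \<noteq> 0 \<Longrightarrow> f Q = vec.span {apply_forms H w}"
    using reg P unfolding regular_self_map_def by metis
  obtain c where c: "u = c *s v" using H(2) by (auto simp: mem_span1)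
  obtain e where e: "cdot e v = 1" using nonzero_cdot[OF v(1)] cdot_commute by metis
  define G where "G w = cdot e w *s apply_forms H w" for w
  have "apply_forms H (c *s v) = c ^ d *s apply_forms H v"
    using form_homogeneous[OF homogeneous_form[OF H(1)]] by (simp add: apply_forms_def vec_eq_iff)
  then have "apply_forms H v \<noteq> 0" using H(3) c by auto
  then have "G v \<noteq> 0" using e by (simp add: G_def)
  moreover have "vform (Suc d) G"
    unfolding vform_def using form_cdot[OF homogeneous_form[OF H(1)], of e]
    by (simp add: G_def apply_forms_def)
  moreover have "eval F (G w) = 0 \<and> f (vec.span {w}) = vec.span {G w}"
    if w: "w \<noteq> 0" "eval F w = 0" "G w \<noteq> 0" for w
  proof -
    have Q: "vec.span {w} \<in> curve F" using w by (auto simp: curve_iff[OF F])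
    have "w \<in> vec.span {w} - {0}" using w(1) vec.span_base[of w "{w}"] by simp
    moreover have "apply_forms H w \<noteq> 0" using w(3) by (auto simp: G_def)
    ultimately have "f (vec.span {w}) = vec.span {apply_forms H w}" using H(4)[OF Q] by blast
    moreover have "vec.span {G w} = vec.span {apply_forms H w}"
      using w(3) by (intro span1_eq) (auto simp: G_def mem_span1)
    ultimately have fw: "f (vec.span {w}) = vec.span {G w}" by simp
    have "f (vec.span {w}) \<in> curve F" using reg Q by (auto simp: regular_self_map_def)
    then have "\<forall>x\<in>vec.span {G w}. eval F x = 0" unfolding fw by (simp add: curve_def)
    then show ?thesis using fw vec.span_base[of "G w" "{G w}"] by blast
  qed
  ultimately show ?thesis unfolding rep_def by (intro exI[of _ "Suc d"] exI[of _ G]) auto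
qed

lemma involution_is_reflection_map:
  assumes sm: "smooth_quartic F" and f: "f \<in> involutions F"
  obtains p a where "is_center (eval F) p a" "f = reflection_map F p a"
proof -
  have F: "homogeneous 4 F" "smooth_form (eval F)" using sm by (simp_all add: smooth_quartic_iff)
  have ext: "f \<in> extensional (curve F)" and reg: "regular_self_map F f"
    and id: "f \<noteq> (\<lambda>P\<in>curve F. P)" and ff: "compose (curve F) f f = (\<lambda>P\<in>curve F. P)"
    using f by (auto simp: involutions_def automorphisms_def)
  have ff: "f (f P) = P" if "P \<in> curve F" for P
    using fun_cong[OF ff, of P] that by (simp add: compose_def)
  have inv: "f (f (vec.span {u})) = vec.span {u}" if "u \<noteq> 0" "eval F u = 0" for u
    by (rule ff) (use that in \<open>auto simp: curve_iff[OF F(1)]\<close>)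
  obtain m :: "3 \<Rightarrow> c3" where m: "\<And>v. v \<noteq> 0 \<Longrightarrow> eval F v = 0 \<Longrightarrow>
    (\<chi> i. cdot (m i) v) \<noteq> 0 \<and> eval F (\<chi> i. cdot (m i) v) = 0 \<and> f (vec.span {v}) = vec.span {\<chi> i. cdot (m i) v}"
    using regular_involution_linear[OF F(2) regular_self_map_rep[OF F(1) reg] inv] by metis
  have "\<exists>P\<in>curve F. f P \<noteq> P"
  proof (rule ccontr)
    assume "\<not> ?thesis"
    then have "f = (\<lambda>P\<in>curve F. P)" using ext by (intro extensionalityI[of _ "curve F"]) auto
    then show False using id by simp
  qed
  then obtain P0 where "P0 \<in> curve F" "f P0 \<noteq> P0" by blast
  then obtain v0 where v0: "v0 \<noteq> 0" "eval F v0 = 0" "f (vec.span {v0}) \<noteq> vec.span {v0}"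
    unfolding curve_iff[OF F(1)] by blast
  obtain p a where pa: "is_center (eval F) p a"
    "\<And>v. v \<noteq> 0 \<Longrightarrow> eval F v = 0 \<Longrightarrow> f (vec.span {v}) = vec.span {reflection p a v}"
    using linear_involution_center[OF F(2) m inv v0] by metis
  have "f = reflection_map F p a"
  proof (rule extensionalityI[OF ext])
    show "reflection_map F p a \<in> extensional (curve F)" by (simp add: reflection_map_def)
    fix P assume "P \<in> curve F"
    then obtain v where "v \<noteq> 0" "eval F v = 0" "P = vec.span {v}" by (auto simp: curve_iff[OF F(1)])
    then show "f P = reflection_map F p a P" using pa(2) reflection_map_span[OF F(1)] by simp
  qed
  with pa(1) show ?thesis by (rule that)
qed

lemma bij_betw_centers_involutions:
  assumes sm: "smooth_quartic F"
  shows "\<exists>g. bij_betw g (centers (eval F)) (involutions F)"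
proof -
  have F: "homogeneous 4 F" "smooth_form (eval F)" using sm by (simp_all add: smooth_quartic_iff)
  have "\<exists>p a. P = vec.span {p} \<and> is_center (eval F) p a" if "P \<in> centers (eval F)" for P
    using that by (auto simp: centers_def)
  then obtain p a where pa: "\<And>P. P \<in> centers (eval F) \<Longrightarrow> P = vec.span {p P} \<and> is_center (eval F) (p P) (a P)"
    by metis
  define g where "g P = reflection_map F (p P) (a P)" for P
  have "inj_on g (centers (eval F))"
  proof (rule inj_onI)
    fix P Q assume P: "P \<in> centers (eval F)" and Q: "Q \<in> centers (eval F)" and eq: "g P = g Q"
    have "vec.span {reflection (p P) (a P) v} = vec.span {reflection (p Q) (a Q) v}" if "v \<noteq> 0" "eval F v = 0" for v
      using reflection_map_span[OF F(1) that] eq unfolding g_def by metis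
    then show "P = Q" using span_eqI_reflection[OF F(2)] pa[OF P] pa[OF Q] by metis
  qed
  moreover have "g ` centers (eval F) = involutions F"
  proof (intro equalityI subsetI)
    fix f assume "f \<in> involutions F"
    then obtain q b where q: "is_center (eval F) q b" "f = reflection_map F q b"
      by (rule involution_is_reflection_map[OF sm])
    define P where "P = vec.span {q}"
    have P: "P \<in> centers (eval F)" using q(1) by (auto simp: centers_def P_def)
    \<comment> \<open>The representatives chosen for the point may differ from \<open>q\<close> and
      \<open>b\<close>, but the reflection depends only on the point.\<close>
    have "reflection (p P) (a P) = reflection q b"
      using reflection_eqI[OF F(2) _ q(1)] pa[OF P] by (metis P_def)
    then have "f = g P" by (simp add: q(2) g_def reflection_map_def)
    then show "f \<in> g ` centers (eval F)" using P by blast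
  qed (use pa reflection_map_involution[OF sm] in \<open>auto simp: g_def\<close>)
  ultimately show ?thesis unfolding bij_betw_def by blast
qed

section \<open>The Klein quartic\<close>

lemma klein_quartic_eval:
  "eval (klein_quartic l) v = v $ 1 ^ 4 + v $ 2 ^ 4 + v $ 3 ^ 4 +
     l * ((v $ 1)\<^sup>2 * (v $ 2)\<^sup>2 + (v $ 1)\<^sup>2 * (v $ 3)\<^sup>2 + (v $ 2)\<^sup>2 * (v $ 3)\<^sup>2)"
  by (simp add: klein_quartic_def)

lemma klein_quartic_homogeneous: "homogeneous 4 (klein_quartic l)"
proof -
  have "homogeneous 4 (X i ^ 4)" "homogeneous 2 (X i ^ 2)" for i
    using homogeneous_power[OF homogeneous_X, of 4 i] homogeneous_power[OF homogeneous_X, of 2 i] by simp_all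
  moreover from this have "homogeneous 4 (X i ^ 2 * X j ^ 2)" for i j
    using homogeneous_mult[of 2 "X i ^ 2" 2 "X j ^ 2"] by simp
  then have "homogeneous 4 (X 1 ^ 2 * X 2 ^ 2 + X 1 ^ 2 * X 3 ^ 2 + X 2 ^ 2 * X 3 ^ 2)"
    by (intro homogeneous_add)
  from homogeneous_mult[OF homogeneous_const[of l] this]
  have "homogeneous 4 (const l * (X 1 ^ 2 * X 2 ^ 2 + X 1 ^ 2 * X 3 ^ 2 + X 2 ^ 2 * X 3 ^ 2))" by simp
  ultimately show ?thesis unfolding klein_quartic_def by (intro homogeneous_add)
qed

text \<open>The partial derivatives are
  \<open>2 * x * (2 * x\<^sup>2 + l * (y\<^sup>2 + z\<^sup>2))\<close> and its permutations. The
  linear systems for the squares of the nonzero coordinates can degenerate only for \<open>l\<close>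
  equal to 2, -2 or -1, none of which satisfies the equation for \<open>l\<close>.\<close>

lemma klein_quartic_smooth:
  assumes l: "l\<^sup>2 + 3 * l + 18 = 0" shows "smooth_quartic (klein_quartic l)"
proof -
  let ?F = "eval (klein_quartic l)"
  note hom = homogeneous_form[OF klein_quartic_homogeneous]
  have gw: "cdot (grad ?F v) w = 4 * (v $ 1) ^ 3 * w $ 1 + 4 * (v $ 2) ^ 3 * w $ 2 + 4 * (v $ 3) ^ 3 * w $ 3
      + l * (2 * v $ 1 * w $ 1 * (v $ 2)\<^sup>2 + (v $ 1)\<^sup>2 * (2 * v $ 2 * w $ 2)
        + (2 * v $ 1 * w $ 1 * (v $ 3)\<^sup>2 + (v $ 1)\<^sup>2 * (2 * v $ 3 * w $ 3))
        + (2 * v $ 2 * w $ 2 * (v $ 3)\<^sup>2 + (v $ 2)\<^sup>2 * (2 * v $ 3 * w $ 3)))" for v w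
  proof (rule cdot_gradI[OF form_polyfun[OF hom]], goal_cases)
    case 1
    show ?case unfolding klein_quartic_eval vector_add_component vector_smult_component
      by (rule derivative_eq_intros refl | simp)+
  qed
  have g: "grad ?F v $ 1 = 2 * v $ 1 * (2 * (v $ 1)\<^sup>2 + l * ((v $ 2)\<^sup>2 + (v $ 3)\<^sup>2))"
    "grad ?F v $ 2 = 2 * v $ 2 * (2 * (v $ 2)\<^sup>2 + l * ((v $ 1)\<^sup>2 + (v $ 3)\<^sup>2))"
    "grad ?F v $ 3 = 2 * v $ 3 * (2 * (v $ 3)\<^sup>2 + l * ((v $ 1)\<^sup>2 + (v $ 2)\<^sup>2))" for v
    using gw[of v "axis 1 1", unfolded cdot_axis] gw[of v "axis 2 1", unfolded cdot_axis]
      gw[of v "axis 3 1", unfolded cdot_axis]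
    by (simp_all add: axis_def power2_eq_square power3_eq_cube algebra_simps)
  have l2: "l - 2 \<noteq> 0" "l + 2 \<noteq> 0" "l + 1 \<noteq> 0"
  proof -
    have "l \<noteq> 2" "l \<noteq> - 2" "l \<noteq> - 1" using l by auto
    then show "l - 2 \<noteq> 0" "l + 2 \<noteq> 0" "l + 1 \<noteq> 0" by (auto simp: add_eq_0_iff2)
  qed
  have "v = 0" if "grad ?F v = 0" for v
  proof -
    define x y z where "x = v $ 1" and "y = v $ 2" and "z = v $ 3"
    have e: "x * (2 * x\<^sup>2 + l * (y\<^sup>2 + z\<^sup>2)) = 0" "y * (2 * y\<^sup>2 + l * (x\<^sup>2 + z\<^sup>2)) = 0"
      "z * (2 * z\<^sup>2 + l * (x\<^sup>2 + y\<^sup>2)) = 0"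
      using g[of v] that by (simp_all add: x_def y_def z_def)
    have two: "a = 0 \<or> b = 0" if ab: "2 * a\<^sup>2 + l * b\<^sup>2 = 0" "2 * b\<^sup>2 + l * a\<^sup>2 = 0" for a b
    proof -
      have "(l - 2) * (l + 2) * a\<^sup>2 = 0" using ab by algebra
      then show ?thesis using l2 by simp
    qed
    have three: "a = 0 \<or> b = 0 \<or> c = 0"
      if abc: "2 * a\<^sup>2 + l * (b\<^sup>2 + c\<^sup>2) = 0" "2 * b\<^sup>2 + l * (a\<^sup>2 + c\<^sup>2) = 0" "2 * c\<^sup>2 + l * (a\<^sup>2 + b\<^sup>2) = 0" for a b c
    proof -
      have "(l - 2) * (a\<^sup>2 - b\<^sup>2) = 0" "(l - 2) * (a\<^sup>2 - c\<^sup>2) = 0" using abc by algebra+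
      then have "a\<^sup>2 = b\<^sup>2" "a\<^sup>2 = c\<^sup>2" using l2 by simp_all
      then have "(l + 1) * a\<^sup>2 = 0" using abc(1) by algebra
      then have "a\<^sup>2 = 0" using l2(3) by (metis mult_eq_0_iff)
      then show ?thesis by simp
    qed
    have "x = 0 \<or> y = 0 \<or> z = 0" using three[of x y z] e by auto
    then have "x = 0 \<and> y = 0 \<and> z = 0"
      using two[of y z] two[of x z] two[of x y] e by (auto simp: add.commute)
    then show ?thesis by (simp add: vec_eq_iff forall_3 x_def y_def z_def)
  qed
  then show ?thesis using hom klein_quartic_homogeneous by (auto simp: smooth_quartic_iff smooth_form_def)
qed

text \<open>Compares the values at \<open>m - h o\<close> and \<open>m + h o\<close> for \<open>m = (x, y, z)\<close> and \<open>o = (1, 1, \<alpha>)\<close>: only the terms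
  odd in \<open>h\<close> differ, and they vanish when \<open>m\<close> lies on the mirror \<open>x + y = (1 + \<alpha>) z\<close>.\<close>

lemma klein_odd_part:
  fixes x y z h \<alpha> :: complex
  shows "(x - h) ^ 4 + (y - h) ^ 4 + (z - \<alpha> * h) ^ 4 + 3 * \<alpha> * ((x - h)\<^sup>2 * (y - h)\<^sup>2
      + (x - h)\<^sup>2 * (z - \<alpha> * h)\<^sup>2 + (y - h)\<^sup>2 * (z - \<alpha> * h)\<^sup>2)
    = (x + h) ^ 4 + (y + h) ^ 4 + (z + \<alpha> * h) ^ 4 + 3 * \<alpha> * ((x + h)\<^sup>2 * (y + h)\<^sup>2
      + (x + h)\<^sup>2 * (z + \<alpha> * h)\<^sup>2 + (y + h)\<^sup>2 * (z + \<alpha> * h)\<^sup>2)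
      - 2 * h * (4 * x ^ 3 + 4 * y ^ 3 + 4 * \<alpha> * z ^ 3
        + 6 * \<alpha> * (x * (y\<^sup>2 + z\<^sup>2) + y * (x\<^sup>2 + z\<^sup>2) + \<alpha> * z * (x\<^sup>2 + y\<^sup>2)))
      - 2 * h ^ 3 * (4 * x + 4 * y + 4 * \<alpha> ^ 3 * z
        + 6 * \<alpha> * (x * (1 + \<alpha>\<^sup>2) + y * (1 + \<alpha>\<^sup>2) + 2 * \<alpha> * z))"
  by algebra

text \<open>Here \<alpha> is a third of the parameter of the quartic. The reflection with root
  \<open>(1, 1, \<alpha>)\<close> exchanges \<open>m + h o\<close> and \<open>m - h o\<close>, where
  \<open>m = (X, Y, Z)\<close> is the midpoint of a point and its image. As \<open>m\<close> is on
  the mirror, the odd coefficients of \<open>klein_odd_part\<close> vanish modulo the equation for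
  \<alpha>.\<close>

lemma klein_reflection_identity:
  fixes x y z s \<alpha> :: complex
  assumes "\<alpha>\<^sup>2 + \<alpha> + 2 = 0" "2 * s = x + y - (1 + \<alpha>) * z"
  shows "(x - s) ^ 4 + (y - s) ^ 4 + (z - \<alpha> * s) ^ 4 + 3 * \<alpha> * ((x - s)\<^sup>2 * (y - s)\<^sup>2
      + (x - s)\<^sup>2 * (z - \<alpha> * s)\<^sup>2 + (y - s)\<^sup>2 * (z - \<alpha> * s)\<^sup>2)
    = x ^ 4 + y ^ 4 + z ^ 4 + 3 * \<alpha> * (x\<^sup>2 * y\<^sup>2 + x\<^sup>2 * z\<^sup>2 + y\<^sup>2 * z\<^sup>2)"
proof -
  define h X Y Z where "h = s / 2" and "X = x - h" and "Y = y - h" and "Z = z - \<alpha> * h"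
  have s: "s = 2 * h" and xyz: "x = X + h" "y = Y + h" "z = Z + \<alpha> * h"
    by (simp_all add: h_def X_def Y_def Z_def)
  have X: "X = (1 + \<alpha>) * Z - Y" using assms unfolding s xyz by algebra
  have c1: "4 * X ^ 3 + 4 * Y ^ 3 + 4 * \<alpha> * Z ^ 3
      + 6 * \<alpha> * (X * (Y\<^sup>2 + Z\<^sup>2) + Y * (X\<^sup>2 + Z\<^sup>2) + \<alpha> * Z * (X\<^sup>2 + Y\<^sup>2)) = 0"
    unfolding X using assms(1) by algebra
  have c2: "4 * X + 4 * Y + 4 * \<alpha> ^ 3 * Z
      + 6 * \<alpha> * (X * (1 + \<alpha>\<^sup>2) + Y * (1 + \<alpha>\<^sup>2) + 2 * \<alpha> * Z) = 0"
    unfolding X using assms(1) by algebra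
  have m: "X + h - 2 * h = X - h" "Y + h - 2 * h = Y - h" "Z + \<alpha> * h - \<alpha> * (2 * h) = Z - \<alpha> * h"
    by (simp_all add: algebra_simps)
  show ?thesis unfolding s xyz m klein_odd_part c1 c2 by simp
qed


section \<open>The 21 reflections of the Klein quartic\<close>

definition vec3 :: "complex \<times> complex \<times> complex \<Rightarrow> c3" where
  "vec3 = (\<lambda>(x, y, z). vector [x, y, z])"

lemma vec3_nth [simp]: "vec3 (x, y, z) $ 1 = x" "vec3 (x, y, z) $ 2 = y" "vec3 (x, y, z) $ 3 = z"
  by (simp_all add: vec3_def)

definition klein_form :: "complex \<Rightarrow> complex \<Rightarrow> complex \<Rightarrow> complex \<Rightarrow> complex" where
  "klein_form l x y z = x ^ 4 + y ^ 4 + z ^ 4 + l * (x\<^sup>2 * y\<^sup>2 + x\<^sup>2 * z\<^sup>2 + y\<^sup>2 * z\<^sup>2)"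

lemma klein_form_sign:
  assumes "c\<^sup>2 = 1" "e\<^sup>2 = 1" "d\<^sup>2 = 1"
  shows "klein_form l (c * x) (e * y) (d * z) = klein_form l x y z"
proof -
  have "c ^ 4 = (c\<^sup>2)\<^sup>2" "e ^ 4 = (e\<^sup>2)\<^sup>2" "d ^ 4 = (d\<^sup>2)\<^sup>2" by simp_all
  then show ?thesis using assms by (simp add: klein_form_def power_mult_distrib)
qed

lemma klein_form_swap: "klein_form l x y z = klein_form l x z y" "klein_form l x y z = klein_form l y x z"
  "klein_form l x y z = klein_form l z y x"
  by (simp_all add: klein_form_def algebra_simps)

lemma klein_is_centerI:
  assumes "a * p + b * q + c * r = 1"
    and "\<And>x y z s. s = 2 * (a * x + b * y + c * z) \<Longrightarrow>
      klein_form l (x - s * p) (y - s * q) (z - s * r) = klein_form l x y z"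
  shows "is_center (eval (klein_quartic l)) (vec3 (p, q, r)) (vec3 (a, b, c))"
proof -
  have F: "eval (klein_quartic l) v = klein_form l (v $ 1) (v $ 2) (v $ 3)" for v
    by (simp add: klein_quartic_eval klein_form_def)
  have "eval (klein_quartic l) (reflection (vec3 (p, q, r)) (vec3 (a, b, c)) v) = eval (klein_quartic l) v" for v
  proof -
    define s where "s = 2 * (a * v $ 1 + b * v $ 2 + c * v $ 3)"
    have "reflection (vec3 (p, q, r)) (vec3 (a, b, c)) v = v - s *s vec3 (p, q, r)"
      by (simp add: reflection_def s_def cdot_def)
    then show ?thesis unfolding F using assms(2)[OF s_def] by simp
  qed
  then show ?thesis using assms(1) by (simp add: is_center_def cdot_def)
qed

text \<open>These are the roots of the complex reflection group of order 336, whose projective image is the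
  automorphism group of the curve.\<close>

abbreviation klein_center :: "complex \<Rightarrow> complex \<times> complex \<times> complex \<Rightarrow> bool" where
  "klein_center \<alpha> t \<equiv> vec.span {vec3 t} \<in> centers (eval (klein_quartic (3 * \<alpha>)))"

lemma klein_centers:
  assumes \<alpha>: "\<alpha>\<^sup>2 + \<alpha> + 2 = 0" and \<gamma>: "\<alpha> * \<gamma> = 1" and e: "e\<^sup>2 = 1" and d: "d\<^sup>2 = 1"
  shows "klein_center \<alpha> (1, 0, 0)"
    "klein_center \<alpha> (0, 1, 0)"
    "klein_center \<alpha> (0, 0, 1)"
    "klein_center \<alpha> (0, 1, e)"
    "klein_center \<alpha> (1, 0, e)"
    "klein_center \<alpha> (1, e, 0)"
    "klein_center \<alpha> (1, e, d * \<alpha>)"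
    "klein_center \<alpha> (1, d * \<alpha>, e)"
    "klein_center \<alpha> (1, e * \<gamma>, d * \<gamma>)"
proof -
  let ?G = "klein_form (3 * \<alpha>)"
  have cI: "klein_center \<alpha> (p, q, r)"
    if "a * p + b * q + c * r = 1"
      "\<And>x y z s. s = 2 * (a * x + b * y + c * z) \<Longrightarrow> ?G (x - s * p) (y - s * q) (z - s * r) = ?G x y z"
    for p q r a b c
    using klein_is_centerI[OF that] by (auto simp: centers_def)
  have core: "?G (x - s) (y - s) (z - \<alpha> * s) = ?G x y z" if "2 * s = x + y - (1 + \<alpha>) * z" for x y z s
    unfolding klein_form_def by (rule klein_reflection_identity[OF \<alpha> that])
  have core2: "?G (x - s) (y - \<alpha> * s) (z - s) = ?G x y z" if "2 * s = x + z - (1 + \<alpha>) * y" for x y z s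
    using core[OF that] klein_form_swap(1)[of _ "x - s" "y - \<alpha> * s" "z - s"] klein_form_swap(1)[of _ x y z]
    by simp
  have core3: "?G (x - \<alpha> * s) (y - s) (z - s) = ?G x y z" if "2 * s = z + y - (1 + \<alpha>) * x" for x y z s
    using core[OF that] klein_form_swap(3)[of _ "x - \<alpha> * s" "y - s" "z - s"] klein_form_swap(3)[of _ x y z]
    by simp
  have sg: "?G (c1 * x) (c2 * y) (c3 * z) = ?G x y z"
    if "c1\<^sup>2 = 1" "c2\<^sup>2 = 1" "c3\<^sup>2 = 1" for c1 c2 c3 x y z
    using klein_form_sign[OF that] .
  have me: "(- e)\<^sup>2 = 1" "(1::complex)\<^sup>2 = 1" "(- 1 :: complex)\<^sup>2 = 1" using e by simp_all
  have ee: "e * e = 1" "d * d = 1" "e * (e * x) = x" "d * (d * x) = x" for x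
    using e d by (simp_all add: power2_eq_square flip: mult.assoc)
  show "klein_center \<alpha> (1, 0, 0)"
    using sg[of "- 1" 1 1] by (intro cI[of 1 _ 0 _ 0]) simp_all
  show "klein_center \<alpha> (0, 1, 0)"
    using sg[of 1 "- 1" 1] by (intro cI[of 0 _ 1 _ 0]) simp_all
  show "klein_center \<alpha> (0, 0, 1)"
    using sg[of 1 1 "- 1"] by (intro cI[of 0 _ 0 _ 1]) simp_all
  show "klein_center \<alpha> (0, 1, e)"
  proof (rule cI[of 0 _ "1/2" _ "e/2"])
    fix x y z s assume "s = 2 * (0 * x + 1/2 * y + e/2 * z)"
    then have "y - s * 1 = (- e) * z" "z - s * e = (- e) * y" "x - s * 0 = 1 * x"
      by (simp_all add: algebra_simps ee)
    then show "?G (x - s * 0) (y - s * 1) (z - s * e) = ?G x y z"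
      using sg[OF me(2,1,1), of x z y] klein_form_swap(1)[of _ x z y] by simp
  qed (simp add: ee)
  show "klein_center \<alpha> (1, 0, e)"
  proof (rule cI[of "1/2" _ 0 _ "e/2"])
    fix x y z s assume "s = 2 * (1/2 * x + 0 * y + e/2 * z)"
    then have "x - s * 1 = (- e) * z" "z - s * e = (- e) * x" "y - s * 0 = 1 * y"
      by (simp_all add: algebra_simps ee)
    then show "?G (x - s * 1) (y - s * 0) (z - s * e) = ?G x y z"
      using sg[OF me(1,2,1), of z y x] klein_form_swap(3)[of _ z y x] by simp
  qed (simp add: ee)
  show "klein_center \<alpha> (1, e, 0)"
  proof (rule cI[of "1/2" _ "e/2" _ 0])
    fix x y z s assume "s = 2 * (1/2 * x + e/2 * y + 0 * z)"
    then have "x - s * 1 = (- e) * y" "y - s * e = (- e) * x" "z - s * 0 = 1 * z"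
      by (simp_all add: algebra_simps ee)
    then show "?G (x - s * 1) (y - s * e) (z - s * 0) = ?G x y z"
      using sg[OF me(1,1,2), of y x z] klein_form_swap(2)[of _ y x z] by simp
  qed (simp add: ee)
  have aa: "\<alpha> * \<alpha> = - \<alpha> - 2" using \<alpha> by (simp add: power2_eq_square) algebra
  show "klein_center \<alpha> (1, e, d * \<alpha>)"
  \<comment> \<open>A unitary reflection: the covector is the conjugate root divided by its squared
    length 4. The two solutions for \<alpha> are conjugate with sum -1 and product 2, so
    \<open>- (1 + \<alpha>)\<close> is the conjugate of \<alpha>.\<close>
  proof (rule cI[of "1/4" _ "e/4" _ "- d * (1 + \<alpha>) / 4"])
    show "1/4 * 1 + e/4 * e + - d * (1 + \<alpha>) / 4 * (d * \<alpha>) = 1" using ee(1,2) \<alpha> by algebra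
    fix x y z s assume s: "s = 2 * (1/4 * x + e/4 * y + - d * (1 + \<alpha>) / 4 * z)"
    have "2 * s = x + e * y - (1 + \<alpha>) * (d * z)" unfolding s by (simp add: field_simps)
    from core[OF this] have "?G (1 * (x - s)) (e * (e * y - s)) (d * (d * z - \<alpha> * s)) = ?G (1 * x) (e * y) (d * z)"
      unfolding sg[OF me(2) e d, of "x - s"] by simp
    then have "?G (1 * (x - s)) (e * (e * y - s)) (d * (d * z - \<alpha> * s)) = ?G x y z"
      unfolding sg[OF me(2) e d, of x] .
    then show "?G (x - s * 1) (y - s * e) (z - s * (d * \<alpha>)) = ?G x y z"
      by (simp add: algebra_simps ee)
  qed
  show "klein_center \<alpha> (1, d * \<alpha>, e)"
  proof (rule cI[of "1/4" _ "- d * (1 + \<alpha>) / 4" _ "e/4"])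
    show "1/4 * 1 + - d * (1 + \<alpha>) / 4 * (d * \<alpha>) + e/4 * e = 1" using ee(1,2) \<alpha> by algebra
    fix x y z s assume s: "s = 2 * (1/4 * x + - d * (1 + \<alpha>) / 4 * y + e/4 * z)"
    have "2 * s = x + e * z - (1 + \<alpha>) * (d * y)" unfolding s by (simp add: field_simps)
    from core2[OF this] have "?G (1 * (x - s)) (d * (d * y - \<alpha> * s)) (e * (e * z - s)) = ?G (1 * x) (d * y) (e * z)"
      unfolding sg[OF me(2) d e, of "x - s"] by simp
    then have "?G (1 * (x - s)) (d * (d * y - \<alpha> * s)) (e * (e * z - s)) = ?G x y z"
      unfolding sg[OF me(2) d e, of x] .
    then show "?G (x - s * 1) (y - s * (d * \<alpha>)) (z - s * e) = ?G x y z"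
      by (simp add: algebra_simps ee)
  qed
  show "klein_center \<alpha> (1, e * \<gamma>, d * \<gamma>)"
  \<comment> \<open>The same recipe with squared length 2; the conjugate of \<gamma> is
    \<open>\<alpha> / 2\<close>.\<close>
  proof (rule cI[of "1/2" _ "e * \<alpha> / 4" _ "d * \<alpha> / 4"])
    show "1/2 * 1 + e * \<alpha> / 4 * (e * \<gamma>) + d * \<alpha> / 4 * (d * \<gamma>) = 1" using ee(1,2) \<gamma> by algebra
    fix x y z s assume s: "s = 2 * (1/2 * x + e * \<alpha> / 4 * y + d * \<alpha> / 4 * z)"
    \<comment> \<open>Rescales the root to \<open>(\<alpha>, e, d)\<close>, a signed permutation of
      \<open>(1, 1, \<alpha>)\<close> to which \<open>core3\<close> applies.\<close>
    define t where "t = \<gamma> * s"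
    have st: "\<alpha> * t = s" using \<gamma> by (simp add: t_def flip: mult.assoc)
    have s2: "2 * s = 2 * x + \<alpha> * (e * y + d * z)" unfolding s by (simp add: field_simps)
    have "\<alpha> * (2 * t) = \<alpha> * (e * y + d * z - (1 + \<alpha>) * x)"
      using s2 aa unfolding st[symmetric] by algebra
    moreover have "\<alpha> \<noteq> 0" using \<gamma> by auto
    ultimately have "2 * t = d * z + e * y - (1 + \<alpha>) * x" by simp
    from core3[OF this] have "?G (1 * (x - \<alpha> * t)) (e * (e * y - t)) (d * (d * z - t)) = ?G (1 * x) (e * y) (d * z)"
      unfolding sg[OF me(2) e d, of "x - \<alpha> * t"] by simp
    then have "?G (1 * (x - \<alpha> * t)) (e * (e * y - t)) (d * (d * z - t)) = ?G x y z"
      unfolding sg[OF me(2) e d, of x] .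
    then show "?G (x - s * 1) (y - s * (e * \<gamma>)) (z - s * (d * \<gamma>)) = ?G x y z"
      by (simp add: algebra_simps ee st) (simp add: t_def algebra_simps)
  qed
qed

text \<open>The first nonzero coordinate is 1, so that distinct triples give distinct points; the
  roots \<open>(\<alpha>, 1, 1)\<close> up to signs are therefore divided by \<alpha>, which brings
  in \<gamma>. The count is 3 + 6 + 4 + 4 + 4.\<close>

definition klein_points :: "complex \<Rightarrow> complex \<Rightarrow> (complex \<times> complex \<times> complex) set" where
  "klein_points \<alpha> \<gamma> = {(1, 0, 0), (0, 1, 0), (0, 0, 1), (0, 1, 1), (0, 1, -1), (1, 0, 1), (1, 0, -1),
     (1, 1, 0), (1, -1, 0), (1, 1, \<alpha>), (1, 1, - \<alpha>), (1, -1, \<alpha>), (1, -1, - \<alpha>),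
     (1, \<alpha>, 1), (1, - \<alpha>, 1), (1, \<alpha>, -1), (1, - \<alpha>, -1),
     (1, \<gamma>, \<gamma>), (1, \<gamma>, - \<gamma>), (1, - \<gamma>, \<gamma>), (1, - \<gamma>, - \<gamma>)}"

lemma card_klein_points:
  assumes "\<alpha>\<^sup>2 + \<alpha> + 2 = 0" "\<alpha> * \<gamma> = 1" shows "card (klein_points \<alpha> \<gamma>) = 21"
proof -
  have g2: "2 * \<gamma> = - 1 - \<alpha>" using assms by algebra
  have "\<alpha> \<noteq> 0" "\<alpha> \<noteq> 1" "\<alpha> \<noteq> - 1" using assms(1) by auto
  moreover from this have "\<gamma> \<noteq> 0" "\<gamma> \<noteq> 1" using assms(2) by auto
  moreover have "\<gamma> \<noteq> - 1"
  proof
    assume "\<gamma> = - 1"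
    then have "\<alpha> = - 1" using assms(2) by algebra
    then show False using \<open>\<alpha> \<noteq> - 1\<close> by simp
  qed
  moreover have "\<alpha> \<noteq> - \<alpha>" "\<gamma> \<noteq> - \<gamma>" using \<open>\<alpha> \<noteq> 0\<close> \<open>\<gamma> \<noteq> 0\<close> by simp_all
  moreover have "- \<alpha> \<noteq> 1" "- \<gamma> \<noteq> 1" using \<open>\<alpha> \<noteq> - 1\<close> \<open>\<gamma> \<noteq> - 1\<close> by (metis minus_minus)+
  moreover have "(1::complex) \<noteq> - 1" by simp
  ultimately show ?thesis by (auto simp: klein_points_def card_insert_if)
qed

lemma inj_on_span_normalized:
  "inj_on (\<lambda>t. vec.span {vec3 t}) {(x, y, z). x = 1 \<or> (x = 0 \<and> y = 1) \<or> (x = 0 \<and> y = 0 \<and> z = 1)}"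
proof (rule inj_onI)
  fix t t' assume t: "t \<in> {(x, y, z). x = 1 \<or> (x = 0 \<and> y = 1) \<or> (x = 0 \<and> y = 0 \<and> z = 1)}"
    "t' \<in> {(x, y, z). x = 1 \<or> (x = 0 \<and> y = 1) \<or> (x = 0 \<and> y = 0 \<and> z = 1)}"
    and eq: "vec.span {vec3 t} = vec.span {vec3 t'}"
  obtain x y z x' y' z' where xyz: "t = (x, y, z)" "t' = (x', y', z')" by (metis prod_cases3)
  have n: "x = 1 \<or> (x = 0 \<and> y = 1) \<or> (x = 0 \<and> y = 0 \<and> z = 1)"
    "x' = 1 \<or> (x' = 0 \<and> y' = 1) \<or> (x' = 0 \<and> y' = 0 \<and> z' = 1)" using t by (simp_all add: xyz)
  obtain c where "vec3 (x, y, z) = c *s vec3 (x', y', z')" using span1_eqD[OF eq] unfolding xyz by blast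
  then have "x = c * x'" "y = c * y'" "z = c * z'" by (simp_all add: vec_eq_iff forall_3)
  then show "t = t'" using n by (auto simp: xyz)
qed

text \<open>The listed roots give at least 21 centers and the general bound at most 21, so neither
  the bitangents nor the automorphism group have to be determined.\<close>

lemma klein_quadruple_points:
  assumes l: "l\<^sup>2 + 3 * l + 18 = 0"
  shows "card (quadruple_points (bitangents (klein_quartic l))) = 21"
proof -
  define \<alpha> \<gamma> where "\<alpha> = l / 3" and "\<gamma> = 1 / \<alpha>"
  have l3: "l = 3 * \<alpha>" by (simp add: \<alpha>_def)
  have a: "\<alpha>\<^sup>2 + \<alpha> + 2 = 0" using l unfolding l3 by algebra
  then have "\<alpha> \<noteq> 0" by auto
  then have g: "\<alpha> * \<gamma> = 1" by (simp add: \<gamma>_def)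
  have F: "smooth_form (eval (klein_quartic l))" using klein_quartic_smooth[OF l] smooth_quartic_iff by blast
  have sub: "(\<lambda>t. vec.span {vec3 t}) ` klein_points \<alpha> \<gamma> \<subseteq> centers (eval (klein_quartic l))"
    using klein_centers[OF a g, of 1 1] klein_centers[OF a g, of 1 "-1"]
      klein_centers[OF a g, of "-1" 1] klein_centers[OF a g, of "-1" "-1"]
    by (simp add: klein_points_def l3)
  have "inj_on (\<lambda>t. vec.span {vec3 t}) (klein_points \<alpha> \<gamma>)"
    by (rule inj_on_subset[OF inj_on_span_normalized]) (auto simp: klein_points_def)
  then have "card ((\<lambda>t. vec.span {vec3 t}) ` klein_points \<alpha> \<gamma>) = 21"
    by (simp add: card_image card_klein_points[OF a g])
  then have "21 \<le> card (centers (eval (klein_quartic l)))"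
    using card_mono[OF centers_le_21(1)[OF F] sub] by simp
  then show ?thesis
    using centers_le_21(2)[OF F] quadruple_points_eq[OF klein_quartic_smooth[OF l]] by simp
qed

text \<open>Finiteness is asserted separately because \<open>card\<close> is 0 on infinite sets,
  where the equality and the bound alone would say little.\<close>

theorem proposition3p7:
  "(\<forall>F. smooth_quartic F \<longrightarrow>
      finite (quadruple_points (bitangents F)) \<and> finite (involutions F) \<and>
      card (quadruple_points (bitangents F)) = card (involutions F) \<and>
      card (quadruple_points (bitangents F)) \<le> 21) \<and>
   (\<forall>l. l\<^sup>2 + 3 * l + 18 = 0 \<longrightarrow>
      smooth_quartic (klein_quartic l) \<and>
      card (quadruple_points (bitangents (klein_quartic l))) = 21)"
proof (intro conjI allI impI)
  fix F assume sm: "smooth_quartic F"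
  then have F: "smooth_form (eval F)" by (simp add: smooth_quartic_iff)
  obtain g where g: "bij_betw g (centers (eval F)) (involutions F)"
    using bij_betw_centers_involutions[OF sm] by blast
  show "finite (quadruple_points (bitangents F))" "card (quadruple_points (bitangents F)) \<le> 21"
    unfolding quadruple_points_eq[OF sm] using centers_le_21[OF F] by blast+
  show "finite (involutions F)" using bij_betw_finite[OF g] centers_le_21(1)[OF F] by simp
  show "card (quadruple_points (bitangents F)) = card (involutions F)"
    unfolding quadruple_points_eq[OF sm] by (rule bij_betw_same_card[OF g])
qed (simp_all add: klein_quartic_smooth klein_quadruple_points)

end
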